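(* Let $X=\{X_t:t\ge0\}$ be a spectrally positive Lévy process with Lévy measure $\nu$ such that the function $x\mapsto\nu(x,\infty)$ is regularly varying at infinity with index $-\alpha$ for some $\alpha\in(1,2)$. Let $\mu=\mathbb{E}X_1$, assume $\mu>0$, and set $\rho(a)=\mu/a$ for $a>\mu$. Let $$r(s)=\int_0^\infty\left(e^{-sx}-1+sx\right)\nu(dx),\qquad s\ge 0,$$ let $d(x)>0$, for $x\in(0,1)$, be such that $$r(d(x))\sim d(x)\,\frac{1-x}{x}\,\mu^{\alpha}\quad\text{as } x\uparrow 1,$$ and let $\Delta(x)=d(x)/\mu$. Then $$\Delta(\rho(a))\,\sup_{t\ge 0}(X_t-at)\xrightarrow{d}\mathscr{ML}_{\alpha-1}\quad\text{as }\rho(a)\uparrow 1.$$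
   Context: A Lévy process is a real-valued process with $X_0=0$, stationary independent increments (with respect to a standard filtration) and càdlàg paths; all Lévy processes considered are nondeterministic, i.e. $\sigma^2+\nu(\mathbb{R}\setminus\{0\})>0$, where $\sigma^2$ is the Gaussian coefficient and $\nu$ the Lévy measure on $\mathbb{R}\setminus\{0\}$, satisfying $\int(1\wedge x^2)\,\nu(dx)<\infty$. $X$ is spectrally positive if $\nu(-\infty,0)=0$. For $f,g$, the notation $f(x)\sim g(x)$ as $x\to x_0$ means $\lim_{x\to x_0}f(x)/g(x)=1$. For $\beta\in(0,1]$, $\mathscr{ML}_\beta$ denotes a positive random variable with the Mittag--Leffler distribution with parameter $\beta$, i.e. with Laplace--Stieltjes transform $\mathbb{E}\exp(-s\,\mathscr{ML}_\beta)=\frac{1}{1+s^\beta}$, $s\ge0$. $\xrightarrow{d}$ denotes convergence in distribution. *)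

theory Defs
  imports "HOL-Probability.Probability"
begin

text \<open>Time is \<^typ>\<open>real\<close>, restricted to nonnegative values. The members of the filtration at negative
  times play no role. ``Standard'' means the usual conditions: right-continuity, and all subsets of
  null sets belong to the initial sigma-algebra.\<close>

definition standard_filtration :: "'a measure \<Rightarrow> (real \<Rightarrow> 'a measure) \<Rightarrow> bool" where
  "standard_filtration M F \<longleftrightarrow>
     filtration (space M) F \<and>
     (\<forall>t\<ge>0. sets (F t) \<subseteq> sets M) \<and>
     complete_measure M \<and>
     null_sets M \<subseteq> sets (F 0) \<and>
     (\<forall>t\<ge>0. sets (F t) = (\<Inter>s\<in>{t<..}. sets (F s)))"

definition cadlag :: "(real \<Rightarrow> real) \<Rightarrow> bool" where
  "cadlag f \<longleftrightarrow>
     (\<forall>t\<ge>0. continuous (at_right t) f) \<and>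
     (\<forall>t>0. \<exists>l. (f \<longlongrightarrow> l) (at_left t))"

definition levy_process ::
  "'a measure \<Rightarrow> (real \<Rightarrow> 'a measure) \<Rightarrow> (real \<Rightarrow> 'a \<Rightarrow> real) \<Rightarrow> bool" where
  "levy_process M F X \<longleftrightarrow>
     prob_space M \<and>
     standard_filtration M F \<and>
     (\<forall>t\<ge>0. X t \<in> borel_measurable (F t)) \<and>
     (\<forall>\<omega>\<in>space M. X 0 \<omega> = 0) \<and>
     (\<forall>s t. 0 \<le> s \<and> s \<le> t \<longrightarrow>
        prob_space.indep_set M (sets (F s))
          (sets (vimage_algebra (space M) (\<lambda>\<omega>. X t \<omega> - X s \<omega>) borel))) \<and>
     (\<forall>s t. 0 \<le> s \<and> s \<le> t \<longrightarrow>
        distr M borel (\<lambda>\<omega>. X t \<omega> - X s \<omega>) = distr M borel (X (t - s))) \<and>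
     (\<forall>\<omega>\<in>space M. cadlag (\<lambda>t. X t \<omega>))"

text \<open>A measure on the punctured line is represented by a Borel measure on the line that does not
  charge the origin.\<close>

definition levy_measure :: "real measure \<Rightarrow> bool" where
  "levy_measure \<nu> \<longleftrightarrow>
     sets \<nu> = sets borel \<and>
     emeasure \<nu> {0} = 0 \<and>
     (\<integral>\<^sup>+x. ennreal (min 1 (x\<^sup>2)) \<partial>\<nu>) < \<infinity>"

definition levy_exponent :: "real \<Rightarrow> real \<Rightarrow> real measure \<Rightarrow> real \<Rightarrow> complex" where
  "levy_exponent \<gamma> \<sigma> \<nu> \<theta> =
     \<i> * of_real (\<gamma> * \<theta>) - of_real (\<sigma>\<^sup>2 * \<theta>\<^sup>2 / 2) +
     (CLINT x|\<nu>. iexp (\<theta> * x) - 1 - \<i> * of_real (\<theta> * x * indicator {-1<..<1} x))"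

text \<open>The Gaussian coefficient \<open>\<sigma>\<^sup>2\<close> and the Levy measure of a process are those of its
  Levy--Khintchine representation.\<close>

definition has_levy_triplet ::
  "'a measure \<Rightarrow> (real \<Rightarrow> 'a \<Rightarrow> real) \<Rightarrow> real \<Rightarrow> real \<Rightarrow> real measure \<Rightarrow> bool" where
  "has_levy_triplet M X \<gamma> \<sigma> \<nu> \<longleftrightarrow>
     levy_measure \<nu> \<and>
     (\<forall>t\<ge>0. \<forall>\<theta>. char (distr M borel (X t)) \<theta> = exp (of_real t * levy_exponent \<gamma> \<sigma> \<nu> \<theta>))"

definition nondeterministic :: "real \<Rightarrow> real measure \<Rightarrow> bool" where
  "nondeterministic \<sigma> \<nu> \<longleftrightarrow> ennreal (\<sigma>\<^sup>2) + emeasure \<nu> (- {0}) > 0"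

definition spectrally_positive :: "real measure \<Rightarrow> bool" where
  "spectrally_positive \<nu> \<longleftrightarrow> emeasure \<nu> {..<0} = 0"

text \<open>Positivity and measurability are only required near infinity; a tail \<open>measure \<nu> {x<..}\<close> of a
  Levy measure need not be finite for \<open>x \<le> 0\<close>.\<close>

definition regularly_varying_at_infinity :: "(real \<Rightarrow> real) \<Rightarrow> real \<Rightarrow> bool" where
  "regularly_varying_at_infinity f \<kappa> \<longleftrightarrow>
     (\<exists>c>0. (\<forall>x\<ge>c. f x > 0) \<and> f \<in> borel_measurable (restrict_space borel {c..})) \<and>
     (\<forall>l>0. ((\<lambda>x. f (l * x) / f x) \<longlongrightarrow> l powr \<kappa>) at_top)"

definition jump_exponent :: "real measure \<Rightarrow> real \<Rightarrow> real" where
  "jump_exponent \<nu> s = (LINT x:{0<..}|\<nu>. exp (- s * x) - 1 + s * x)"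

definition mittag_leffler_distribution :: "real \<Rightarrow> real measure \<Rightarrow> bool" where
  "mittag_leffler_distribution \<beta> L \<longleftrightarrow>
     real_distribution L \<and>
     (AE x in L. 0 < x) \<and>
     (\<forall>s\<ge>0. (LINT x|L. exp (- s * x)) = 1 / (1 + s powr \<beta>))"

text \<open>Convergence in distribution along an arbitrary filter, extending \<^const>\<open>weak_conv_m\<close>.\<close>

definition weak_conv_along :: "('i \<Rightarrow> real measure) \<Rightarrow> real measure \<Rightarrow> 'i filter \<Rightarrow> bool" where
  "weak_conv_along Ms L G \<longleftrightarrow>
     (\<forall>x. isCont (cdf L) x \<longrightarrow> ((\<lambda>i. cdf (Ms i) x) \<longlongrightarrow> cdf L x) G)"

lemma weak_conv_along_sequentially: "weak_conv_along Ms L sequentially \<longleftrightarrow> weak_conv_m Ms L"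
  by (simp add: weak_conv_along_def weak_conv_m_def weak_conv_def)

text \<open>Since a real \<^const>\<open>Sup\<close> of an unbounded set is an unspecified constant, this is meaningful
  only on paths for which the supremum is finite; for \<open>a\<close> larger than the mean of \<open>X 1\<close> these have
  probability one.\<close>

definition all_time_sup :: "(real \<Rightarrow> 'a \<Rightarrow> real) \<Rightarrow> real \<Rightarrow> 'a \<Rightarrow> real" where
  "all_time_sup X a \<omega> = (SUP t\<in>{0..}. X t \<omega> - a * t)"

lemma heavy_traffic_filter:
  fixes \<mu> :: real
  assumes "\<mu> > 0"
  shows "inf (filtercomap (\<lambda>a. \<mu> / a) (at_left 1)) (principal {\<mu><..}) = at_right \<mu>"
proof (rule antisym)
  show "inf (filtercomap (\<lambda>a. \<mu> / a) (at_left 1)) (principal {\<mu><..}) \<le> at_right \<mu>"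
  proof (rule filter_leI)
    fix P assume "eventually P (at_right \<mu>)"
    then obtain b where b: "b > \<mu>" "\<And>y. \<mu> < y \<Longrightarrow> y < b \<Longrightarrow> P y"
      by (auto simp: eventually_at_right_field)
    have ev: "eventually (\<lambda>x. \<mu> / b < x) (at_left (1::real))"
      using b(1) assms by (intro eventually_at_leftI[of "\<mu> / b"]) (auto simp: field_simps)
    have "P y" if "\<mu> / b < \<mu> / y" "y > \<mu>" for y
    proof -
      have "y < b"
        using that assms b(1) by (simp add: field_simps)
      then show ?thesis
        using b(2) that by blast
    qed
    then show "eventually P (inf (filtercomap (\<lambda>a. \<mu> / a) (at_left 1)) (principal {\<mu><..}))"
      unfolding eventually_inf_principal eventually_filtercomap
      by (intro exI[of _ "\<lambda>x. \<mu> / b < x"]) (use ev in auto)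
  qed
next
  have "((\<lambda>a. \<mu> / a) \<longlongrightarrow> \<mu> / \<mu>) (at_right \<mu>)"
    using assms by (intro tendsto_intros) auto
  moreover have "eventually (\<lambda>a. \<mu> / a < 1) (at_right \<mu>)"
    using assms by (intro eventually_at_rightI[of \<mu> "\<mu> + 1"]) auto
  ultimately have "filterlim (\<lambda>a. \<mu> / a) (at_left 1) (at_right \<mu>)"
    using assms by (auto simp: filterlim_at elim: eventually_mono)
  then show "at_right \<mu> \<le> inf (filtercomap (\<lambda>a. \<mu> / a) (at_left 1)) (principal {\<mu><..})"
    by (auto simp: filterlim_iff_le_filtercomap at_within_def)
qed

end

theory Submission
  imports Defs "HOL-Real_Asymp.Real_Asymp"
begin

text \<open>Put \<open>\<phi> s = (a - \<mu>) * s + \<sigma>\<^sup>2 * s\<^sup>2 / 2 + r s\<close>, so that \<open>E exp (- s * (X t - a * t)) = exp (t * \<phi> s)\<close>. The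
generalised Pollaczek--Khinchine formula says that the all-time supremum of \<open>X t - a * t\<close> has
the Laplace transform \<open>(a - \<mu>) * s / \<phi> s\<close>. At \<open>s = k * \<Delta>\<close> this is the inverse of
\<open>1 + \<sigma>\<^sup>2 * s / (2 * (a - \<mu>)) + r s / (s * (a - \<mu>))\<close>. Because the tail of \<open>\<nu>\<close> is regularly varying with
index \<open>- \<alpha>\<close>, the function \<open>r\<close> is regularly varying at \<open>0\<close> with index \<open>\<alpha>\<close>, and by the choice of
\<open>d\<close> the last term tends to \<open>k powr (\<alpha> - 1)\<close>, while the Gaussian term vanishes since
\<open>s\<^sup>2 = o(r s)\<close>. So the limit is the Mittag-Leffler transform, and convergence of Laplace transforms
gives convergence in distribution.

Four ingredients carry the argument. The formula itself is obtained in a weak form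
(\<open>pollaczek_khinchine_bounds\<close>): the transform lies between \<open>(a - \<mu>) * s / \<phi> s\<close> and the same
expression with \<open>O(s\<^sup>2)\<close> added to the numerator, uniformly in \<open>a\<close>. That suffices, as \<open>s / (a - \<mu>)\<close>
tends to \<open>0\<close>. The bounds are proved for random walks, from the recursion that the maximum
over \<open>n + 1\<close> steps satisfies, and then the mesh of the time grid tends to \<open>0\<close>. Letting
\<open>s\<close> tend to \<open>0\<close> in the lower bound shows that the supremum is finite almost surely.

Second, the process is given by a characteristic function, whereas its one-sided exponential moments
are used. Its one-dimensional laws are limits of compound Poisson laws, whose Laplace
transforms are explicit, and these transforms pass to the limit (\<open>has_transforms_levy\<close>).

Third, \<open>r_regularly_varying\<close> is the Abelian theorem: \<open>r (1 / x)\<close> is up to an error \<open>O(1 / x\<^sup>2)\<close> the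
integral of \<open>(1 - exp (- u)) * \<nu>(u * x, \<infinity>)\<close> over \<open>u\<close>, and Potter bounds dominate the
integrand after division by \<open>\<nu>(x, \<infinity>)\<close>.

Fourth, \<open>laplace_continuity_along\<close> passes from Laplace transforms to distribution functions by
approximating with polynomials in \<open>exp (- x)\<close>.\<close>

section \<open>Convergence in distribution from Laplace transforms\<close>

text \<open>A cut-off in the variable \<open>y = exp (- x)\<close>: as a function of \<open>x\<close> it is \<open>1\<close> up to \<open>a\<close>, vanishes from \<open>b\<close> on,
and is continuous in between.\<close>

definition exp_ramp :: "real \<Rightarrow> real \<Rightarrow> real \<Rightarrow> real" where
  "exp_ramp a b y = max 0 (min 1 ((y - exp (- b)) / (exp (- a) - exp (- b))))"

lemma exp_ramp_bounds: "0 \<le> exp_ramp a b y" "exp_ramp a b y \<le> 1"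
  by (auto simp: exp_ramp_def)

lemma continuous_on_exp_ramp: "continuous_on S (exp_ramp a b)"
proof (cases "a = b")
  case True
  then show ?thesis by (simp add: exp_ramp_def [abs_def])
next
  case False
  then show ?thesis
    unfolding exp_ramp_def [abs_def] by (intro continuous_intros) auto
qed

lemma borel_measurable_exp_ramp [measurable]: "exp_ramp a b \<in> borel_measurable borel"
  by (rule borel_measurable_continuous_onI) (rule continuous_on_exp_ramp)

text \<open>Continuous functions of \<open>exp (- x)\<close> can be approximated by polynomials, indicators cannot; the ramp
stands in for the latter at the cost of a slightly shifted argument.\<close>

lemma cdf_exp_ramp:
  assumes N: "real_distribution N" and ab: "a < b"
  shows "cdf N a \<le> (LINT x|N. exp_ramp a b (exp (- x)))"
    and "(LINT x|N. exp_ramp a b (exp (- x))) \<le> cdf N b"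
proof -
  interpret real_distribution N by fact
  have pos: "exp (- b) < exp (- a)" using ab by simp
  have int: "integrable N (\<lambda>x. exp_ramp a b (exp (- x)))"
    by (rule integrable_const_bound[where B=1]) (auto simp: exp_ramp_bounds)
  have lo: "indicator {..a} x \<le> exp_ramp a b (exp (- x))" for x
  proof (cases "x \<le> a")
    case True
    then have "exp (- a) - exp (- b) \<le> exp (- x) - exp (- b)" by simp
    then have "1 \<le> (exp (- x) - exp (- b)) / (exp (- a) - exp (- b))"
      using pos by (simp add: field_simps)
    then show ?thesis by (simp add: exp_ramp_def)
  qed (simp add: exp_ramp_bounds)
  have hi: "exp_ramp a b (exp (- x)) \<le> indicator {..b} x" for x
  proof (cases "x \<le> b")
    case False
    then have "exp (- x) - exp (- b) \<le> 0" by simp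
    then have "(exp (- x) - exp (- b)) / (exp (- a) - exp (- b)) \<le> 0"
      using pos by (intro divide_nonpos_pos) auto
    then show ?thesis by (simp add: exp_ramp_def)
  qed (simp add: exp_ramp_bounds)
  have "cdf N a = (LINT x|N. indicator {..a} x)" by (simp add: cdf_def)
  also have "\<dots> \<le> (LINT x|N. exp_ramp a b (exp (- x)))"
    by (intro integral_mono int lo integrable_const_bound[where B=1]) auto
  finally show "cdf N a \<le> (LINT x|N. exp_ramp a b (exp (- x)))" .
  have "(LINT x|N. exp_ramp a b (exp (- x))) \<le> (LINT x|N. indicator {..b} x)"
    by (intro integral_mono int hi integrable_const_bound[where B=1]) auto
  then show "(LINT x|N. exp_ramp a b (exp (- x))) \<le> cdf N b" by (simp add: cdf_def)
qed

text \<open>On the half-line \<open>exp (- x)\<close> stays in the unit interval, where \<open>f\<close> is close to the polynomial, and the powers of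
\<open>exp (- x)\<close> integrate to values of the Laplace transform at integers.\<close>

lemma nonneg_laplace_polynomial_approx:
  fixes f :: "real \<Rightarrow> real"
  assumes N: "real_distribution N" and nn: "AE x in N. 0 \<le> x"
    and f: "f \<in> borel_measurable borel" "\<And>y. \<bar>f y\<bar> \<le> 1"
    and p: "\<And>y. 0 \<le> y \<Longrightarrow> y \<le> 1 \<Longrightarrow> \<bar>f y - (\<Sum>k\<le>n. c k * y ^ k)\<bar> < e"
  shows "\<bar>(LINT x|N. f (exp (- x))) - (\<Sum>k\<le>n. c k * (LINT x|N. exp (- real k * x)))\<bar> \<le> e"
proof -
  interpret real_distribution N by fact
  have [measurable]: "f \<in> borel_measurable borel" by fact
  have int: "integrable N (\<lambda>x. f (exp (- x)))"
    by (rule integrable_const_bound[where B=1]) (auto simp: f)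
  have intk: "integrable N (\<lambda>x. exp (- real k * x))" for k
    by (rule integrable_const_bound[where B=1]) (use nn in \<open>auto elim!: eventually_mono\<close>)
  have "(LINT x|N. f (exp (- x))) - (\<Sum>k\<le>n. c k * (LINT x|N. exp (- real k * x)))
      = (LINT x|N. f (exp (- x)) - (\<Sum>k\<le>n. c k * exp (- real k * x)))"
    using int intk by (simp add: Bochner_Integration.integral_sum)
  moreover have "\<bar>\<dots>\<bar> \<le> (LINT x|N. \<bar>f (exp (- x)) - (\<Sum>k\<le>n. c k * exp (- real k * x))\<bar>)"
    by (rule integral_abs_bound)
  moreover have "\<dots> \<le> (LINT x|N. e)"
  proof (rule integral_mono_AE)
    show "integrable N (\<lambda>x. \<bar>f (exp (- x)) - (\<Sum>k\<le>n. c k * exp (- real k * x))\<bar>)"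
      using int intk by (intro integrable_abs Bochner_Integration.integrable_diff
          Bochner_Integration.integrable_sum integrable_mult_right)
    show "AE x in N. \<bar>f (exp (- x)) - (\<Sum>k\<le>n. c k * exp (- real k * x))\<bar> \<le> e"
      using nn
    proof eventually_elim
      case (elim x)
      have "exp (- real k * x) = exp (- x) ^ k" for k
        by (simp add: exp_of_nat_mult [symmetric])
      then show ?case using p[of "exp (- x)"] elim by simp
    qed
  qed auto
  moreover have "(LINT x|N. e) = e" using prob_space by simp
  ultimately show ?thesis by linarith
qed

text \<open>By Weierstrass' theorem the values of the Laplace transform at the integers determine the integrals of all
ramps. Each of the given laws is compared with \<open>L\<close> through one fixed polynomial, so the argument works along any filter.\<close>

theorem laplace_continuity_along:
  fixes Ms :: "'i \<Rightarrow> real measure"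
  assumes L: "real_distribution L" "AE x in L. 0 \<le> x"
    and Ms: "eventually (\<lambda>i. real_distribution (Ms i) \<and> (AE x in Ms i. 0 \<le> x)) G"
    and conv: "\<And>k::nat. 0 < k \<Longrightarrow>
      ((\<lambda>i. LINT x|Ms i. exp (- real k * x)) \<longlongrightarrow> (LINT x|L. exp (- real k * x))) G"
  shows "weak_conv_along Ms L G"
proof -
  interpret L: real_distribution L by fact
  have ramp: "((\<lambda>i. LINT x|Ms i. exp_ramp a b (exp (- x))) \<longlongrightarrow>
      (LINT x|L. exp_ramp a b (exp (- x)))) G" for a b
  proof (rule tendstoI)
    fix e :: real assume e: "0 < e"
    \<comment> \<open>A polynomial within \<open>e / 4\<close> of the ramp leaves room for an error of \<open>e / 4\<close> in each of the two
      integrals and in the convergence of the transforms.\<close>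
    obtain g where g: "real_polynomial_function g"
      "\<And>y. y \<in> {0..1} \<Longrightarrow> norm (exp_ramp a b y - g y) < e / 4"
      using Stone_Weierstrass_real_polynomial_function[OF compact_Icc continuous_on_exp_ramp, of "e / 4" 0 1 a b]
        e by auto
    then obtain c n where gc: "g = (\<lambda>x. \<Sum>k\<le>n. c k * x ^ k)"
      by (auto simp: real_polynomial_function_iff_sum)
    have bd: "\<bar>exp_ramp a b y\<bar> \<le> 1" for y using exp_ramp_bounds[of a b y] by simp
    have p: "\<bar>exp_ramp a b y - (\<Sum>k\<le>n. c k * y ^ k)\<bar> < e / 4" if "0 \<le> y" "y \<le> 1" for y
      using g(2)[of y] that by (simp add: gc)
    note appr = nonneg_laplace_polynomial_approx[OF _ _ borel_measurable_exp_ramp bd p]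
    have "((\<lambda>i. LINT x|Ms i. exp (- real k * x)) \<longlongrightarrow> (LINT x|L. exp (- real k * x))) G" for k
    proof (cases "k = 0")
      case True
      have "((\<lambda>i. 1) \<longlongrightarrow> (1::real)) G" by simp
      moreover have "eventually (\<lambda>i. (LINT x|Ms i. exp (- real k * x)) = 1) G"
        using Ms
      proof eventually_elim
        case (elim i)
        then interpret real_distribution "Ms i" by simp
        show ?case using True prob_space by simp
      qed
      ultimately show ?thesis using True L.prob_space by (simp add: tendsto_cong)
    qed (use conv in auto)
    then have "((\<lambda>i. \<Sum>k\<le>n. c k * (LINT x|Ms i. exp (- real k * x))) \<longlongrightarrow>
        (\<Sum>k\<le>n. c k * (LINT x|L. exp (- real k * x)))) G"
      by (intro tendsto_intros)
    then have "eventually (\<lambda>i. dist (\<Sum>k\<le>n. c k * (LINT x|Ms i. exp (- real k * x)))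
        (\<Sum>k\<le>n. c k * (LINT x|L. exp (- real k * x))) < e / 4) G"
      using e by (intro tendstoD) auto
    with Ms show "eventually (\<lambda>i. dist (LINT x|Ms i. exp_ramp a b (exp (- x)))
        (LINT x|L. exp_ramp a b (exp (- x))) < e) G"
    proof eventually_elim
      case (elim i)
      then have "real_distribution (Ms i)" "AE x in Ms i. 0 \<le> x" by auto
      from appr[OF this] appr[OF L] elim(2) e show ?case
        unfolding dist_real_def by linarith
    qed
  qed
  show ?thesis
    unfolding weak_conv_along_def
  proof (intro allI impI)
    fix x assume cont: "isCont (cdf L) x"
    show "((\<lambda>i. cdf (Ms i) x) \<longlongrightarrow> cdf L x) G"
    proof (rule order_tendstoI)
      fix u assume u: "cdf L x < u"
      have "eventually (\<lambda>z. cdf L z < u) (at x)"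
        using cont u by (auto simp: isCont_def intro: order_tendstoD)
      then have "eventually (\<lambda>z. cdf L z < u) (at_right x)"
        by (simp add: eventually_at_split)
      then obtain z where z: "x < z" "cdf L z < u"
        by (metis eventually_at_right_field dense)
      have "(LINT y|L. exp_ramp x z (exp (- y))) < u" using cdf_exp_ramp(2)[OF L(1) z(1)] z by simp
      from order_tendstoD(2)[OF ramp this] Ms show "eventually (\<lambda>i. cdf (Ms i) x < u) G"
      proof eventually_elim
        case (elim i)
        then show ?case using cdf_exp_ramp(1)[of "Ms i" x z] z by simp
      qed
    next
      fix u assume u: "u < cdf L x"
      have "eventually (\<lambda>z. u < cdf L z) (at x)"
        using cont u by (auto simp: isCont_def intro: order_tendstoD)
      then have "eventually (\<lambda>z. u < cdf L z) (at_left x)"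
        by (simp add: eventually_at_split)
      then obtain z where z: "z < x" "u < cdf L z"
        by (metis eventually_at_left_field dense)
      have "u < (LINT y|L. exp_ramp z x (exp (- y)))" using cdf_exp_ramp(1)[OF L(1) z(1)] z by simp
      from order_tendstoD(1)[OF ramp this] Ms show "eventually (\<lambda>i. u < cdf (Ms i) x) G"
      proof eventually_elim
        case (elim i)
        then show ?case using cdf_exp_ramp(2)[of "Ms i" z x] z by simp
      qed
    qed
  qed
qed

section \<open>The maximum of a random walk with negative drift\<close>

text \<open>The largest partial sum of at most \<open>n\<close> terms. Splitting off the first step makes the rest of the walk
independent of it and equal in law to a shorter walk, so that the recursion turns into one for
the laws.\<close>

primrec walk_max :: "nat \<Rightarrow> (nat \<Rightarrow> real) \<Rightarrow> real" where
  "walk_max 0 x = 0"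
| "walk_max (Suc n) x = max 0 (x 0 + walk_max n (\<lambda>i. x (Suc i)))"

lemma walk_max_nonneg: "0 \<le> walk_max n x"
  by (cases n) auto

lemma walk_max_le_Suc: "walk_max n x \<le> walk_max (Suc n) x"
proof (induction n arbitrary: x)
  case (Suc n)
  from Suc[of "\<lambda>i. x (Suc i)"] show ?case by (auto simp: max_def)
qed simp

lemma walk_max_le_sum_abs: "walk_max n x \<le> (\<Sum>i<n. \<bar>x i\<bar>)"
proof (induction n arbitrary: x)
  case (Suc n)
  from Suc[of "\<lambda>i. x (Suc i)"] have "x 0 + walk_max n (\<lambda>i. x (Suc i)) \<le> (\<Sum>i<Suc n. \<bar>x i\<bar>)"
    unfolding sum.lessThan_Suc_shift by linarith
  then show ?case by (simp add: sum_nonneg)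
qed simp

lemma partial_sum_le_walk_max: "k \<le> n \<Longrightarrow> (\<Sum>i<k. x i) \<le> walk_max n x"
proof (induction n arbitrary: x k)
  case (Suc n)
  show ?case
  proof (cases k)
    case (Suc j)
    with Suc.prems Suc.IH[of j "\<lambda>i. x (Suc i)"] show ?thesis
      unfolding Suc sum.lessThan_Suc_shift by simp
  qed simp
qed simp

lemma walk_max_attained: "\<exists>k\<le>n. walk_max n x = (\<Sum>i<k. x i)"
proof (induction n arbitrary: x)
  case (Suc n)
  obtain k where k: "k \<le> n" "walk_max n (\<lambda>i. x (Suc i)) = (\<Sum>i<k. x (Suc i))"
    using Suc by blast
  show ?case
  proof (cases "0 \<le> x 0 + walk_max n (\<lambda>i. x (Suc i))")
    case True
    then show ?thesis
      using k by (intro exI[of _ "Suc k"]) (simp add: sum.lessThan_Suc_shift del: sum.lessThan_Suc)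
  qed (auto intro!: exI[of _ 0])
qed simp

lemma measurable_walk_max [measurable]:
  "walk_max n \<in> borel_measurable (PiM UNIV (\<lambda>_. borel))"
proof (induction n)
  case (Suc n)
  have "(\<lambda>x. \<lambda>i. x (Suc i)) \<in> measurable (PiM UNIV (\<lambda>_. borel :: real measure)) (PiM UNIV (\<lambda>_. borel))"
    by (rule measurable_PiM_single') auto
  from measurable_compose[OF this Suc] have [measurable]:
    "(\<lambda>x. walk_max n (\<lambda>i. x (Suc i))) \<in> borel_measurable (PiM UNIV (\<lambda>_. borel))" .
  show ?case by simp
qed simp

text \<open>In the power series of the remainder every power of \<open>s\<close> is at least the second.\<close>

lemma exp_remainder_scale:
  fixes s l :: real
  assumes "0 \<le> s" "s \<le> 1" "0 \<le> l"
  shows "exp (s * l) - 1 - s * l \<le> s\<^sup>2 * (exp l - 1 - l)"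
proof -
  have eq: "exp x - 1 - x = (\<Sum>n. inverse (fact (n + 2)) * x ^ (n + 2))"
    and sm: "summable (\<lambda>n. inverse (fact (n + 2)) * x ^ (n + 2))" for x :: real
    using exp_first_two_terms[of x] summable_exp[THEN summable_ignore_initial_segment, where k=2]
    by (simp_all add: ac_simps)
  have "(\<Sum>n. inverse (fact (n + 2)) * (s * l) ^ (n + 2))
      \<le> (\<Sum>n. s\<^sup>2 * (inverse (fact (n + 2)) * l ^ (n + 2)))"
  proof (rule suminf_le)
    fix n
    have "s ^ (n + 2) \<le> s\<^sup>2" using assms by (intro power_decreasing) auto
    then have "s ^ (n + 2) * (inverse (fact (n + 2)) * l ^ (n + 2)) \<le> s\<^sup>2 * (inverse (fact (n + 2)) * l ^ (n + 2))"
      using assms by (intro mult_right_mono) auto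
    then show "inverse (fact (n + 2)) * (s * l) ^ (n + 2) \<le> s\<^sup>2 * (inverse (fact (n + 2)) * l ^ (n + 2))"
      by (simp only: power_mult_distrib mult.commute mult.left_commute mult.assoc)
  qed (intro sm summable_mult)+
  then show ?thesis unfolding eq by (simp only: suminf_mult[OF sm])
qed

text \<open>The last assumption identifies the slope of the Laplace transform at \<open>0\<close>. It is kept separate because for
Levy processes it is read off the exponent.\<close>

locale negative_drift_walk = prob_space M for M :: "'a measure" +
  fixes \<xi> :: "nat \<Rightarrow> 'a \<Rightarrow> real" and m :: real and \<kappa> :: "real \<Rightarrow> real"
  assumes indep: "indep_vars (\<lambda>_. borel) \<xi> UNIV"
    and same_law: "distr M borel (\<xi> i) = distr M borel (\<xi> 0)"
    and integrable_step: "integrable M (\<xi> 0)"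
    and mean_step: "expectation (\<xi> 0) = - m"
    and drift: "0 < m"
    and integrable_exp: "0 \<le> s \<Longrightarrow> integrable M (\<lambda>\<omega>. exp (- s * \<xi> 0 \<omega>))"
    and laplace: "0 \<le> s \<Longrightarrow> expectation (\<lambda>\<omega>. exp (- s * \<xi> 0 \<omega>)) = exp (\<kappa> s)"
    and kappa_slope: "((\<lambda>s. (exp (\<kappa> s) - 1) / s) \<longlongrightarrow> m) (at_right 0)"
begin

lemma measurable_step [measurable]: "\<xi> i \<in> borel_measurable M"
  using indep by (auto simp: indep_vars_def)

text \<open>One step turns the maximum \<open>later_max\<close> of the walk after the first step into \<open>max 0 (\<xi> 0 + later_max)\<close>; the
amount by which this exceeds \<open>\<xi> 0 + later_max\<close> is the reflection at \<open>0\<close>.\<close>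

definition "run_max n \<omega> = walk_max n (\<lambda>i. \<xi> i \<omega>)"
definition "later_max n \<omega> = walk_max n (\<lambda>i. \<xi> (Suc i) \<omega>)"
definition "reflection n \<omega> = max 0 (- (\<xi> 0 \<omega> + later_max n \<omega>))"

lemma measurable_seq [measurable]:
  "(\<lambda>\<omega> i. \<xi> i \<omega>) \<in> measurable M (PiM UNIV (\<lambda>_. borel))"
  "(\<lambda>\<omega> i. \<xi> (Suc i) \<omega>) \<in> measurable M (PiM UNIV (\<lambda>_. borel))"
  by (rule measurable_PiM_single'; simp)+

lemma measurable_run_max [measurable]: "run_max n \<in> borel_measurable M" "later_max n \<in> borel_measurable M"
  unfolding run_max_def [abs_def] later_max_def [abs_def] by measurable

lemma measurable_reflection [measurable]: "reflection n \<in> borel_measurable M"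
  unfolding reflection_def [abs_def] by measurable

lemma run_max_Suc: "run_max (Suc n) \<omega> = max 0 (\<xi> 0 \<omega> + later_max n \<omega>)"
  by (simp add: run_max_def later_max_def)

lemma run_max_nonneg: "0 \<le> run_max n \<omega>" "0 \<le> later_max n \<omega>"
  by (simp_all add: run_max_def later_max_def walk_max_nonneg)

text \<open>The whole sequence of steps has the law of an infinite product of equal factors, which reindexing by \<open>Suc\<close> preserves.\<close>

lemma distr_shift: "distr M borel (later_max n) = distr M borel (run_max n)"
proof -
  let ?Q = "distr M borel (\<xi> 0)"
  let ?P = "PiM UNIV (\<lambda>_::nat. ?Q)"
  have sets_P [measurable_cong]: "sets ?P = sets (PiM UNIV (\<lambda>_. borel))"
    by (intro sets_PiM_cong) auto
  have P: "distr M (PiM UNIV (\<lambda>_. borel)) (\<lambda>\<omega> i. \<xi> i \<omega>) = ?P"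
  proof -
    have "distr M (PiM UNIV (\<lambda>_. borel)) (\<lambda>\<omega> i. \<xi> i \<omega>) = PiM UNIV (\<lambda>i. distr M borel (\<xi> i))"
      using indep by (subst (asm) indep_vars_iff_distr_eq_PiM') (auto simp: restrict_UNIV)
    also have "(\<lambda>i. distr M borel (\<xi> i)) = (\<lambda>_. ?Q)"
      using same_law by blast
    finally show ?thesis .
  qed
  have shift_meas [measurable]: "(\<lambda>x i. x (Suc i)) \<in> measurable (PiM UNIV (\<lambda>_. borel)) (PiM UNIV (\<lambda>_. borel :: real measure))"
    by (rule measurable_PiM_single') auto
  have P': "distr ?P (PiM UNIV (\<lambda>_. borel)) (\<lambda>x i. x (Suc i)) = ?P"
  proof -
    have "distr ?P (PiM UNIV (\<lambda>_. borel)) (\<lambda>x i. x (Suc i)) = distr ?P ?P (\<lambda>x. \<lambda>n\<in>UNIV. x (Suc n))"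
      by (rule distr_cong) (auto simp: sets_P restrict_UNIV)
    also have "\<dots> = ?P"
      by (rule distr_PiM_reindex) (auto intro: prob_space_distr)
    finally show ?thesis .
  qed
  have "distr M borel (later_max n) = distr ?P borel (\<lambda>x. walk_max n (\<lambda>i. x (Suc i)))"
    unfolding P [symmetric] by (subst distr_distr) (auto simp: later_max_def [abs_def] comp_def)
  also have "\<dots> = distr (distr ?P (PiM UNIV (\<lambda>_. borel)) (\<lambda>x i. x (Suc i))) borel (walk_max n)"
    by (subst distr_distr) (auto simp: comp_def)
  also have "\<dots> = distr M borel (run_max n)"
    unfolding P' unfolding P [symmetric] by (subst distr_distr) (auto simp: run_max_def [abs_def] comp_def)
  finally show ?thesis .
qed

lemma integral_shift:
  fixes f :: "real \<Rightarrow> real"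
  assumes [measurable]: "f \<in> borel_measurable borel"
  shows "expectation (\<lambda>\<omega>. f (later_max n \<omega>)) = expectation (\<lambda>\<omega>. f (run_max n \<omega>))"
proof -
  have "expectation (\<lambda>\<omega>. f (later_max n \<omega>)) = integral\<^sup>L (distr M borel (later_max n)) f"
    by (subst integral_distr) auto
  also have "\<dots> = expectation (\<lambda>\<omega>. f (run_max n \<omega>))"
    unfolding distr_shift by (subst integral_distr) auto
  finally show ?thesis .
qed

lemma indep_first_rest: "indep_var borel (\<xi> 0) borel (later_max n)"
proof -
  have "indep_var (PiM {0} (\<lambda>_. borel)) (\<lambda>\<omega>. restrict (\<lambda>i. \<xi> i \<omega>) {0})
      (PiM {1..} (\<lambda>_. borel)) (\<lambda>\<omega>. restrict (\<lambda>i. \<xi> i \<omega>) {1..})"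
    by (rule indep_var_restrict[OF indep]) auto
  then have "indep_var borel ((\<lambda>x. x 0) \<circ> (\<lambda>\<omega>. restrict (\<lambda>i. \<xi> i \<omega>) {0}))
      borel ((\<lambda>x. walk_max n (\<lambda>i. x (Suc i))) \<circ> (\<lambda>\<omega>. restrict (\<lambda>i. \<xi> i \<omega>) {1..}))"
  proof (rule indep_var_compose)
    have "(\<lambda>x. \<lambda>i. x (Suc i)) \<in> measurable (PiM {1..} (\<lambda>_. borel :: real measure)) (PiM UNIV (\<lambda>_. borel))"
      by (rule measurable_PiM_single') auto
    from measurable_compose[OF this measurable_walk_max]
    show "(\<lambda>x. walk_max n (\<lambda>i. x (Suc i))) \<in> measurable (PiM {1..} (\<lambda>_. borel)) borel" .
  qed simp
  then show ?thesis by (simp add: comp_def later_max_def [abs_def])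
qed

lemma integrable_run_max: "integrable M (run_max n)" "integrable M (later_max n)"
proof -
  have int: "integrable M (\<xi> i)" for i
  proof -
    have "integrable (distr M borel (\<xi> i)) (\<lambda>x. x)"
      unfolding same_law[of i] using integrable_step by (subst integrable_distr_eq) auto
    then show ?thesis by (subst (asm) integrable_distr_eq) auto
  qed
  show "integrable M (run_max n)"
  proof (rule Bochner_Integration.integrable_bound)
    show "integrable M (\<lambda>\<omega>. \<Sum>i<n. \<bar>\<xi> i \<omega>\<bar>)" using int by auto
    show "AE \<omega> in M. norm (run_max n \<omega>) \<le> norm (\<Sum>i<n. \<bar>\<xi> i \<omega>\<bar>)"
      using walk_max_le_sum_abs[of n] by (auto simp: run_max_def walk_max_nonneg sum_nonneg)
  qed simp
  show "integrable M (later_max n)"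
  proof (rule Bochner_Integration.integrable_bound)
    show "integrable M (\<lambda>\<omega>. \<Sum>i<n. \<bar>\<xi> (Suc i) \<omega>\<bar>)" using int by auto
    show "AE \<omega> in M. norm (later_max n \<omega>) \<le> norm (\<Sum>i<n. \<bar>\<xi> (Suc i) \<omega>\<bar>)"
      using walk_max_le_sum_abs[of n] by (auto simp: later_max_def walk_max_nonneg sum_nonneg)
  qed simp
qed

lemma integrable_reflection: "integrable M (reflection n)"
  unfolding reflection_def [abs_def] using integrable_step integrable_run_max by auto

lemma integrable_exp_run_max:
  assumes "0 \<le> s"
  shows "integrable M (\<lambda>\<omega>. exp (- s * run_max n \<omega>))" "integrable M (\<lambda>\<omega>. exp (- s * later_max n \<omega>))"
  by (rule integrable_const_bound[where B=1]; use assms run_max_nonneg in \<open>auto\<close>)+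

text \<open>The recursion for the maximum becomes a linear recursion for its Laplace transform, \<open>reflection_laplace_eq\<close>
below, in which only the exponential moment of the reflection is not explicit.\<close>

definition "max_laplace s n = expectation (\<lambda>\<omega>. exp (- s * run_max n \<omega>))"
definition "reflection_laplace s n = expectation (\<lambda>\<omega>. exp (s * reflection n \<omega>) - 1)"

lemma
  assumes s: "0 \<le> s"
  shows integrable_exp_sum: "integrable M (\<lambda>\<omega>. exp (- s * (\<xi> 0 \<omega> + later_max n \<omega>)))"
    and expectation_exp_sum: "expectation (\<lambda>\<omega>. exp (- s * (\<xi> 0 \<omega> + later_max n \<omega>))) = exp (\<kappa> s) * max_laplace s n"
proof -
  have ind: "indep_var borel (\<lambda>\<omega>. exp (- s * \<xi> 0 \<omega>)) borel (\<lambda>\<omega>. exp (- s * later_max n \<omega>))"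
    using indep_var_compose[OF indep_first_rest, of "\<lambda>x. exp (- s * x)" borel "\<lambda>x. exp (- s * x)" borel n]
    by (simp add: comp_def)
  have eq: "exp (- s * (\<xi> 0 \<omega> + later_max n \<omega>)) = exp (- s * \<xi> 0 \<omega>) * exp (- s * later_max n \<omega>)" for \<omega>
    by (simp add: algebra_simps flip: exp_add)
  show "integrable M (\<lambda>\<omega>. exp (- s * (\<xi> 0 \<omega> + later_max n \<omega>)))"
    unfolding eq by (intro indep_var_integrable[OF ind] integrable_exp integrable_exp_run_max s)
  show "expectation (\<lambda>\<omega>. exp (- s * (\<xi> 0 \<omega> + later_max n \<omega>))) = exp (\<kappa> s) * max_laplace s n"
    unfolding eq max_laplace_def
    by (subst indep_var_lebesgue_integral[OF ind integrable_exp[OF s] integrable_exp_run_max(2)[OF s]])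
      (simp add: laplace[OF s, simplified] integral_shift[of "\<lambda>x. exp (- (s * x))"])
qed

text \<open>One of \<open>max 0 y\<close> and \<open>max 0 (- y)\<close> always vanishes, so \<open>exp (- s * max 0 y)\<close> and \<open>exp (s * max 0 (- y))\<close> add up to
\<open>exp (- s * y) + 1\<close>.\<close>

lemma exp_split: "exp (s * reflection n \<omega>) - 1 = exp (- s * (\<xi> 0 \<omega> + later_max n \<omega>)) - exp (- s * run_max (Suc n) \<omega>)"
  by (auto simp: reflection_def run_max_Suc max_def algebra_simps)

lemma integrable_exp_reflection: "0 \<le> s \<Longrightarrow> integrable M (\<lambda>\<omega>. exp (s * reflection n \<omega>) - 1)"
  unfolding exp_split by (intro Bochner_Integration.integrable_diff integrable_exp_sum integrable_exp_run_max)

lemma reflection_laplace_eq: "0 \<le> s \<Longrightarrow> reflection_laplace s n = exp (\<kappa> s) * max_laplace s n - max_laplace s (Suc n)"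
  unfolding reflection_laplace_def exp_split
  by (subst Bochner_Integration.integral_diff)
    (use integrable_exp_sum integrable_exp_run_max expectation_exp_sum in \<open>auto simp: max_laplace_def\<close>)

lemma run_max_le_Suc: "run_max n \<omega> \<le> run_max (Suc n) \<omega>"
  unfolding run_max_def by (rule walk_max_le_Suc)

text \<open>Taking means in \<open>max 0 y = y + max 0 (- y)\<close>: since the mean of the maximum grows with \<open>n\<close>, the reflection
must make up for the drift.\<close>

lemma mean_reflection_ge: "m \<le> expectation (reflection n)"
proof -
  have "expectation (run_max n) \<le> expectation (run_max (Suc n))"
    by (intro integral_mono integrable_run_max run_max_le_Suc)
  also have "run_max (Suc n) = (\<lambda>\<omega>. \<xi> 0 \<omega> + later_max n \<omega> + reflection n \<omega>)"
    by (auto simp: reflection_def run_max_Suc max_def)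
  also have "expectation (\<lambda>\<omega>. \<xi> 0 \<omega> + later_max n \<omega> + reflection n \<omega>) = - m + expectation (run_max n) + expectation (reflection n)"
    using integrable_step integrable_run_max integrable_reflection integral_shift[of "\<lambda>x. x" n]
    by (simp add: mean_step)
  finally show ?thesis by simp
qed

lemma mean_reflection_le: "0 \<le> s \<Longrightarrow> s * expectation (reflection n) \<le> reflection_laplace s n"
proof -
  assume s: "0 \<le> s"
  have "expectation (\<lambda>\<omega>. s * reflection n \<omega>) \<le> reflection_laplace s n"
    unfolding reflection_laplace_def
  proof (rule integral_mono)
    show "s * reflection n \<omega> \<le> exp (s * reflection n \<omega>) - 1" for \<omega>
      using exp_ge_add_one_self[of "s * reflection n \<omega>"] by linarith
  qed (use s in \<open>auto intro!: integrable_reflection integrable_exp_reflection\<close>)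
  then show ?thesis by simp
qed

text \<open>The reflection is at most the negative part of the first step, whatever the later maximum is; this bounds
the second-order term by the exponential moment of a single step.\<close>

lemma reflection_laplace_le:
  assumes s: "0 \<le> s" "s \<le> 1"
  shows "reflection_laplace s n \<le> s * expectation (reflection n) + s\<^sup>2 * (exp (\<kappa> 1) - 1 - m)"
proof -
  have int1: "integrable M (\<lambda>\<omega>. exp (- \<xi> 0 \<omega>) - 1 + \<xi> 0 \<omega>)"
    using integrable_exp[of 1] integrable_step by auto
  have "reflection_laplace s n \<le> expectation (\<lambda>\<omega>. s * reflection n \<omega> + s\<^sup>2 * (exp (- \<xi> 0 \<omega>) - 1 + \<xi> 0 \<omega>))"
    unfolding reflection_laplace_def
  proof (rule integral_mono)
    fix \<omega>
    have reflection: "0 \<le> reflection n \<omega>" "reflection n \<omega> \<le> max 0 (- \<xi> 0 \<omega>)"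
      using run_max_nonneg(2)[of n \<omega>] by (auto simp: reflection_def)
    have "exp (s * reflection n \<omega>) - 1 - s * reflection n \<omega> \<le> s\<^sup>2 * (exp (reflection n \<omega>) - 1 - reflection n \<omega>)"
      by (rule exp_remainder_scale[OF s reflection(1)])
    also have "exp (reflection n \<omega>) - 1 - reflection n \<omega> \<le> exp (- \<xi> 0 \<omega>) - 1 + \<xi> 0 \<omega>"
    proof (cases "reflection n \<omega> = 0")
      case True
      then show ?thesis using exp_ge_add_one_self[of "- \<xi> 0 \<omega>"] by simp
    next
      case False
      with reflection have le: "reflection n \<omega> \<le> - \<xi> 0 \<omega>" by linarith
      let ?d = "- \<xi> 0 \<omega> - reflection n \<omega>"
      have "?d \<le> exp ?d - 1" using exp_ge_add_one_self[of ?d] by linarith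
      also have "\<dots> \<le> exp (reflection n \<omega>) * (exp ?d - 1)"
        using reflection(1) le mult_right_mono[of 1 "exp (reflection n \<omega>)" "exp ?d - 1"] by simp
      also have "\<dots> = exp (- \<xi> 0 \<omega>) - exp (reflection n \<omega>)"
        by (simp add: algebra_simps flip: exp_add)
      finally show ?thesis by simp
    qed
    finally show "exp (s * reflection n \<omega>) - 1 \<le> s * reflection n \<omega> + s\<^sup>2 * (exp (- \<xi> 0 \<omega>) - 1 + \<xi> 0 \<omega>)"
      by (simp add: mult_left_mono)
  qed (use s int1 in \<open>auto intro!: integrable_reflection integrable_exp_reflection\<close>)
  also have "\<dots> = s * expectation (reflection n) + s\<^sup>2 * (exp (\<kappa> 1) - 1 - m)"
    using int1 integrable_reflection integrable_exp[of 1] integrable_step laplace[of 1] prob_space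
    by (simp add: mean_step)
  finally show ?thesis .
qed

text \<open>For \<open>s > 0\<close> this is the Laplace transform of the supremum of the walk, with the convention that it is \<open>0\<close> where the
supremum is infinite. It is defined as a limit since finiteness of the supremum is still open at this stage.\<close>

definition "sup_laplace s = lim (max_laplace s)"

lemma max_laplace_bounds: "0 \<le> s \<Longrightarrow> 0 \<le> max_laplace s n" "0 \<le> s \<Longrightarrow> max_laplace s n \<le> 1"
proof -
  assume s: "0 \<le> s"
  show "0 \<le> max_laplace s n" by (auto simp: max_laplace_def)
  have "max_laplace s n \<le> expectation (\<lambda>_. 1)"
    unfolding max_laplace_def by (intro integral_mono integrable_exp_run_max s) (use s run_max_nonneg in auto)
  then show "max_laplace s n \<le> 1" using prob_space by simp
qed

lemma decseq_max_laplace: "0 \<le> s \<Longrightarrow> decseq (max_laplace s)"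
  unfolding decseq_Suc_iff max_laplace_def
  using run_max_le_Suc by (auto intro!: integral_mono integrable_exp_run_max[simplified] mult_left_mono)

lemma tendsto_max_laplace:
  assumes s: "0 \<le> s" shows "max_laplace s \<longlonglongrightarrow> sup_laplace s"
proof -
  have "convergent (max_laplace s)"
    using max_laplace_bounds(1)[OF s] decseq_max_laplace[OF s] by (metis decseq_convergent convergentI)
  then show ?thesis by (simp add: sup_laplace_def convergent_LIMSEQ_iff)
qed

lemma sup_laplace_le:
  assumes s: "0 \<le> s" shows "sup_laplace s \<le> max_laplace s n"
  by (rule LIMSEQ_le_const2[OF tendsto_max_laplace[OF s]]) (use decseqD[OF decseq_max_laplace[OF s]] in blast)

lemma tendsto_reflection_laplace: "0 \<le> s \<Longrightarrow> reflection_laplace s \<longlonglongrightarrow> (exp (\<kappa> s) - 1) * sup_laplace s"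
proof -
  assume s: "0 \<le> s"
  have "(\<lambda>n. exp (\<kappa> s) * max_laplace s n - max_laplace s (Suc n)) \<longlonglongrightarrow> exp (\<kappa> s) * sup_laplace s - sup_laplace s"
    using tendsto_max_laplace[OF s] by (intro tendsto_intros LIMSEQ_Suc)
  moreover have "reflection_laplace s = (\<lambda>n. exp (\<kappa> s) * max_laplace s n - max_laplace s (Suc n))"
    by (rule ext) (rule reflection_laplace_eq[OF s])
  ultimately show ?thesis by (simp add: left_diff_distrib)
qed

lemma sup_laplace_bounds: "0 \<le> s \<Longrightarrow> 0 \<le> sup_laplace s" "0 \<le> s \<Longrightarrow> sup_laplace s \<le> 1"
proof -
  assume s: "0 \<le> s"
  show "0 \<le> sup_laplace s" by (rule LIMSEQ_le_const[OF tendsto_max_laplace[OF s]]) (use max_laplace_bounds s in auto)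
  show "sup_laplace s \<le> 1" by (rule LIMSEQ_le_const2[OF tendsto_max_laplace[OF s]]) (use max_laplace_bounds s in auto)
qed

theorem laplace_max_lower:
  assumes s: "0 \<le> s" shows "m * s \<le> (exp (\<kappa> s) - 1) * sup_laplace s"
proof (rule LIMSEQ_le_const[OF tendsto_reflection_laplace[OF s]], intro exI allI impI)
  fix n
  show "m * s \<le> reflection_laplace s n"
    using mult_left_mono[OF mean_reflection_ge s, of n] mean_reflection_le[OF s, of n] by (simp add: ac_simps)
qed

text \<open>By convexity the mean reflection is at most \<open>reflection_laplace r n / r\<close> for each \<open>r > 0\<close>, whose limit in \<open>n\<close> is at
most \<open>(exp (\<kappa> r) - 1) / r\<close>. As \<open>r\<close> tends to \<open>0\<close> this tends to \<open>m\<close>, so the lower bound \<open>m\<close> for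
the mean reflection is asymptotically sharp.\<close>

theorem laplace_max_upper:
  assumes s: "0 < s" "s \<le> 1"
  shows "(exp (\<kappa> s) - 1) * sup_laplace s \<le> m * s + s\<^sup>2 * (exp (\<kappa> 1) - 1 - m)"
proof (rule field_le_epsilon)
  fix \<epsilon> :: real assume \<epsilon>: "0 < \<epsilon>"
  have "eventually (\<lambda>r. (exp (\<kappa> r) - 1) / r < m + \<epsilon> / s) (at_right 0)"
    using order_tendstoD(2)[OF kappa_slope] \<epsilon> s by simp
  then have "eventually (\<lambda>r. (exp (\<kappa> r) - 1) / r < m + \<epsilon> / s \<and> 0 < r) (at_right 0)"
    by (intro eventually_conj) (auto simp: eventually_at_right_less)
  then obtain r where r: "0 < r" "(exp (\<kappa> r) - 1) / r < m + \<epsilon> / s"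
    using eventually_happens[of _ "at_right (0::real)"] by auto
  have "0 < m * r" using r drift by simp
  also have "\<dots> \<le> (exp (\<kappa> r) - 1) * sup_laplace r" using laplace_max_lower[of r] r by simp
  finally have "0 \<le> exp (\<kappa> r) - 1"
    using sup_laplace_bounds(1)[of r] r by (auto simp: zero_less_mult_iff)
  then have "(exp (\<kappa> r) - 1) * sup_laplace r \<le> exp (\<kappa> r) - 1"
    using sup_laplace_bounds[of r] r by (intro mult_left_le) auto
  also have "\<dots> < (m + \<epsilon> / s) * r" using r by (simp add: field_simps)
  finally have "eventually (\<lambda>n. reflection_laplace r n < (m + \<epsilon> / s) * r) sequentially"
    using order_tendstoD(2)[OF tendsto_reflection_laplace[of r]] r by simp
  then have "eventually (\<lambda>n. reflection_laplace s n \<le> m * s + s\<^sup>2 * (exp (\<kappa> 1) - 1 - m) + \<epsilon>) sequentially"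
  proof eventually_elim
    case (elim n)
    have "expectation (reflection n) * r \<le> reflection_laplace r n"
      using mean_reflection_le[of r n] r by (simp add: mult.commute)
    from le_less_trans[OF this elim] have "expectation (reflection n) < m + \<epsilon> / s"
      using r by (simp add: mult_less_cancel_right_pos)
    then have "s * expectation (reflection n) \<le> s * m + \<epsilon>" using s by (simp add: field_simps)
    then show ?case using reflection_laplace_le[of s n] s by (simp add: mult.commute[of s])
  qed
  then show "(exp (\<kappa> s) - 1) * sup_laplace s \<le> m * s + s\<^sup>2 * (exp (\<kappa> 1) - 1 - m) + \<epsilon>"
    using tendsto_reflection_laplace[of s] s by (intro tendsto_upperbound[OF tendsto_reflection_laplace]) auto
qed

end

section \<open>Compound Poisson laws and their limits\<close>

abbreviation nn_laplace :: "real measure \<Rightarrow> real \<Rightarrow> ennreal" where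
  "nn_laplace P s \<equiv> (\<integral>\<^sup>+x. ennreal (exp (- s * x)) \<partial>P)"

text \<open>Characteristic function and Laplace transform are recorded through their exponents, which add under convolution.
The nonnegative integral makes finiteness of the exponential moments part of the statement.\<close>

definition has_transforms :: "real measure \<Rightarrow> (real \<Rightarrow> complex) \<Rightarrow> (real \<Rightarrow> real) \<Rightarrow> bool" where
  "has_transforms P \<Phi> \<phi> \<longleftrightarrow> real_distribution P \<and>
     (\<forall>\<theta>. char P \<theta> = exp (\<Phi> \<theta>)) \<and>
     (\<forall>s\<ge>0. nn_laplace P s = ennreal (exp (\<phi> s)))"

lemma has_transformsD:
  assumes "has_transforms P \<Phi> \<phi>"
  shows "real_distribution P" and "char P \<theta> = exp (\<Phi> \<theta>)"
    and "0 \<le> s \<Longrightarrow> integrable P (\<lambda>x. exp (- s * x))"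
    and "0 \<le> s \<Longrightarrow> (LINT x|P. exp (- s * x)) = exp (\<phi> s)"
proof -
  show P: "real_distribution P" and "char P \<theta> = exp (\<Phi> \<theta>)"
    using assms by (auto simp: has_transforms_def)
  interpret real_distribution P by (rule P)
  assume s: "0 \<le> s"
  have eq: "nn_laplace P s = ennreal (exp (\<phi> s))"
    using assms s by (auto simp: has_transforms_def)
  show *: "integrable P (\<lambda>x. exp (- s * x))"
    by (rule integrableI_nonneg) (use eq in auto)
  show "(LINT x|P. exp (- s * x)) = exp (\<phi> s)"
    using eq nn_integral_eq_integral[OF *] by simp
qed

lemma real_distribution_return: "real_distribution (return borel (b::real))"
  by (auto simp: real_distribution_def real_distribution_axioms_def intro!: prob_space_return)

lemma has_transforms_return:
  "has_transforms (return borel b) (\<lambda>\<theta>. \<i> * of_real (\<theta> * b)) (\<lambda>s. - s * b)"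
  by (auto simp: has_transforms_def real_distribution_return char_def integral_return nn_integral_return)

text \<open>The convolution is the law of the sum of the two coordinates of the product space.\<close>

lemma
  assumes P: "real_distribution P" and Q: "real_distribution Q"
  shows real_distribution_convolution: "real_distribution (P \<star> Q)"
    and char_convolution: "char (P \<star> Q) \<theta> = char P \<theta> * char Q \<theta>"
    and nn_laplace_convolution: "nn_laplace (P \<star> Q) s
      = nn_laplace P s * nn_laplace Q s"
proof -
  interpret P: real_distribution P by fact
  interpret Q: real_distribution Q by fact
  interpret PQ: pair_prob_space P Q ..
  have [measurable_cong]: "sets P = sets borel" "sets Q = sets borel" by auto
  have f: "distr (P \<Otimes>\<^sub>M Q) borel fst = P"
    using Q.distr_pair_fst[of P] by (simp cong: distr_cong)
  have s: "distr (P \<Otimes>\<^sub>M Q) borel snd = Q"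
  proof -
    have "distr (P \<Otimes>\<^sub>M Q) borel snd = distr (distr (Q \<Otimes>\<^sub>M P) (P \<Otimes>\<^sub>M Q) (\<lambda>(x, y). (y, x))) borel snd"
      by (subst PQ.distr_pair_swap) simp
    also have "\<dots> = distr (Q \<Otimes>\<^sub>M P) borel fst"
      by (subst distr_distr) (auto simp: comp_def case_prod_beta)
    also have "\<dots> = Q" using P.distr_pair_fst[of Q] by (simp cong: distr_cong)
    finally show ?thesis .
  qed
  have eq: "(P \<star> Q) = distr (P \<Otimes>\<^sub>M Q) borel (\<lambda>\<omega>. fst \<omega> + snd \<omega>)"
    unfolding convolution_def by (rule distr_cong) auto
  show "real_distribution (P \<star> Q)"
    unfolding eq by (intro PQ.real_distribution_distr) simp
  have "PQ.indep_var borel fst borel snd"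
    unfolding PQ.indep_var_distribution_eq f s
  proof (intro conjI)
    have "sets (borel \<Otimes>\<^sub>M borel) = sets (P \<Otimes>\<^sub>M Q)"
      by (rule sets_pair_measure_cong) simp_all
    then show "P \<Otimes>\<^sub>M Q = distr (P \<Otimes>\<^sub>M Q) (borel \<Otimes>\<^sub>M borel) (\<lambda>x. (fst x, snd x))"
      by (simp add: distr_id2)
  qed simp_all
  from PQ.char_distr_add[OF this] show "char (P \<star> Q) \<theta> = char P \<theta> * char Q \<theta>"
    unfolding eq f s .
  have exp_split: "exp (- s * (x + y)) = exp (- s * x) * exp (- s * y)" for x y
    by (simp add: distrib_left exp_add exp_diff exp_minus divide_inverse)
  have "nn_laplace (P \<star> Q) s
      = (\<integral>\<^sup>+x. \<integral>\<^sup>+y. ennreal (exp (- s * x)) * ennreal (exp (- s * y)) \<partial>Q \<partial>P)"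
    by (subst nn_integral_convolution)
      (auto simp: P.finite_measure_axioms Q.finite_measure_axioms exp_split[simplified]
        simp flip: ennreal_mult intro!: nn_integral_cong)
  also have "\<dots> = nn_laplace P s * nn_laplace Q s"
    by (simp add: nn_integral_cmult nn_integral_multc)
  finally show "nn_laplace (P \<star> Q) s
      = nn_laplace P s * nn_laplace Q s" .
qed

lemma has_transforms_convolution:
  assumes "has_transforms P \<Phi> \<phi>" "has_transforms Q \<Psi> \<psi>"
  shows "has_transforms (P \<star> Q) (\<lambda>\<theta>. \<Phi> \<theta> + \<Psi> \<theta>) (\<lambda>s. \<phi> s + \<psi> s)"
proof -
  have P: "real_distribution P" and Q: "real_distribution Q"
    using assms by (auto simp: has_transforms_def)
  show ?thesis
    unfolding has_transforms_def char_convolution[OF P Q] nn_laplace_convolution[OF P Q]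
    using assms real_distribution_convolution[OF P Q]
    by (auto simp: has_transforms_def exp_add ennreal_mult)
qed

primrec convolution_power :: "real measure \<Rightarrow> nat \<Rightarrow> real measure" where
  "convolution_power Q 0 = return borel 0"
| "convolution_power Q (Suc n) = (Q \<star> convolution_power Q n)"

lemma convolution_power_transforms:
  assumes Q: "real_distribution Q"
  shows "real_distribution (convolution_power Q n)"
    and "char (convolution_power Q n) \<theta> = char Q \<theta> ^ n"
    and "nn_laplace (convolution_power Q n) s
      = nn_laplace Q s ^ n"
proof -
  show *: "real_distribution (convolution_power Q n)" for n
    by (induction n) (simp_all add: real_distribution_return real_distribution_convolution Q)
  show "char (convolution_power Q n) \<theta> = char Q \<theta> ^ n"
    by (induction n) (simp_all add: char_convolution Q * char_def[of "return borel 0"] integral_return)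
  show "nn_laplace (convolution_power Q n) s
      = nn_laplace Q s ^ n"
    by (induction n) (simp_all add: nn_laplace_convolution[OF Q *, simplified] nn_integral_return)
qed

lemma (in prob_space) abs_expectation_le_1:
  fixes h :: "'a \<Rightarrow> real"
  assumes "\<And>x. \<bar>h x\<bar> \<le> 1"
  shows "\<bar>expectation h\<bar> \<le> 1"
proof -
  have "\<bar>expectation h\<bar> \<le> expectation (\<lambda>x. \<bar>h x\<bar>)" by (rule integral_abs_bound)
  also have "\<dots> \<le> expectation (\<lambda>_. 1)" by (rule integral_mono') (use assms in auto)
  finally show ?thesis using prob_space by simp
qed

text \<open>Mixtures are integrated with the nonnegative integral, applied to \<open>1 + f\<close>.\<close>

lemma integral_bind_pmf_bounded:
  fixes f :: "real \<Rightarrow> real" and p :: "nat pmf"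
  assumes N: "\<And>n. real_distribution (N n)"
    and f [measurable]: "f \<in> borel_measurable borel" and bd: "\<And>x. \<bar>f x\<bar> \<le> 1"
    and R: "R = measure_pmf p \<bind> N"
  shows "real_distribution R"
    and "(LINT x|R. f x) = (LINT n|measure_pmf p. LINT x|N n. f x)"
proof -
  interpret N: real_distribution "N n" for n by (rule N)
  have Nm: "N \<in> measurable (measure_pmf p) (subprob_algebra borel)"
    by (auto simp: space_subprob_algebra N.subprob_space_axioms)
  have sR: "sets R = sets borel"
    unfolding R by (rule sets_bind) auto
  show Rd: "real_distribution R"
    unfolding real_distribution_def real_distribution_axioms_def
  proof (intro conjI sR)
    show "prob_space R"
      unfolding R by (rule measure_pmf.prob_space_bind[OF _ Nm]) (auto simp: N.prob_space_axioms)
  qed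
  interpret R: real_distribution R by fact
  have int: "integrable P f" if "real_distribution P" for P
  proof -
    interpret real_distribution P by fact
    show ?thesis by (rule integrable_const_bound[where B=1]) (use bd in auto)
  qed
  have le: "\<bar>LINT x|N n. f x\<bar> \<le> 1" for n by (rule N.abs_expectation_le_1) (rule bd)
  have nn: "(\<integral>\<^sup>+x. ennreal (1 + f x) \<partial>P) = ennreal (1 + (LINT x|P. f x))" if "real_distribution P" for P
  proof -
    interpret real_distribution P by fact
    have "0 \<le> 1 + f x" for x using bd[of x] by linarith
    then show ?thesis
      using int[OF that] prob_space by (subst nn_integral_eq_integral) auto
  qed
  have i2: "integrable (measure_pmf p) (\<lambda>n. LINT x|N n. f x)"
    by (rule measure_pmf.integrable_const_bound[where B=1]) (use le in auto)
  have "ennreal (1 + (LINT x|R. f x)) = (\<integral>\<^sup>+n. \<integral>\<^sup>+x. ennreal (1 + f x) \<partial>N n \<partial>measure_pmf p)"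
    unfolding nn[OF Rd, symmetric] unfolding R by (rule nn_integral_bind[OF _ Nm]) simp
  also have "\<dots> = (\<integral>\<^sup>+n. ennreal (1 + (LINT x|N n. f x)) \<partial>measure_pmf p)"
    by (simp add: nn N)
  also have "\<dots> = ennreal (1 + (LINT n|measure_pmf p. LINT x|N n. f x))"
  proof -
    have "0 \<le> 1 + (LINT x|N n. f x)" for n using le[of n] by linarith
    then show ?thesis using i2 by (subst nn_integral_eq_integral) auto
  qed
  finally show "(LINT x|R. f x) = (LINT n|measure_pmf p. LINT x|N n. f x)"
  proof (subst (asm) ennreal_inj)
    show "0 \<le> 1 + (LINT x|R. f x)"
      using R.abs_expectation_le_1[of f, OF bd] by linarith
    show "0 \<le> 1 + (LINT n|measure_pmf p. LINT x|N n. f x)"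
      using measure_pmf.abs_expectation_le_1[of "\<lambda>n. LINT x|N n. f x" p, OF le] by linarith
  qed simp
qed

lemma poisson_sums:
  fixes z :: "'b :: {real_normed_field, banach}"
  assumes "0 < r"
  shows "(\<lambda>n. of_real (pmf (poisson_pmf r) n) * z ^ n) sums exp (of_real r * (z - 1))"
proof -
  have "(\<lambda>n. exp (- of_real r) * ((of_real r * z) ^ n /\<^sub>R fact n)) sums (exp (- of_real r) * exp (of_real r * z))"
    by (intro sums_mult exp_converges)
  moreover have "exp (- of_real r) * ((of_real r * z) ^ n /\<^sub>R fact n) = of_real (pmf (poisson_pmf r) n) * z ^ n" for n
    unfolding pmf_poisson[OF assms]
    by (simp add: power_mult_distrib scaleR_conv_of_real divide_inverse mult_ac flip: exp_of_real)
  ultimately show ?thesis by (simp add: algebra_simps flip: exp_add)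
qed

lemma poisson_integral:
  fixes z :: complex
  assumes r: "0 < r" and z: "norm z \<le> 1"
  shows "(LINT n|measure_pmf (poisson_pmf r). z ^ n) = exp (of_real r * (z - 1))"
proof -
  let ?p = "poisson_pmf r"
  have "integrable (measure_pmf ?p) (\<lambda>n. z ^ n)"
    by (rule measure_pmf.integrable_const_bound[where B=1]) (use z in \<open>auto simp: norm_power power_le_one\<close>)
  then have int: "integrable (count_space UNIV) (\<lambda>n. pmf ?p n *\<^sub>R z ^ n)"
    unfolding measure_pmf_eq_density by (subst (asm) integrable_density) auto
  have "(LINT n|measure_pmf ?p. z ^ n) = (LINT n|count_space UNIV. pmf ?p n *\<^sub>R z ^ n)"
    unfolding measure_pmf_eq_density by (subst integral_density) auto
  also have "\<dots> = (\<Sum>n. of_real (pmf ?p n) * z ^ n)"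
    using integral_count_space_nat[OF int] by (simp add: scaleR_conv_of_real)
  also have "\<dots> = exp (of_real r * (z - 1))"
    by (rule sums_unique[symmetric]) (rule poisson_sums[OF r])
  finally show ?thesis .
qed

lemma poisson_nn_integral:
  fixes q :: real
  assumes r: "0 < r" and q: "0 \<le> q"
  shows "(\<integral>\<^sup>+n. ennreal (q ^ n) \<partial>measure_pmf (poisson_pmf r)) = ennreal (exp (r * (q - 1)))"
proof -
  have "(\<integral>\<^sup>+n. ennreal (q ^ n) \<partial>measure_pmf (poisson_pmf r)) = (\<Sum>n. ennreal (pmf (poisson_pmf r) n * q ^ n))"
    using q by (simp add: nn_integral_measure_pmf nn_integral_count_space_nat ennreal_mult del: pmf_poisson)
  also have "\<dots> = ennreal (exp (r * (q - 1)))"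
    by (rule suminf_ennreal_eq) (use q poisson_sums[OF r, of q] in \<open>auto simp del: pmf_poisson\<close>)
  finally show ?thesis .
qed

text \<open>The law of a sum of a Poisson number of independent variables with law \<open>Q\<close>. Conditionally on the number \<open>n\<close>
both transforms are \<open>n\<close>-th powers, and the Poisson weights sum them to an exponential.\<close>

lemma compound_poisson_prob:
  assumes Q: "real_distribution Q" and r: "0 < r"
    and q: "\<And>s. 0 \<le> s \<Longrightarrow> nn_laplace Q s = ennreal (q s)" "\<And>s. 0 \<le> s \<Longrightarrow> 0 \<le> q s"
  shows "has_transforms (measure_pmf (poisson_pmf r) \<bind> convolution_power Q)
    (\<lambda>\<theta>. of_real r * (char Q \<theta> - 1)) (\<lambda>s. r * (q s - 1))"
proof -
  let ?p = "poisson_pmf r" and ?N = "convolution_power Q"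
  let ?R = "measure_pmf ?p \<bind> ?N"
  note N = convolution_power_transforms[OF Q]
  interpret N: real_distribution "?N n" for n by (rule N)
  have Nm: "?N \<in> measurable (measure_pmf ?p) (subprob_algebra borel)"
    by (auto simp: space_subprob_algebra N.subprob_space_axioms)
  note bind = integral_bind_pmf_bounded[OF N(1) _ _ refl, of _ ?p]
  have R: "real_distribution ?R" by (rule bind(1)[of "\<lambda>_. 0"]) auto
  have iexp_int: "(CLINT x|P. iexp (\<theta> * x)) = Complex (LINT x|P. cos (\<theta> * x)) (LINT x|P. sin (\<theta> * x))"
    if "real_distribution P" for P \<theta>
  proof -
    interpret real_distribution P by fact
    have "integrable P (\<lambda>x. iexp (\<theta> * x))" by (rule integrable_iexp) auto
    then show ?thesis
      by (auto simp: complex_eq_iff simp flip: integral_Re integral_Im) (simp_all add: Re_exp Im_exp)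
  qed
  have char: "char ?R \<theta> = exp (of_real r * (char Q \<theta> - 1))" for \<theta>
  proof -
    interpret Q: real_distribution Q by fact
    have int: "integrable (measure_pmf ?p) (\<lambda>n. char (?N n) \<theta>)"
      by (rule measure_pmf.integrable_const_bound[where B=1]) (use N.cmod_char_le_1 in auto)
    have "char ?R \<theta> = Complex (LINT n|measure_pmf ?p. Re (char (?N n) \<theta>)) (LINT n|measure_pmf ?p. Im (char (?N n) \<theta>))"
      unfolding char_def iexp_int[OF R] iexp_int[OF N(1)]
      by (subst (1 2) bind(2)) (auto simp: abs_le_iff)
    also have "\<dots> = (LINT n|measure_pmf ?p. char (?N n) \<theta>)"
      using int by (auto simp: complex_eq_iff)
    also have "\<dots> = exp (of_real r * (char Q \<theta> - 1))"
      unfolding N(2) by (rule poisson_integral[OF r Q.cmod_char_le_1])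
    finally show ?thesis .
  qed
  have "nn_laplace ?R s = ennreal (exp (r * (q s - 1)))" if s: "0 \<le> s" for s
  proof -
    have "nn_laplace ?R s = (\<integral>\<^sup>+n. \<integral>\<^sup>+x. ennreal (exp (- s * x)) \<partial>?N n \<partial>measure_pmf ?p)"
      by (rule nn_integral_bind[OF _ Nm]) simp
    also have "\<dots> = (\<integral>\<^sup>+n. ennreal (q s ^ n) \<partial>measure_pmf ?p)"
      unfolding N(3) q(1)[OF s] using q(2)[OF s] by (simp add: ennreal_power)
    also have "\<dots> = ennreal (exp (r * (q s - 1)))"
      by (rule poisson_nn_integral[OF r q(2)[OF s]])
    finally show ?thesis .
  qed
  with R char show ?thesis by (auto simp: has_transforms_def)
qed

text \<open>The total mass of \<open>\<kappa>\<close> becomes the Poisson rate and the normalised measure the law of the jumps.\<close>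

lemma compound_poisson_exists:
  assumes fin: "finite_measure \<kappa>" and [measurable_cong]: "sets \<kappa> = sets (borel :: real measure)"
    and int: "\<And>s. 0 \<le> s \<Longrightarrow> integrable \<kappa> (\<lambda>x. exp (- s * x))"
  shows "\<exists>R. has_transforms R (\<lambda>\<theta>. CLINT x|\<kappa>. iexp (\<theta> * x) - 1) (\<lambda>s. LINT x|\<kappa>. exp (- s * x) - 1)"
proof -
  interpret finite_measure \<kappa> by fact
  define r where "r = measure \<kappa> UNIV"
  have sp: "space \<kappa> = UNIV" using sets_eq_imp_space_eq[OF assms(2)] by simp
  have r: "emeasure \<kappa> UNIV = ennreal r" "0 \<le> r" by (auto simp: r_def emeasure_eq_measure)
  have iexp_i: "integrable \<kappa> (\<lambda>x. iexp (\<theta> * x))" for \<theta>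
    by (rule integrable_const_bound[where B=1]) auto
  show ?thesis
  proof (cases "r = 0")
    case True
    then have "\<kappa> = null_measure \<kappa>"
      using r(1) sp by (intro measure_eqI) (auto, metis emeasure_mono emeasure_space le_zero_eq sp)
    then have "(CLINT x|\<kappa>. iexp (\<theta> * x) - 1) = 0" "(LINT x|\<kappa>. exp (- s * x) - 1) = 0" for \<theta> s
      by (metis integral_null_measure)+
    then show ?thesis using has_transforms_return[of 0] by (intro exI[of _ "return borel 0"]) simp
  next
    case False
    with r have rp: "0 < r" by simp
    define Q where "Q = density \<kappa> (\<lambda>_. ennreal (1 / r))"
    have Q: "real_distribution Q"
    proof -
      have "emeasure Q (space Q) = 1"
        using rp r(1) by (simp add: Q_def emeasure_density sp flip: ennreal_mult)
      then show ?thesis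
        unfolding real_distribution_def real_distribution_axioms_def
        by (auto intro: prob_spaceI simp: Q_def assms(2))
    qed
    have char: "of_real r * (char Q \<theta> - 1) = (CLINT x|\<kappa>. iexp (\<theta> * x) - 1)" for \<theta>
    proof -
      have "char Q \<theta> = (1 / r) *\<^sub>R (CLINT x|\<kappa>. iexp (\<theta> * x))"
        unfolding char_def Q_def using rp by (subst integral_density) auto
      moreover have "(CLINT x|\<kappa>. iexp (\<theta> * x) - 1) = (CLINT x|\<kappa>. iexp (\<theta> * x)) - of_real r"
        using iexp_i by (subst Bochner_Integration.integral_diff) (auto simp: sp r_def scaleR_conv_of_real)
      ultimately show ?thesis using rp by (simp add: scaleR_conv_of_real field_simps)
    qed
    have lap: "nn_laplace Q s = ennreal ((1 / r) * (LINT x|\<kappa>. exp (- s * x)))" if "0 \<le> s" for s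
    proof -
      have "nn_laplace Q s = (\<integral>\<^sup>+x. ennreal ((1 / r) * exp (- s * x)) \<partial>\<kappa>)"
        unfolding Q_def using rp by (subst nn_integral_density) (auto simp flip: ennreal_mult)
      also have "\<dots> = ennreal (LINT x|\<kappa>. (1 / r) * exp (- s * x))"
        using int[OF that] rp by (intro nn_integral_eq_integral) auto
      finally show ?thesis by simp
    qed
    have "has_transforms (measure_pmf (poisson_pmf r) \<bind> convolution_power Q)
        (\<lambda>\<theta>. of_real r * (char Q \<theta> - 1)) (\<lambda>s. r * ((1 / r) * (LINT x|\<kappa>. exp (- s * x)) - 1))"
      by (rule compound_poisson_prob[OF Q rp lap]) (use rp in auto)
    then have "has_transforms (measure_pmf (poisson_pmf r) \<bind> convolution_power Q)
        (\<lambda>\<theta>. CLINT x|\<kappa>. iexp (\<theta> * x) - 1) (\<lambda>s. r * ((1 / r) * (LINT x|\<kappa>. exp (- s * x)) - 1))"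
      unfolding char .
    moreover have "r * ((1 / r) * (LINT x|\<kappa>. exp (- s * x)) - 1) = (LINT x|\<kappa>. exp (- s * x) - 1)" if "0 \<le> s" for s
      using rp int[OF that] by (subst Bochner_Integration.integral_diff) (auto simp: sp r_def field_simps)
    ultimately show ?thesis unfolding has_transforms_def by (intro exI) auto
  qed
qed

text \<open>Levy's continuity theorem gives weak convergence. The exponentials \<open>exp (- s * x)\<close> are unbounded, but they may be
truncated: by Markov's inequality the truncation error at height \<open>K\<close> is at most the transform at \<open>2 * s\<close>
divided by \<open>K\<close>.\<close>

lemma has_transforms_limit:
  assumes Pn: "\<And>n. has_transforms (Pn n) (\<Phi>n n) (\<phi>n n)"
    and P: "real_distribution P" "\<And>\<theta>. char P \<theta> = exp (\<Phi> \<theta>)"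
    and lim: "\<And>\<theta>. (\<lambda>n. \<Phi>n n \<theta>) \<longlonglongrightarrow> \<Phi> \<theta>" "\<And>s. 0 \<le> s \<Longrightarrow> (\<lambda>n. \<phi>n n s) \<longlonglongrightarrow> \<phi> s"
  shows "has_transforms P \<Phi> \<phi>"
proof -
  interpret P: real_distribution P by fact
  have Pn_d: "real_distribution (Pn n)" for n using Pn by (auto simp: has_transforms_def)
  interpret Pn: real_distribution "Pn n" for n by (rule Pn_d)
  have wc: "weak_conv_m Pn P"
  proof (rule levy_continuity[OF Pn_d P(1)])
    show "(\<lambda>n. char (Pn n) t) \<longlonglongrightarrow> char P t" for t
      using tendsto_exp[OF lim(1)[of t]] Pn P(2) by (auto simp: has_transforms_def)
  qed
  have "nn_laplace P s = ennreal (exp (\<phi> s))" if s: "0 \<le> s" for s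
  proof -
    define g where "g K x = min (exp (- s * x)) (real K)" for K x
    have g_meas [measurable]: "g K \<in> borel_measurable borel" for K
      unfolding g_def [abs_def] by measurable
    have g0: "0 \<le> g K x" "g K x \<le> real K" for K x by (auto simp: g_def)
    have g_int: "integrable R (g K)" if "real_distribution R" for R K
    proof -
      interpret real_distribution R by fact
      show ?thesis by (rule integrable_const_bound[where B="real K"]) (use g0 in auto)
    qed
    have g_lim: "(\<lambda>n. LINT x|Pn n. g K x) \<longlonglongrightarrow> (LINT x|P. g K x)" for K
    proof (rule weak_conv_imp_integral_bdd_continuous_conv[OF Pn_d P(1) wc])
      show "isCont (g K) x" for x unfolding g_def [abs_def] by (intro continuous_intros)
      show "norm (g K x) \<le> real K" for x using g0[of K x] by simp
    qed
    note Lap = has_transformsD(3,4)[OF Pn]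
    have up: "(LINT x|P. g K x) \<le> exp (\<phi> s)" for K
    proof (rule LIMSEQ_le[OF g_lim tendsto_exp[OF lim(2)[OF s]]], intro exI allI impI)
      fix n
      have "(LINT x|Pn n. g K x) \<le> (LINT x|Pn n. exp (- s * x))"
        by (intro integral_mono g_int Pn_d Lap s) (auto simp: g_def)
      then show "(LINT x|Pn n. g K x) \<le> exp (\<phi>n n s)" using Lap(2)[OF s] by simp
    qed
    have lo: "exp (\<phi> s) - exp (\<phi> (2 * s)) / real (Suc K) \<le> (LINT x|P. g (Suc K) x)" for K
    proof (rule LIMSEQ_le[OF _ g_lim], rule tendsto_diff[OF tendsto_exp[OF lim(2)[OF s]]
          tendsto_divide[OF tendsto_exp[OF lim(2)] tendsto_const]], use s in simp, simp, intro exI allI impI)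
      fix n
      have "exp (\<phi>n n s) = (LINT x|Pn n. exp (- s * x))" using Lap(2)[OF s] by simp
      also have "\<dots> \<le> (LINT x|Pn n. g (Suc K) x + exp (- (2 * s) * x) / real (Suc K))"
      proof (rule integral_mono)
        fix x
        have sq: "exp (- (2 * s) * x) = exp (- s * x) * exp (- s * x)"
          by (simp flip: exp_add)
        show "exp (- s * x) \<le> g (Suc K) x + exp (- (2 * s) * x) / real (Suc K)"
        proof (cases "exp (- s * x) \<le> real (Suc K)")
          case False
          then have "exp (- s * x) * real (Suc K) \<le> exp (- s * x) * exp (- s * x)"
            by (intro mult_left_mono) auto
          then have "exp (- s * x) \<le> exp (- (2 * s) * x) / real (Suc K)"
            unfolding sq by (simp add: field_simps del: of_nat_Suc)
          then show ?thesis using g0(1)[of "Suc K" x] by linarith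
        qed (simp add: g_def)
      qed (use s in \<open>intro Bochner_Integration.integrable_add integrable_divide g_int Pn_d Lap; simp\<close>)+
      also have "\<dots> = (LINT x|Pn n. g (Suc K) x) + exp (\<phi>n n (2 * s)) / real (Suc K)"
        using g_int[OF Pn_d] Lap[of "2 * s" n] s by (subst Bochner_Integration.integral_add) auto
      finally show "exp (\<phi>n n s) - exp (\<phi>n n (2 * s)) / real (Suc K) \<le> (LINT x|Pn n. g (Suc K) x)"
        by linarith
    qed
    have "(\<lambda>K. ennreal (LINT x|P. g K x)) \<longlonglongrightarrow> nn_laplace P s"
    proof -
      have "(\<lambda>K. \<integral>\<^sup>+x. ennreal (g K x) \<partial>P) \<longlonglongrightarrow> nn_laplace P s"
      proof (rule nn_integral_LIMSEQ)
        show "mono (\<lambda>K x. ennreal (g K x))"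
          by (auto simp: mono_def le_fun_def g_def intro!: ennreal_leI)
        fix x
        obtain K0 where K0: "exp (- s * x) \<le> real K0" using real_arch_simple by blast
        have "eventually (\<lambda>K. ennreal (g K x) = ennreal (exp (- s * x))) sequentially"
          using eventually_ge_at_top[of K0] by eventually_elim (use K0 in \<open>auto simp: g_def min_def\<close>)
        then show "(\<lambda>K. ennreal (g K x)) \<longlonglongrightarrow> ennreal (exp (- s * x))"
          by (rule tendsto_eventually)
      qed auto
      moreover have "(\<integral>\<^sup>+x. ennreal (g K x) \<partial>P) = ennreal (LINT x|P. g K x)" for K
        by (intro nn_integral_eq_integral g_int P) (auto simp: g0)
      ultimately show ?thesis by simp
    qed
    moreover have "(\<lambda>K. ennreal (LINT x|P. g K x)) \<longlonglongrightarrow> ennreal (exp (\<phi> s))"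
    proof (intro tendsto_ennrealI, rule LIMSEQ_imp_Suc, rule tendsto_sandwich[OF _ _ _ tendsto_const])
      show "\<forall>\<^sub>F K in sequentially. exp (\<phi> s) - exp (\<phi> (2 * s)) / real (Suc K) \<le> (LINT x|P. g (Suc K) x)"
        using lo by auto
      have "(\<lambda>K. exp (\<phi> s) - exp (\<phi> (2 * s)) * inverse (real (Suc K))) \<longlonglongrightarrow> exp (\<phi> s) - exp (\<phi> (2 * s)) * 0"
        by (intro tendsto_intros LIMSEQ_inverse_real_of_nat)
      then show "(\<lambda>K. exp (\<phi> s) - exp (\<phi> (2 * s)) / real (Suc K)) \<longlonglongrightarrow> exp (\<phi> s)"
        by (simp add: divide_inverse)
    qed (use up in auto)
    ultimately show ?thesis by (rule LIMSEQ_unique)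
  qed
  with P show ?thesis by (auto simp: has_transforms_def)
qed

section \<open>The Laplace exponent of a spectrally positive Levy process\<close>

abbreviation comp_exp :: "real \<Rightarrow> real \<Rightarrow> real" where
  "comp_exp s x \<equiv> exp (- s * x) - 1 + s * x"

abbreviation comp_iexp :: "real \<Rightarrow> real \<Rightarrow> complex" where
  "comp_iexp \<theta> x \<equiv> iexp (\<theta> * x) - 1 - \<i> * of_real (\<theta> * x)"

text \<open>Jumps of size \<open>- d\<close> with rate \<open>1 / d\<^sup>2\<close>, compensated, turn into a Gaussian part as \<open>d\<close> tends to \<open>0\<close>, both in the
Laplace exponent and in the characteristic exponent.\<close>

lemma exp_second_order_limit:
  fixes s :: real
  shows "((\<lambda>d. (exp (s * d) - 1 - s * d) / d\<^sup>2) \<longlongrightarrow> s\<^sup>2 / 2) (at_right 0)"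
proof -
  have "((\<lambda>d. (exp (s * d) - 1 - s * d) / d\<^sup>2) \<longlongrightarrow> s * s / 2) (at_right 0)"
    by real_asymp
  then show ?thesis by (simp add: power2_eq_square)
qed

lemma iexp_second_order_limit:
  "((\<lambda>d. (iexp (- \<theta> * d) - 1 + \<i> * of_real (\<theta> * d)) / of_real (d\<^sup>2)) \<longlongrightarrow> - of_real (\<theta>\<^sup>2 / 2)) (at_right 0)"
proof (rule LIM_zero_cancel, rule Lim_null_comparison)
  show "((\<lambda>d. \<bar>\<theta>\<bar> ^ 3 / 6 * d) \<longlongrightarrow> 0) (at_right 0)"
    by (rule tendsto_eq_intros refl | simp)+
  show "\<forall>\<^sub>F d in at_right 0. norm ((iexp (- \<theta> * d) - 1 + \<i> * of_real (\<theta> * d)) / of_real (d\<^sup>2) - - of_real (\<theta>\<^sup>2 / 2)) \<le> \<bar>\<theta>\<bar> ^ 3 / 6 * d"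
    using eventually_at_right_less[of 0]
  proof eventually_elim
    case (elim d)
    have "(iexp (- \<theta> * d) - 1 + \<i> * of_real (\<theta> * d)) / of_real (d\<^sup>2) - - of_real (\<theta>\<^sup>2 / 2)
        = (iexp (- \<theta> * d) - (\<Sum>k \<le> 2. (\<i> * of_real (- \<theta> * d)) ^ k / fact k)) / of_real (d\<^sup>2)"
      using elim by (simp add: numeral_2_eq_2 field_simps power_mult_distrib)
    also have "norm \<dots> = norm (iexp (- \<theta> * d) - (\<Sum>k \<le> 2. (\<i> * of_real (- \<theta> * d)) ^ k / fact k)) / d\<^sup>2"
      using elim by (simp add: norm_divide norm_power)
    also have "\<dots> \<le> (\<bar>- \<theta> * d\<bar> ^ Suc 2 / fact (Suc 2)) / d\<^sup>2"
      by (intro divide_right_mono iexp_approx1) simp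
    also have "\<dots> = \<bar>\<theta>\<bar> ^ 3 / 6 * d"
      using elim by (simp add: abs_mult power_mult_distrib fact_numeral numeral_3_eq_3 numeral_2_eq_2)
    finally show ?case .
  qed
qed

lemma tail_le_min_square:
  fixes x d :: real
  assumes "0 < d" "d \<le> 1" "0 < x"
  shows "indicator {d<..} x \<le> 1 / d\<^sup>2 * min x (x\<^sup>2)" and "x * indicator {d<..} x \<le> 1 / d * min x (x\<^sup>2)"
proof -
  have "1 \<le> 1 / d\<^sup>2 * min x (x\<^sup>2) \<and> x \<le> 1 / d * min x (x\<^sup>2)" if "d < x"
  proof -
    have "d\<^sup>2 \<le> x\<^sup>2" using that assms by (intro power_mono) auto
    moreover have "d\<^sup>2 \<le> d" using assms by (simp add: power2_eq_square mult_left_le)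
    moreover have "x * d \<le> x\<^sup>2" using that assms by (simp add: power2_eq_square)
    moreover have "x * d \<le> x" using that assms by (simp add: mult_left_le)
    ultimately show ?thesis using assms that by (simp add: field_simps)
  qed
  then show "indicator {d<..} x \<le> 1 / d\<^sup>2 * min x (x\<^sup>2)" "x * indicator {d<..} x \<le> 1 / d * min x (x\<^sup>2)"
    using assms by (cases "d < x"; simp)+
qed

text \<open>The quadratic Taylor polynomial bounds \<open>exp (s * x)\<close> from below, and the product of the polynomials at
\<open>s * x\<close> and \<open>- s * x\<close> is at least \<open>1\<close>.\<close>

lemma exp_compensated_le_square:
  fixes s x :: real
  assumes "0 \<le> s" "0 \<le> x"
  shows "comp_exp s x \<le> s\<^sup>2 * x\<^sup>2"
proof -
  have "exp (- (s * x)) \<le> 1 - s * x + (s * x)\<^sup>2 / 2"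
  proof (cases "s * x = 0")
    case False
    then have y: "0 < s * x" using assms by (simp add: zero_less_mult_iff less_le)
    have "exp (s * x) \<ge> 1 + s * x + (s * x)\<^sup>2 / 2"
      using exp_lower_Taylor_quadratic[of "s * x"] y by simp
    then have "exp (- (s * x)) \<le> 1 / (1 + s * x + (s * x)\<^sup>2 / 2)"
      using y unfolding exp_minus divide_inverse by (simp add: add_pos_nonneg)
    also have "\<dots> \<le> 1 - s * x + (s * x)\<^sup>2 / 2"
    proof -
      have "(1 - y + y\<^sup>2 / 2) * (1 + y + y\<^sup>2 / 2) = 1 + (y\<^sup>2 / 2)\<^sup>2" for y :: real
        by (simp add: power2_eq_square field_simps)
      then have "1 \<le> (1 - s * x + (s * x)\<^sup>2 / 2) * (1 + s * x + (s * x)\<^sup>2 / 2)" by simp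
      then show ?thesis using y by (subst pos_divide_le_eq) (auto intro: add_pos_nonneg)
    qed
    finally show ?thesis .
  qed auto
  moreover have "0 \<le> (s * x)\<^sup>2" by simp
  ultimately have "exp (- (s * x)) - 1 + s * x \<le> (s * x)\<^sup>2" by linarith
  then show "comp_exp s x \<le> s\<^sup>2 * x\<^sup>2"
    by (simp add: power_mult_distrib)
qed

lemma le_min_squareI:
  fixes x y A B :: real
  assumes "y \<le> A * x" "y \<le> B * x\<^sup>2" "0 \<le> A" "0 \<le> B" "0 \<le> x"
  shows "y \<le> (A + B) * min x (x\<^sup>2)"
proof -
  have "0 \<le> B * x" "0 \<le> A * x\<^sup>2" using assms by simp_all
  then show ?thesis using assms(1,2) unfolding min_def distrib_right by (cases "x \<le> x\<^sup>2") simp_all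
qed

lemma exp_compensated_bounds:
  fixes s x :: real
  assumes "0 \<le> s" "0 \<le> x"
  shows "0 \<le> comp_exp s x" "comp_exp s x \<le> (s + s\<^sup>2) * min x (x\<^sup>2)"
proof -
  show "0 \<le> comp_exp s x" using exp_ge_add_one_self[of "- s * x"] by simp
  have "exp (- s * x) \<le> 1" using assms by simp
  then show "comp_exp s x \<le> (s + s\<^sup>2) * min x (x\<^sup>2)"
    using exp_compensated_le_square[OF assms] assms by (intro le_min_squareI) auto
qed

lemma iexp_compensated_bound:
  assumes "0 \<le> x"
  shows "norm (comp_iexp \<theta> x) \<le> (2 * \<bar>\<theta>\<bar> + \<theta>\<^sup>2) * min x (x\<^sup>2)"
proof (rule le_min_squareI)
  have eq: "(\<Sum>k\<le>1. (\<i> * of_real (\<theta> * x)) ^ k / fact k) = 1 + \<i> * of_real (\<theta> * x)" by simp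
  show "norm (comp_iexp \<theta> x) \<le> 2 * \<bar>\<theta>\<bar> * x"
    using iexp_approx2[of "\<theta> * x" 1] assms unfolding eq by (simp add: abs_mult diff_diff_eq)
  have "norm (comp_iexp \<theta> x) \<le> \<bar>\<theta> * x\<bar>\<^sup>2 / 2"
    using iexp_approx1[of "\<theta> * x" 1] unfolding eq by (simp add: diff_diff_eq fact_numeral numeral_2_eq_2)
  also have "\<dots> \<le> \<theta>\<^sup>2 * x\<^sup>2" by (simp add: power_mult_distrib)
  finally show "norm (comp_iexp \<theta> x) \<le> \<theta>\<^sup>2 * x\<^sup>2" .
qed (use assms in auto)

text \<open>The Gaussian part is approximated by these downward jumps rather than by normal laws, so that compound Poisson laws
are the only building blocks.\<close>

lemma small_atom_transforms:
  assumes r: "0 \<le> r"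
  shows "\<exists>R. has_transforms R (\<lambda>\<theta>. of_real r * (iexp (- \<theta> * d) - 1)) (\<lambda>s. r * (exp (s * d) - 1))"
proof -
  let ?k = "density (return borel (- d)) (\<lambda>_. ennreal r)"
  have "finite_measure ?k"
    by (rule finite_measureI) (simp add: emeasure_density)
  moreover have "sets ?k = sets borel" by simp
  moreover have "integrable ?k (\<lambda>x. exp (- s * x))" for s
  proof (subst integrable_density)
    have "integrable (return borel (- d)) (\<lambda>x. r *\<^sub>R exp (- s * x))"
      by (rule integrableI_bounded) (simp_all add: nn_integral_return)
    then show "integrable (return borel (- d)) (\<lambda>x. r *\<^sub>R exp (- s * x))" .
  qed (use r in auto)
  ultimately obtain R where "has_transforms R (\<lambda>\<theta>. CLINT x|?k. iexp (\<theta> * x) - 1) (\<lambda>s. LINT x|?k. exp (- s * x) - 1)"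
    using compound_poisson_exists by blast
  moreover have "(CLINT x|?k. iexp (\<theta> * x) - 1) = of_real r * (iexp (- \<theta> * d) - 1)" for \<theta>
    using r by (subst integral_density) (auto simp: integral_return scaleR_conv_of_real)
  moreover have "(LINT x|?k. exp (- s * x) - 1) = r * (exp (s * d) - 1)" for s
    using r by (subst integral_density) (auto simp: integral_return)
  ultimately show ?thesis by auto
qed

text \<open>Integrability of \<open>min x (x\<^sup>2)\<close> means that the large jumps have a mean, so that all jumps, not only
the small ones, can be compensated.\<close>

locale one_sided_levy_measure =
  fixes \<nu> :: "real measure"
  assumes sets_nu [measurable_cong]: "sets \<nu> = sets borel"
    and pos: "AE x in \<nu>. 0 < x"
    and integrable_min: "integrable \<nu> (\<lambda>x. min x (x\<^sup>2))"
begin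

lemma integrable_le_min:
  fixes f :: "real \<Rightarrow> 'b::{banach, second_countable_topology}"
  assumes [measurable]: "f \<in> borel_measurable borel" and le: "\<And>x. 0 < x \<Longrightarrow> norm (f x) \<le> C * min x (x\<^sup>2)"
  shows "integrable \<nu> f"
proof (rule Bochner_Integration.integrable_bound)
  show "integrable \<nu> (\<lambda>x. C * min x (x\<^sup>2))" using integrable_min by simp
  show "AE x in \<nu>. norm (f x) \<le> norm (C * min x (x\<^sup>2))"
    using pos by eventually_elim (use le in \<open>auto intro: order_trans[OF _ abs_ge_self]\<close>)
qed simp

lemma integrable_exp_compensated: "0 \<le> s \<Longrightarrow> integrable \<nu> (\<lambda>x. comp_exp s x)"
  by (rule integrable_le_min[where C="s + s\<^sup>2"])
    (use exp_compensated_bounds[of s] in \<open>auto simp: abs_of_nonneg\<close>)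

lemma integrable_iexp_compensated: "integrable \<nu> (\<lambda>x. comp_iexp \<theta> x)"
  by (rule integrable_le_min[where C="2 * \<bar>\<theta>\<bar> + \<theta>\<^sup>2"]) (use iexp_compensated_bound in auto)

context
  fixes d :: real
  assumes d: "0 < d" "d \<le> 1"
begin

lemma integrable_tail: "integrable \<nu> (indicator {d<..} :: real \<Rightarrow> real)"
proof (rule integrable_le_min)
  show "norm (indicator {d<..} x :: real) \<le> (1 / d\<^sup>2) * min x (x\<^sup>2)" if "0 < x" for x
    using tail_le_min_square(1)[OF d that] by simp
qed simp

lemma integrable_tail_id: "integrable \<nu> (\<lambda>x. x * indicator {d<..} x)"
proof (rule integrable_le_min)
  show "norm (x * indicator {d<..} x :: real) \<le> (1 / d) * min x (x\<^sup>2)" if "0 < x" for x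
    using tail_le_min_square(2)[OF d that] that by (simp add: abs_mult)
qed simp

lemma truncated_transforms:
  assumes t: "0 \<le> t"
  shows "\<exists>R. has_transforms R
    (\<lambda>\<theta>. of_real t * (CLINT x|\<nu>. indicator {d<..} x *\<^sub>R (iexp (\<theta> * x) - 1)))
    (\<lambda>s. t * (LINT x|\<nu>. indicator {d<..} x * (exp (- s * x) - 1)))"
proof -
  let ?k = "density \<nu> (\<lambda>x. ennreal (t * indicator {d<..} x))"
  have m: "(\<lambda>x. t * indicator {d<..} x) \<in> borel_measurable \<nu>" by measurable
  have nn: "0 \<le> t * indicator {d<..} x" for x :: real using t by simp
  have "finite_measure ?k"
  proof (rule finite_measureI)
    have "emeasure ?k (space ?k) = (\<integral>\<^sup>+x. ennreal (t * indicator {d<..} x) \<partial>\<nu>)"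
      by (simp add: emeasure_density)
    also have "\<dots> = ennreal (LINT x|\<nu>. t * indicator {d<..} x)"
      using integrable_tail nn by (intro nn_integral_eq_integral) auto
    finally show "emeasure ?k (space ?k) \<noteq> \<infinity>" by simp
  qed
  moreover have "sets ?k = sets borel" by (simp add: sets_nu)
  moreover have "integrable ?k (\<lambda>x. exp (- s * x))" if s: "0 \<le> s" for s
  proof (subst integrable_density)
    show "integrable \<nu> (\<lambda>x. (t * indicator {d<..} x) *\<^sub>R exp (- s * x))"
    proof (rule Bochner_Integration.integrable_bound)
      show "integrable \<nu> (\<lambda>x. t * indicator {d<..} x)" using integrable_tail by simp
      show "AE x in \<nu>. norm ((t * indicator {d<..} x) *\<^sub>R exp (- s * x)) \<le> norm (t * indicator {d<..} x)"
        using pos by eventually_elim (use s t in \<open>auto simp: abs_mult indicator_def intro!: mult_left_le\<close>)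
    qed simp
  qed (use nn in auto)
  ultimately obtain R where "has_transforms R (\<lambda>\<theta>. CLINT x|?k. iexp (\<theta> * x) - 1) (\<lambda>s. LINT x|?k. exp (- s * x) - 1)"
    using compound_poisson_exists by blast
  moreover have "(CLINT x|?k. iexp (\<theta> * x) - 1) = of_real t * (CLINT x|\<nu>. indicator {d<..} x *\<^sub>R (iexp (\<theta> * x) - 1))" for \<theta>
    by (subst integral_density[OF _ m]) (use nn in \<open>auto simp: scaleR_conv_of_real mult.assoc\<close>)
  moreover have "(LINT x|?k. exp (- s * x) - 1) = t * (LINT x|\<nu>. indicator {d<..} x * (exp (- s * x) - 1))" for s
    by (subst integral_density[OF _ m]) (use nn in \<open>auto simp: mult.assoc\<close>)
  ultimately show ?thesis by auto
qed

end

text \<open>The characteristic exponent with every jump compensated; \<open>b\<close> is then the mean.\<close>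

definition levy_symbol :: "real \<Rightarrow> real \<Rightarrow> real \<Rightarrow> complex" where
  "levy_symbol b \<sigma> \<theta> = \<i> * of_real (\<theta> * b) - of_real (\<sigma>\<^sup>2 * \<theta>\<^sup>2 / 2) +
     (CLINT x|\<nu>. comp_iexp \<theta> x)"

definition laplace_exponent :: "real \<Rightarrow> real \<Rightarrow> real \<Rightarrow> real" where
  "laplace_exponent b \<sigma> s = - s * b + \<sigma>\<^sup>2 * s\<^sup>2 / 2 + (LINT x|\<nu>. comp_exp s x)"

text \<open>Compensating the jumps of size at least \<open>1\<close> as well shifts the linear coefficient by their mean.\<close>

lemma levy_exponent_eq_symbol:
  "levy_exponent \<gamma> \<sigma> \<nu> \<theta> = levy_symbol (\<gamma> + (LINT x|\<nu>. x * indicator {1..} x)) \<sigma> \<theta>"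
proof -
  have int: "integrable \<nu> (\<lambda>x. x * indicator {1..} x)"
    by (rule integrable_le_min[where C=1])
      (auto simp: indicator_def power2_eq_square abs_mult mult_le_cancel_left1)
  have "(CLINT x|\<nu>. iexp (\<theta> * x) - 1 - \<i> * of_real (\<theta> * x * indicator {-1<..<1} x))
      = (CLINT x|\<nu>. comp_iexp \<theta> x + \<i> * of_real \<theta> * of_real (x * indicator {1..} x))"
  proof (rule integral_cong_AE)
    show "AE x in \<nu>. iexp (\<theta> * x) - 1 - \<i> * of_real (\<theta> * x * indicator {-1<..<1} x)
      = comp_iexp \<theta> x + \<i> * of_real \<theta> * of_real (x * indicator {1..} x)"
      using pos by eventually_elim (auto simp: indicator_def)
  qed measurable
  also have "\<dots> = (CLINT x|\<nu>. comp_iexp \<theta> x) + (CLINT x|\<nu>. \<i> * of_real \<theta> * of_real (x * indicator {1..} x))"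
    by (intro Bochner_Integration.integral_add integrable_iexp_compensated integrable_mult_right integrable_of_real int)
  also have "(CLINT x|\<nu>. \<i> * of_real \<theta> * of_real (x * indicator {1..} x)) = \<i> * of_real \<theta> * of_real (LINT x|\<nu>. x * indicator {1..} x)"
    by (simp only: integral_mult_right_zero integral_complex_of_real)
  finally show ?thesis
    by (simp add: levy_exponent_def levy_symbol_def algebra_simps)
qed

lemma truncation_tendsto:
  fixes f :: "real \<Rightarrow> 'b::real_normed_vector"
  assumes d_lim: "d \<longlonglongrightarrow> 0"
  shows "AE x in \<nu>. (\<lambda>n. indicator {d n<..} x *\<^sub>R f x) \<longlonglongrightarrow> f x"
  using pos
proof eventually_elim
  case (elim x)
  have "eventually (\<lambda>n. d n < x) sequentially" using order_tendstoD(2)[OF d_lim elim] .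
  then have "eventually (\<lambda>n. indicator {d n<..} x *\<^sub>R f x = f x) sequentially"
    by eventually_elim auto
  then show ?case by (rule tendsto_eventually)
qed

text \<open>The approximating law has the jumps larger than \<open>d n\<close>, jumps of size \<open>- d n\<close> in place of the Gaussian part,
and the drift that compensates both. Both of its exponents converge by dominated convergence.\<close>

lemma has_transforms_levy:
  assumes t: "0 \<le> t" and P: "real_distribution P" "\<And>\<theta>. char P \<theta> = exp (of_real t * levy_symbol b \<sigma> \<theta>)"
  shows "has_transforms P (\<lambda>\<theta>. of_real t * levy_symbol b \<sigma> \<theta>) (\<lambda>s. t * laplace_exponent b \<sigma> s)"
proof -
  define d where "d n = inverse (real (Suc n))" for n
  have d: "0 < d n" "d n \<le> 1" for n by (auto simp: d_def inverse_le_1_iff)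
  have d_lim: "d \<longlonglongrightarrow> 0" unfolding d_def by (rule LIMSEQ_inverse_real_of_nat)
  have d_filter: "filterlim d (at_right 0) sequentially"
    using d_lim d(1) by (auto simp: filterlim_at intro!: always_eventually simp: less_imp_neq[symmetric])
  define \<Phi> where "\<Phi> n \<theta> = of_real t * (\<i> * of_real (\<theta> * b)
      + of_real (\<sigma>\<^sup>2) * ((iexp (- \<theta> * d n) - 1 + \<i> * of_real (\<theta> * d n)) / of_real ((d n)\<^sup>2))
      + (CLINT x|\<nu>. indicator {d n<..} x *\<^sub>R comp_iexp \<theta> x))" for n \<theta>
  define \<phi> where "\<phi> n s = t * (- s * b + \<sigma>\<^sup>2 * ((exp (s * d n) - 1 - s * d n) / (d n)\<^sup>2)
      + (LINT x|\<nu>. indicator {d n<..} x * comp_exp s x))" for n s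
  have "\<exists>R. has_transforms R (\<Phi> n) (\<phi> n)" for n
  proof -
    define I where "I = (LINT x|\<nu>. x * indicator {d n<..} x)"
    define \<beta> where "\<beta> = t * (b - I + \<sigma>\<^sup>2 / d n)"
    obtain R1 where R1: "has_transforms R1
      (\<lambda>\<theta>. of_real t * (CLINT x|\<nu>. indicator {d n<..} x *\<^sub>R (iexp (\<theta> * x) - 1)))
      (\<lambda>s. t * (LINT x|\<nu>. indicator {d n<..} x * (exp (- s * x) - 1)))"
      using truncated_transforms[OF d t, of n] by blast
    have "0 \<le> t * (\<sigma>\<^sup>2 / (d n)\<^sup>2)" using t by simp
    from small_atom_transforms[OF this, of "d n"] obtain R2 where R2: "has_transforms R2
      (\<lambda>\<theta>. of_real (t * (\<sigma>\<^sup>2 / (d n)\<^sup>2)) * (iexp (- \<theta> * d n) - 1)) (\<lambda>s. t * (\<sigma>\<^sup>2 / (d n)\<^sup>2) * (exp (s * d n) - 1))"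
      by blast
    note R = has_transforms_convolution[OF has_transforms_return[of \<beta>] has_transforms_convolution[OF R1 R2]]
    have ti: "integrable \<nu> (\<lambda>x. complex_of_real (x * indicator {d n<..} x))"
      using integrable_tail_id[OF d] by (rule integrable_of_real)
    have 1: "(CLINT x|\<nu>. indicator {d n<..} x *\<^sub>R (iexp (\<theta> * x) - 1))
        = (CLINT x|\<nu>. indicator {d n<..} x *\<^sub>R comp_iexp \<theta> x) + \<i> * of_real (\<theta> * I)" for \<theta>
    proof -
      have "(CLINT x|\<nu>. indicator {d n<..} x *\<^sub>R (iexp (\<theta> * x) - 1))
          = (CLINT x|\<nu>. indicator {d n<..} x *\<^sub>R comp_iexp \<theta> x + \<i> * of_real \<theta> * of_real (x * indicator {d n<..} x))"
        by (intro Bochner_Integration.integral_cong) (auto simp: indicator_def)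
      also have "\<dots> = (CLINT x|\<nu>. indicator {d n<..} x *\<^sub>R comp_iexp \<theta> x) + \<i> * of_real \<theta> * (CLINT x|\<nu>. of_real (x * indicator {d n<..} x))"
      proof (subst Bochner_Integration.integral_add)
        show "integrable \<nu> (\<lambda>x. indicator {d n<..} x *\<^sub>R comp_iexp \<theta> x)"
          by (rule integrable_mult_indicator[OF _ integrable_iexp_compensated]) (simp add: sets_nu)
        show "integrable \<nu> (\<lambda>x. \<i> * of_real \<theta> * complex_of_real (x * indicator {d n<..} x))"
          by (rule integrable_mult_right) (rule ti)
      qed (simp only: integral_mult_right_zero)
      also have "(CLINT x|\<nu>. of_real (x * indicator {d n<..} x)) = of_real I"
        unfolding I_def by (rule integral_complex_of_real)
      finally show ?thesis by simp
    qed
    have 2: "(LINT x|\<nu>. indicator {d n<..} x * (exp (- s * x) - 1))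
        = (LINT x|\<nu>. indicator {d n<..} x * comp_exp s x) - s * I" if s: "0 \<le> s" for s
    proof -
      have "(LINT x|\<nu>. indicator {d n<..} x * (exp (- s * x) - 1))
          = (LINT x|\<nu>. indicator {d n<..} x *\<^sub>R comp_exp s x - s * (x * indicator {d n<..} x))"
        by (intro Bochner_Integration.integral_cong) (auto simp: indicator_def)
      also have "\<dots> = (LINT x|\<nu>. indicator {d n<..} x *\<^sub>R comp_exp s x) - s * I"
      proof (subst Bochner_Integration.integral_diff)
        show "integrable \<nu> (\<lambda>x. indicator {d n<..} x *\<^sub>R comp_exp s x)"
          by (rule integrable_mult_indicator[OF _ integrable_exp_compensated[OF s]]) (simp add: sets_nu)
        show "integrable \<nu> (\<lambda>x. s * (x * indicator {d n<..} x))"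
          by (rule integrable_mult_right) (rule integrable_tail_id[OF d])
      qed (simp only: I_def integral_mult_right_zero)
      finally show ?thesis by simp
    qed
    have "\<i> * of_real (\<theta> * \<beta>) + (of_real t * (CLINT x|\<nu>. indicator {d n<..} x *\<^sub>R (iexp (\<theta> * x) - 1))
        + of_real (t * (\<sigma>\<^sup>2 / (d n)\<^sup>2)) * (iexp (- \<theta> * d n) - 1)) = \<Phi> n \<theta>" for \<theta>
      unfolding 1 \<Phi>_def \<beta>_def using d(1)[of n] by (simp add: field_simps power2_eq_square)
    moreover have "- s * \<beta> + (t * (LINT x|\<nu>. indicator {d n<..} x * (exp (- s * x) - 1))
        + t * (\<sigma>\<^sup>2 / (d n)\<^sup>2) * (exp (s * d n) - 1)) = \<phi> n s" if "0 \<le> s" for s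
      unfolding 2[OF that] \<phi>_def \<beta>_def using d(1)[of n] by (simp add: field_simps power2_eq_square)
    ultimately show ?thesis using R by (intro exI) (simp add: has_transforms_def)
  qed
  then obtain R where R: "\<And>n. has_transforms (R n) (\<Phi> n) (\<phi> n)" by metis
  note ind_lim = truncation_tendsto[OF d_lim]
  show ?thesis
  proof (rule has_transforms_limit[OF R P])
    fix \<theta>
    have "(\<lambda>n. CLINT x|\<nu>. indicator {d n<..} x *\<^sub>R comp_iexp \<theta> x)
        \<longlonglongrightarrow> (CLINT x|\<nu>. comp_iexp \<theta> x)"
      by (rule integral_dominated_convergence[OF _ _ integrable_norm[OF integrable_iexp_compensated[of \<theta>]] ind_lim])
        (auto simp: indicator_def)
    moreover have "(\<lambda>n. (iexp (- \<theta> * d n) - 1 + \<i> * of_real (\<theta> * d n)) / of_real ((d n)\<^sup>2)) \<longlonglongrightarrow> - of_real (\<theta>\<^sup>2 / 2)"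
      by (rule filterlim_compose[OF iexp_second_order_limit d_filter])
    ultimately have "(\<lambda>n. \<Phi> n \<theta>) \<longlonglongrightarrow> of_real t * (\<i> * of_real (\<theta> * b) + of_real (\<sigma>\<^sup>2) * (- of_real (\<theta>\<^sup>2 / 2))
        + (CLINT x|\<nu>. comp_iexp \<theta> x))"
      unfolding \<Phi>_def by (intro tendsto_intros)
    then show "(\<lambda>n. \<Phi> n \<theta>) \<longlonglongrightarrow> of_real t * levy_symbol b \<sigma> \<theta>"
      by (simp add: levy_symbol_def)
  next
    fix s :: real assume s: "0 \<le> s"
    have "(\<lambda>n. LINT x|\<nu>. indicator {d n<..} x * comp_exp s x)
        \<longlonglongrightarrow> (LINT x|\<nu>. comp_exp s x)"
      by (rule integral_dominated_convergence[OF _ _ integrable_norm[OF integrable_exp_compensated[OF s]]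
            ind_lim[where f="\<lambda>x. comp_exp s x", unfolded real_scaleR_def]])
        (auto simp: indicator_def)
    moreover have "(\<lambda>n. (exp (s * d n) - 1 - s * d n) / (d n)\<^sup>2) \<longlonglongrightarrow> s\<^sup>2 / 2"
      by (rule filterlim_compose[OF exp_second_order_limit d_filter])
    ultimately have "(\<lambda>n. \<phi> n s) \<longlonglongrightarrow> t * (- s * b + \<sigma>\<^sup>2 * (s\<^sup>2 / 2) + (LINT x|\<nu>. comp_exp s x))"
      unfolding \<phi>_def by (intro tendsto_mult tendsto_add tendsto_const)
    then show "(\<lambda>n. \<phi> n s) \<longlonglongrightarrow> t * laplace_exponent b \<sigma> s"
      by (simp add: laplace_exponent_def)
  qed
qed

end

text \<open>The exponential has derivative \<open>1\<close> at \<open>0\<close>, and \<open>k\<close> tends to \<open>0\<close> because its quotient by \<open>s\<close> converges.\<close>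

lemma exp_slope_at_right_0:
  fixes k :: "real \<Rightarrow> real"
  assumes k: "((\<lambda>s. k s / s) \<longlongrightarrow> c) (at_right 0)"
  shows "((\<lambda>s. (exp (k s) - 1) / s) \<longlongrightarrow> c) (at_right 0)"
proof -
  obtain g where g: "\<And>z::real. exp z - exp 0 = g z * (z - 0)" "isCont g 0" "g 0 = exp 0"
    using DERIV_exp[of "0::real"] unfolding CARAT_DERIV by blast
  have "((\<lambda>s. k s / s * s) \<longlongrightarrow> c * 0) (at_right 0)"
    using k by (intro tendsto_intros)
  moreover have "\<forall>\<^sub>F s in at_right 0. k s / s * s = k s"
    using eventually_at_right_less[of 0] by eventually_elim simp
  ultimately have k0: "(k \<longlongrightarrow> 0) (at_right 0)"
    by (simp add: tendsto_cong)
  have "((\<lambda>s. g (k s) * (k s / s)) \<longlongrightarrow> g 0 * c) (at_right 0)"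
    by (intro tendsto_mult k isCont_tendsto_compose[OF g(2) k0])
  moreover have "(\<lambda>s. (exp (k s) - 1) / s) = (\<lambda>s. g (k s) * (k s / s))"
    using g(1) by simp
  ultimately show ?thesis by (simp only: g(3) exp_zero mult_1)
qed

text \<open>Convexity of the exponential between \<open>0\<close> and \<open>- x\<close>.\<close>

lemma compensated_exp_le:
  fixes s x :: real
  assumes "0 \<le> s" "s \<le> 1"
  shows "comp_exp s x \<le> s * (exp (- x) - 1 + x)"
proof -
  have "exp ((1 - s) * 0 + s * (- x)) \<le> (1 - s) * exp 0 + s * exp (- x)"
    using convex_onD[OF exp_convex, of s 0 "- x"] assms by simp
  then show ?thesis by (simp add: algebra_simps)
qed

text \<open>By convexity the difference quotients for \<open>s \<le> 1\<close> are dominated by the one at \<open>s = 1\<close>.\<close>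

lemma compensated_exp_integral_slope:
  fixes N :: "real measure"
  assumes [measurable_cong]: "sets N = sets borel" and int: "integrable N (\<lambda>x. exp (- x) - 1 + x)"
  shows "((\<lambda>s. (LINT x|N. comp_exp s x) / s) \<longlongrightarrow> 0) (at_right 0)"
proof (rule tendsto_at_right_sequentially[of 0 1])
  fix S :: "nat \<Rightarrow> real"
  assume S: "\<And>n. 0 < S n" "\<And>n. S n < 1" "S \<longlonglongrightarrow> 0"
  then have S0: "filterlim S (at_right 0) sequentially"
    by (auto simp: filterlim_at intro!: always_eventually simp: less_imp_neq[symmetric])
  have "(\<lambda>n. LINT x|N. comp_exp (S n) x / S n) \<longlonglongrightarrow> (LINT x|N. 0)"
  proof (rule integral_dominated_convergence[OF _ _ int])
    show "AE x in N. (\<lambda>n. comp_exp (S n) x / S n) \<longlonglongrightarrow> 0"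
    proof (rule AE_I2)
      fix x
      have "((\<lambda>s::real. comp_exp s x / s) \<longlongrightarrow> 0) (at_right 0)"
        by real_asymp
      from filterlim_compose[OF this S0]
      show "(\<lambda>n. comp_exp (S n) x / S n) \<longlonglongrightarrow> 0" .
    qed
    show "AE x in N. norm (comp_exp (S n) x / S n) \<le> exp (- x) - 1 + x" for n
    proof (rule AE_I2)
      fix x
      have "0 \<le> comp_exp (S n) x"
        using exp_ge_add_one_self[of "- S n * x"] by simp
      moreover have "comp_exp (S n) x \<le> S n * (exp (- x) - 1 + x)"
        by (rule compensated_exp_le) (use S in \<open>auto simp: less_imp_le\<close>)
      ultimately show "norm (comp_exp (S n) x / S n) \<le> exp (- x) - 1 + x"
        using S(1)[of n] by (simp add: field_simps)
    qed
  qed simp_all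
  then show "(\<lambda>n. (LINT x|N. comp_exp (S n) x) / S n) \<longlonglongrightarrow> 0"
    by simp
qed simp

lemma (in one_sided_levy_measure) laplace_exponent_slope:
  "((\<lambda>s. laplace_exponent b \<sigma> s / s) \<longlongrightarrow> - b) (at_right 0)"
proof -
  have "((\<lambda>s. - b + \<sigma>\<^sup>2 * s / 2 + (LINT x|\<nu>. comp_exp s x) / s) \<longlongrightarrow> - b + \<sigma>\<^sup>2 * 0 / 2 + 0) (at_right 0)"
    using integrable_exp_compensated[of 1]
    by (intro tendsto_intros compensated_exp_integral_slope sets_nu) auto
  moreover have "\<forall>\<^sub>F s in at_right 0. - b + \<sigma>\<^sup>2 * s / 2 + (LINT x|\<nu>. comp_exp s x) / s = laplace_exponent b \<sigma> s / s"
    using eventually_at_right_less[of 0]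
    by eventually_elim (simp add: laplace_exponent_def field_simps power2_eq_square)
  ultimately show ?thesis by (simp add: tendsto_cong)
qed

text \<open>As \<open>s\<close> decreases to \<open>0\<close>, \<open>(1 - exp (- s * x)) / s\<close> increases to \<open>x\<close>. So monotone convergence yields
the integrability of \<open>x\<close> together with the value of its integral.\<close>

lemma mean_eq_laplace_slope:
  assumes P: "has_transforms P \<Phi> \<phi>" and slope: "((\<lambda>s. \<phi> s / s) \<longlongrightarrow> - b) (at_right 0)"
  shows "integrable P (\<lambda>x. x)" and "(LINT x|P. x) = b"
proof -
  interpret real_distribution P using P by (simp add: has_transforms_def)
  note Lap = has_transformsD(3,4)[OF P]
  define d where "d n = inverse (real (Suc n))" for n
  have d: "0 < d n" "d (Suc n) \<le> d n" for n by (auto simp: d_def field_simps)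
  have d_filter: "filterlim d (at_right 0) sequentially"
    using LIMSEQ_inverse_real_of_nat d(1)
    by (auto simp: filterlim_at d_def[abs_def] intro!: always_eventually simp: less_imp_neq[symmetric] simp del: of_nat_Suc)
  define f where "f n x = (1 - exp (- d n * x)) / d n" for n x
  have f_int: "integrable P (f n)" for n
    unfolding f_def [abs_def] using Lap(1)[of "d n"] d(1)[of n] by (auto simp: less_imp_le)
  have f_mono: "mono (\<lambda>n. f n x)" for x
  proof (rule incseq_SucI)
    fix n
    have "exp (- (d (Suc n) / d n) * (d n * x)) - 1 + d (Suc n) / d n * (d n * x)
        \<le> d (Suc n) / d n * (exp (- (d n * x)) - 1 + d n * x)"
      using d[of n] d(1)[of "Suc n"] by (intro compensated_exp_le) (auto simp: field_simps)
    then show "f n x \<le> f (Suc n) x"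
      using d(1)[of n] d(1)[of "Suc n"] by (simp add: f_def field_simps)
  qed
  have f_lim: "(\<lambda>n. f n x) \<longlonglongrightarrow> x" for x
  proof -
    have "((\<lambda>s::real. (1 - exp (- s * x)) / s) \<longlongrightarrow> x) (at_right 0)" by real_asymp
    from filterlim_compose[OF this d_filter] show ?thesis by (simp add: f_def)
  qed
  have "(\<lambda>n. - ((exp (\<phi> (d n)) - 1) / d n)) \<longlonglongrightarrow> - (- b)"
    by (intro tendsto_minus filterlim_compose[OF exp_slope_at_right_0[OF slope] d_filter])
  moreover have "(LINT x|P. f n x) = - ((exp (\<phi> (d n)) - 1) / d n)" for n
    unfolding f_def using Lap[of "d n"] d(1)[of n] prob_space by (simp add: less_imp_le field_simps)
  ultimately have f_ilim: "(\<lambda>n. LINT x|P. f n x) \<longlonglongrightarrow> b" by simp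
  show "integrable P (\<lambda>x. x)"
    by (rule integrable_monotone_convergence[OF f_int AE_I2[OF f_mono] AE_I2[OF f_lim] f_ilim]) simp
  show "(LINT x|P. x) = b"
    by (rule integral_monotone_convergence[OF f_int AE_I2[OF f_mono] AE_I2[OF f_lim] f_ilim]) simp
qed

section \<open>Regular variation of the jump exponent\<close>

text \<open>Iterating the inequalities for doubled arguments gives the bounds along powers of \<open>2\<close>,
and monotonicity fills the gaps at the cost of a constant. For
arguments below the threshold \<open>X\<close> the function is at most \<open>g 0\<close>, which enters the constant as well.\<close>

lemma potter_bounds:
  fixes g :: "real \<Rightarrow> real"
  assumes anti: "\<And>x y. x \<le> y \<Longrightarrow> g y \<le> g x" and pos: "\<And>x. 0 < g x"
    and rv: "((\<lambda>x. g (2 * x) / g x) \<longlongrightarrow> 2 powr (- \<alpha>)) at_top"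
    and ab: "0 < a" "a < \<alpha>" "\<alpha> < b"
  obtains X K where "0 < X" "0 < K"
    "\<And>x u. X \<le> x \<Longrightarrow> 1 \<le> u \<Longrightarrow> g (u * x) \<le> K * u powr (- a) * g x"
    "\<And>x u. X \<le> x \<Longrightarrow> 0 < u \<Longrightarrow> u \<le> 1 \<Longrightarrow> g (u * x) \<le> K * u powr (- b) * g x"
proof -
  have "eventually (\<lambda>x. g (2 * x) / g x < 2 powr (- a)) at_top"
    by (rule order_tendstoD(2)[OF rv]) (use ab in simp)
  moreover have "eventually (\<lambda>x. g (2 * x) / g x > 2 powr (- b)) at_top"
    by (rule order_tendstoD(1)[OF rv]) (use ab in simp)
  ultimately have "eventually (\<lambda>x. 2 powr (- b) * g x \<le> g (2 * x) \<and> g (2 * x) \<le> 2 powr (- a) * g x \<and> 0 < x) at_top"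
    using eventually_gt_at_top[of 0]
    by eventually_elim (use pos in \<open>auto simp: field_simps less_imp_le\<close>)
  then obtain X0 where X0: "\<And>x. X0 \<le> x \<Longrightarrow> 2 powr (- b) * g x \<le> g (2 * x) \<and> g (2 * x) \<le> 2 powr (- a) * g x \<and> 0 < x"
    by (auto simp: eventually_at_top_linorder)
  define X where "X = X0"
  have X: "0 < X" "\<And>x. X \<le> x \<Longrightarrow> 2 powr (- b) * g x \<le> g (2 * x)" "\<And>x. X \<le> x \<Longrightarrow> g (2 * x) \<le> 2 powr (- a) * g x"
    using X0[of X0] X0 by (auto simp: X_def)
  have iter: "g (2 ^ n * x) \<le> (2 ^ n) powr (- a) * g x \<and> (2 ^ n) powr (- b) * g x \<le> g (2 ^ n * x)" if "X \<le> x" for n x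
  proof (induction n)
    case (Suc n)
    have "1 * x \<le> 2 ^ n * x" using that X(1) by (intro mult_right_mono) auto
    with that have le: "X \<le> 2 ^ n * x" by simp
    have eq: "(2 ^ Suc n) powr (- c) = 2 powr (- c) * (2 ^ n) powr (- c)" for c :: real
      by (simp add: powr_mult)
    have "g (2 ^ Suc n * x) \<le> 2 powr (- a) * g (2 ^ n * x)"
      using X(3)[OF le] by (simp add: mult.assoc)
    also have "\<dots> \<le> 2 powr (- a) * ((2 ^ n) powr (- a) * g x)"
      using Suc by (intro mult_left_mono) auto
    finally have 1: "g (2 ^ Suc n * x) \<le> (2 ^ Suc n) powr (- a) * g x" unfolding eq by (simp add: mult.assoc)
    have "2 powr (- b) * ((2 ^ n) powr (- b) * g x) \<le> 2 powr (- b) * g (2 ^ n * x)"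
      using Suc by (intro mult_left_mono) auto
    also have "\<dots> \<le> g (2 ^ Suc n * x)"
      using X(2)[OF le] by (simp add: mult.assoc)
    finally show ?case using 1 unfolding eq by (simp add: mult.assoc)
  qed simp
  have bracket: "\<exists>n. 2 ^ n \<le> u \<and> u \<le> 2 ^ Suc n" if u: "1 \<le> u" for u :: real
  proof -
    define n where "n = nat \<lfloor>log 2 u\<rfloor>"
    have "0 \<le> log 2 u" using u by simp
    then have n: "real n \<le> log 2 u" "log 2 u \<le> real (Suc n)"
      unfolding n_def by linarith+
    have "2 powr real n \<le> u" "u \<le> 2 powr real (Suc n)"
      using n u by (simp_all add: le_log_iff log_le_iff del: of_nat_Suc)
    then show ?thesis by (intro exI[of _ n]) (simp add: powr_realpow[symmetric] del: power_Suc of_nat_Suc)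
  qed
  define K1 where "K1 = 2 powr b"
  define K where "K = max K1 (K1 * (g 0 / g X))"
  have K1: "1 \<le> K1" "0 < K1" "2 powr a \<le> K1" using ab unfolding K1_def by (auto simp: ge_one_powr_ge_zero)
  have up: "g (u * x) \<le> K1 * u powr (- a) * g x" if x: "X \<le> x" and u: "1 \<le> u" for x u
  proof -
    obtain n where n: "2 ^ n \<le> u" "u \<le> 2 ^ Suc n" using bracket[OF u] by blast
    have "g (u * x) \<le> g (2 ^ n * x)" using n x X(1) by (intro anti mult_right_mono) auto
    also have "\<dots> \<le> (2 ^ n) powr (- a) * g x" using iter[OF x] by blast
    also have "(2 ^ n) powr (- a) \<le> K1 * u powr (- a)"
    proof -
      have "(2 ^ n) powr (- a) = 2 powr a * (2 ^ Suc n) powr (- a)"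
        by (simp add: powr_mult powr_minus field_simps)
      also have "\<dots> \<le> K1 * u powr (- a)"
        using K1 n u ab by (intro mult_mono powr_mono2') auto
      finally show ?thesis .
    qed
    finally show ?thesis using pos[of x] by (simp add: mult_right_mono)
  qed
  have lo: "g y \<le> K1 * v powr b * g (v * y)" if y: "X \<le> y" and v: "1 \<le> v" for y v
  proof -
    obtain n where n: "2 ^ n \<le> v" "v \<le> 2 ^ Suc n" using bracket[OF v] by blast
    have "(2 ^ Suc n) powr (- b) * g y \<le> g (2 ^ Suc n * y)" using iter[OF y] by blast
    also have "\<dots> \<le> g (v * y)" using n y X(1) by (intro anti mult_right_mono) auto
    finally have "g y \<le> (2 ^ Suc n) powr b * g (v * y)"
      by (simp add: powr_minus field_simps)
    also have "\<dots> \<le> (K1 * v powr b) * g (v * y)"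
    proof (intro mult_right_mono)
      have "(2 ^ Suc n) powr b \<le> (2 * v) powr b" using n v ab by (intro powr_mono2) auto
      then show "(2 ^ Suc n) powr b \<le> K1 * v powr b" using v by (simp add: powr_mult K1_def)
    qed (use pos less_imp_le in auto)
    finally show ?thesis .
  qed
  show thesis
  proof (rule that[of X K])
    show "0 < K" using K1 by (simp add: K_def)
    show "g (u * x) \<le> K * u powr (- a) * g x" if "X \<le> x" "1 \<le> u" for x u
    proof -
      have "K1 * (u powr (- a) * g x) \<le> K * (u powr (- a) * g x)"
        using pos[of x] by (intro mult_right_mono) (auto simp: K_def)
      then show ?thesis using up[OF that] by (simp add: mult.assoc)
    qed
    show "g (u * x) \<le> K * u powr (- b) * g x" if x: "X \<le> x" and u: "0 < u" "u \<le> 1" for x u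
    proof (cases "X \<le> u * x")
      case True
      have "g (u * x) \<le> K1 * (1 / u) powr b * g (1 / u * (u * x))"
        using u by (intro lo True) auto
      also have "\<dots> = K1 * (u powr (- b) * g x)"
      proof -
        have "1 / u * (u * x) = x" "(1 / u) powr b = u powr (- b)"
          using u by (simp_all add: powr_divide powr_minus_divide)
        then show ?thesis by simp
      qed
      also have "\<dots> \<le> K * (u powr (- b) * g x)"
        using pos[of x] by (intro mult_right_mono) (auto simp: K_def)
      finally show ?thesis by (simp add: mult.assoc)
    next
      case False
      have ux: "u \<le> X / x" using False X(1) x by (simp add: field_simps)
      have "g X \<le> K1 * (x / X) powr b * g (x / X * X)"
        using X(1) x by (intro lo) auto
      also have "\<dots> = K1 * (x / X) powr b * g x" using X(1) by simp
      also have "\<dots> \<le> K1 * u powr (- b) * g x"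
      proof (intro mult_right_mono mult_left_mono)
        have "x / X \<le> 1 / u" using ux u x X(1) by (simp add: field_simps)
        then have "(x / X) powr b \<le> (1 / u) powr b" using x X(1) ab by (intro powr_mono2) auto
        then show "(x / X) powr b \<le> u powr (- b)" using u by (simp add: powr_divide powr_minus_divide)
      qed (use pos[of x] K1 in auto)
      finally have gX: "g X \<le> K1 * u powr (- b) * g x" .
      have "g (u * x) \<le> g 0" using u x X(1) by (intro anti) auto
      also have "g 0 = g 0 / g X * g X" using pos[of X] by simp
      also have "\<dots> \<le> g 0 / g X * (K1 * u powr (- b) * g x)"
        using pos[of 0] pos[of X] by (intro mult_left_mono gX) auto
      also have "\<dots> = K1 * (g 0 / g X) * (u powr (- b) * g x)" by simp
      also have "\<dots> \<le> K * (u powr (- b) * g x)"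
        using pos[of x] by (intro mult_right_mono) (auto simp: K_def)
      finally show ?thesis by (simp add: mult.assoc)
    qed
  qed (rule X(1))
qed

lemma integrable_powr_pieces:
  fixes a b :: real
  assumes "1 < a" "b < 2"
  shows "integrable lborel (\<lambda>u. indicator {0<..} u * ((1 - exp (- u)) * (if u \<le> 1 then u powr (- b) else u powr (- a))))"
proof -
  have i1: "integrable lborel (\<lambda>u. indicator {0<..1} u * u powr (1 - b))"
  proof -
    have "set_integrable lebesgue {0<..1} (\<lambda>u::real. u powr (1 - b))"
      using assms by (intro nonnegative_absolutely_integrable_1 integrable_on_powr_from_0') auto
    then show ?thesis unfolding set_integrable_def by (subst (asm) integrable_completion) auto
  qed
  have i2: "integrable lborel (\<lambda>u. indicator {1..} u * u powr (- a))"
  proof -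
    have "(\<lambda>u::real. u powr (- a)) integrable_on {1..}"
      using has_integral_powr_to_inf[of "- a" 1] assms by (auto simp: integrable_on_def)
    then have "set_integrable lebesgue {1..} (\<lambda>u::real. u powr (- a))"
      by (intro nonnegative_absolutely_integrable_1) auto
    then show ?thesis unfolding set_integrable_def by (subst (asm) integrable_completion) auto
  qed
  show ?thesis
  proof (rule Bochner_Integration.integrable_bound[OF Bochner_Integration.integrable_add[OF i1 i2]])
    show "AE u in lborel. norm (indicator {0<..} u * ((1 - exp (- u)) * (if u \<le> 1 then u powr (- b) else u powr (- a))))
        \<le> norm (indicator {0<..1} u * u powr (1 - b) + indicator {1..} u * u powr (- a))"
    proof (rule AE_I2)
      fix u :: real
      show "norm (indicator {0<..} u * ((1 - exp (- u)) * (if u \<le> 1 then u powr (- b) else u powr (- a))))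
          \<le> norm (indicator {0<..1} u * u powr (1 - b) + indicator {1..} u * u powr (- a))"
      proof (cases "0 < u")
        case True
        have e: "0 \<le> 1 - exp (- u)" "1 - exp (- u) \<le> u" "1 - exp (- u) \<le> 1"
          using True exp_ge_add_one_self[of "- u"] by auto
        show ?thesis
        proof (cases "u \<le> 1")
          case le: True
          have "(1 - exp (- u)) * u powr (- b) \<le> u powr 1 * u powr (- b)"
            using e True by (intro mult_right_mono) auto
          also have "\<dots> = u powr (1 - b)" unfolding powr_add [symmetric] by simp
          finally show ?thesis using True le e by (auto simp: abs_mult intro!: add_increasing2)
        next
          case False
          have "(1 - exp (- u)) * u powr (- a) \<le> 1 * u powr (- a)"
            using e by (intro mult_right_mono) auto
          then show ?thesis using True False e by (auto simp: abs_mult)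
        qed
      qed simp
    qed
  qed measurable
qed

abbreviation abel_kernel :: "(real \<Rightarrow> real) \<Rightarrow> real \<Rightarrow> real \<Rightarrow> real" where
  "abel_kernel g x u \<equiv> indicator {0<..} u * ((1 - exp (- u)) * g (u * x))"

text \<open>Dominated convergence. The exponents of the Potter bounds are chosen on either side of \<open>\<alpha>\<close> but still between \<open>1\<close> and \<open>2\<close>,
which makes the majorant integrable at infinity and, thanks to the factor \<open>1 - exp (- u)\<close>, at \<open>0\<close>.\<close>

lemma abelian_integral:
  fixes g :: "real \<Rightarrow> real"
  assumes anti: "\<And>x y. x \<le> y \<Longrightarrow> g y \<le> g x" and pos: "\<And>x. 0 < g x"
    and rv: "\<And>l. 0 < l \<Longrightarrow> ((\<lambda>x. g (l * x) / g x) \<longlongrightarrow> l powr (- \<alpha>)) at_top"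
    and \<alpha>: "1 < \<alpha>" "\<alpha> < 2"
  obtains C where "0 < C"
    "\<forall>\<^sub>F x in at_top. integrable lborel (\<lambda>u. abel_kernel g x u)"
    "((\<lambda>x. (LINT u|lborel. abel_kernel g x u) / g x) \<longlongrightarrow> C) at_top"
    "((\<lambda>x. 1 / (x\<^sup>2 * g x)) \<longlongrightarrow> 0) at_top"
proof -
  \<comment> \<open>Half of the room that \<open>\<alpha>\<close> has in the open interval from \<open>1\<close> to \<open>2\<close>.\<close>
  define e where "e = min (\<alpha> - 1) (2 - \<alpha>) / 2"
  define a where "a = \<alpha> - e"
  define b where "b = \<alpha> + e"
  have "0 < e" "e < \<alpha> - 1" "e < 2 - \<alpha>" using \<alpha> by (auto simp: e_def min_def field_simps)
  then have ab: "1 < a" "a < \<alpha>" "\<alpha> < b" "b < 2" by (auto simp: a_def b_def)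
  have rv2: "((\<lambda>x. g (2 * x) / g x) \<longlongrightarrow> 2 powr (- \<alpha>)) at_top" by (rule rv) simp
  obtain X K where XK: "0 < X" "0 < K"
    "\<And>x u. X \<le> x \<Longrightarrow> 1 \<le> u \<Longrightarrow> g (u * x) \<le> K * u powr (- a) * g x"
    "\<And>x u. X \<le> x \<Longrightarrow> 0 < u \<Longrightarrow> u \<le> 1 \<Longrightarrow> g (u * x) \<le> K * u powr (- b) * g x"
    using potter_bounds[OF anti pos rv2, of a b] ab by auto
  have [measurable]: "g \<in> borel_measurable borel"
  proof -
    have "mono (\<lambda>x. - g x)" using anti by (simp add: mono_def)
    then have "(\<lambda>x. - (- g x)) \<in> borel_measurable borel"
      by (intro borel_measurable_uminus borel_measurable_mono)
    then show ?thesis by simp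
  qed
  define p where "p u = indicator {0<..} u * ((1 - exp (- u)) * (if u \<le> 1 then u powr (- b) else u powr (- a)))" for u :: real
  have p: "integrable lborel p" unfolding p_def [abs_def] by (rule integrable_powr_pieces) (use ab in auto)
  have bound: "norm (abel_kernel g x u) \<le> K * p u * g x" if x: "X \<le> x" for x u
  proof (cases "0 < u")
    case True
    have e: "0 \<le> 1 - exp (- u)" using True by simp
    have "g (u * x) \<le> K * (if u \<le> 1 then u powr (- b) else u powr (- a)) * g x"
      using XK(3,4)[OF x, of u] True by auto
    then have "(1 - exp (- u)) * g (u * x) \<le> (1 - exp (- u)) * (K * (if u \<le> 1 then u powr (- b) else u powr (- a)) * g x)"
      using e by (rule mult_left_mono)
    then show ?thesis using True e pos[of "u * x"] by (simp add: p_def abs_mult mult_ac split: if_splits)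
  qed (simp add: p_def)
  define f where "f u = indicator {0<..} u * ((1 - exp (- u)) * u powr (- \<alpha>))" for u :: real
  have f_meas [measurable]: "f \<in> borel_measurable borel" unfolding f_def [abs_def] by measurable
  define S where "S x u = abel_kernel g x u / g x" for x u
  have lim: "AE u in lborel. ((\<lambda>x. S x u) \<longlongrightarrow> f u) at_top"
  proof (rule AE_I2)
    fix u :: real
    show "((\<lambda>x. S x u) \<longlongrightarrow> f u) at_top"
    proof (cases "0 < u")
      case True
      have "((\<lambda>x. (1 - exp (- u)) * (g (u * x) / g x)) \<longlongrightarrow> (1 - exp (- u)) * u powr (- \<alpha>)) at_top"
        by (intro tendsto_intros rv True)
      then show ?thesis using True by (simp add: S_def f_def)
    qed (simp add: S_def f_def)
  qed
  have S_bound: "\<forall>\<^sub>F x in at_top. AE u in lborel. norm (S x u) \<le> K * p u"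
    using eventually_ge_at_top[of X]
  proof eventually_elim
    case (elim x)
    show ?case
    proof (rule AE_I2)
      fix u
      show "norm (S x u) \<le> K * p u"
        using bound[OF elim, of u] pos[of x] by (simp add: S_def abs_mult field_simps)
    qed
  qed
  have S_meas: "S x \<in> borel_measurable lborel" for x unfolding S_def [abs_def] by measurable
  have Kp: "integrable lborel (\<lambda>u. K * p u)" using p by simp
  have fl: "f \<in> borel_measurable lborel" by simp
  have S_lim: "((\<lambda>x. LINT u|lborel. S x u) \<longlongrightarrow> (LINT u|lborel. f u)) at_top"
    by (rule integral_dominated_convergence_at_top[OF fl S_meas Kp lim S_bound])
  have f_int: "integrable lborel f"
    by (rule integrable_dominated_convergence_at_top[OF fl S_meas Kp lim S_bound])
  have "0 < (LINT u|lborel. f u)"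
  proof -
    have "0 < (1 - exp (- 1)) * 2 powr (- \<alpha>)" by simp
    also have "\<dots> = (LINT u|lborel. indicator {1..2::real} u * ((1 - exp (- 1)) * 2 powr (- \<alpha>)))"
      by (simp add: lebesgue_integral_const)
    also have "\<dots> \<le> (LINT u|lborel. f u)"
    proof (rule integral_mono[OF _ f_int])
      show "integrable lborel (\<lambda>u. indicator {1..2::real} u * ((1 - exp (- 1)) * 2 powr (- \<alpha>)))"
        by (intro integrable_mult_left) (simp add: integrable_indicator_iff)
      fix u :: real
      show "indicator {1..2} u * ((1 - exp (- 1)) * 2 powr (- \<alpha>)) \<le> f u"
      proof (cases "1 \<le> u \<and> u \<le> 2")
        case True
        then have "(1 - exp (- 1)) * 2 powr (- \<alpha>) \<le> (1 - exp (- u)) * u powr (- \<alpha>)"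
          using \<alpha> by (intro mult_mono powr_mono2') auto
        then show ?thesis using True by (simp add: f_def)
      qed (auto simp: f_def indicator_def)
    qed
    finally show ?thesis .
  qed
  moreover have "\<forall>\<^sub>F x in at_top. integrable lborel (\<lambda>u. abel_kernel g x u)"
    using eventually_ge_at_top[of X]
  proof eventually_elim
    case (elim x)
    show ?case
    proof (rule Bochner_Integration.integrable_bound)
      show "integrable lborel (\<lambda>u. K * p u * g x)" using p by simp
      show "AE u in lborel. norm (abel_kernel g x u) \<le> norm (K * p u * g x)"
        using bound[OF elim] by (intro AE_I2) (metis abs_ge_self order_trans real_norm_def)
    qed measurable
  qed
  moreover have "((\<lambda>x. (LINT u|lborel. abel_kernel g x u) / g x) \<longlongrightarrow> (LINT u|lborel. f u)) at_top"
    using S_lim unfolding S_def [abs_def] by simp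
  moreover have "((\<lambda>x. 1 / (x\<^sup>2 * g x)) \<longlongrightarrow> 0) at_top"
  proof (rule Lim_null_comparison)
    show "((\<lambda>x. K / (g X * X powr b) * x powr (b - 2)) \<longlongrightarrow> 0) at_top"
      using ab by (intro tendsto_mult_right_zero tendsto_neg_powr filterlim_ident) auto
    show "\<forall>\<^sub>F x in at_top. norm (1 / (x\<^sup>2 * g x)) \<le> K / (g X * X powr b) * x powr (b - 2)"
      using eventually_ge_at_top[of X]
    proof eventually_elim
      case (elim x)
      have x: "0 < x" using elim XK(1) by simp
      have "g X \<le> K * (X / x) powr (- b) * g x"
        using XK(4)[OF elim, of "X / x"] elim XK(1) x by simp
      also have "(X / x) powr (- b) = x powr b / X powr b"
        using x XK(1) by (simp add: powr_divide powr_minus field_simps)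
      finally have "g X * X powr b \<le> K * x powr b * g x"
        using XK(1) by (simp add: field_simps)
      moreover have "x powr (b - 2) = x powr b / x\<^sup>2"
        using x by (simp add: powr_diff)
      ultimately show ?case
        using pos[of x] pos[of X] XK(1) x by (simp add: field_simps abs_mult)
    qed
  qed
  ultimately show thesis by (rule that)
qed

text \<open>The compensated exponential is the integral of \<open>s * (1 - exp (- s * y))\<close> over \<open>0 < y < x\<close>; exchange the integrals
and substitute \<open>y = u / s\<close>.\<close>

lemma nn_integral_compensated_exp_tail:
  fixes N :: "real measure"
  assumes sN [measurable_cong]: "sets N = sets borel" and fin: "finite_measure N"
    and pos: "AE x in N. 0 < x" and s: "0 < s"
  shows "(\<integral>\<^sup>+x. ennreal (comp_exp s x) \<partial>N)
    = (\<integral>\<^sup>+u. ennreal (indicator {0<..} u * ((1 - exp (- u)) * measure N {u / s<..})) \<partial>lborel)"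
proof -
  interpret N: finite_measure N by fact
  interpret NL: pair_sigma_finite N lborel ..
  define k where "k y = s * (1 - exp (- s * y))" for y :: real
  have [measurable]: "k \<in> borel_measurable borel" unfolding k_def [abs_def] by measurable
  have [measurable]: "(\<lambda>y. measure N {y<..}) \<in> borel_measurable borel"
  proof -
    have "mono (\<lambda>y. - measure N {y<..})"
      by (auto simp: mono_def sN intro!: N.finite_measure_mono)
    then have "(\<lambda>y. - (- measure N {y<..})) \<in> borel_measurable borel"
      by (intro borel_measurable_uminus borel_measurable_mono)
    then show ?thesis by simp
  qed
  have k0: "0 \<le> y \<Longrightarrow> 0 \<le> k y" for y using s by (simp add: k_def)
  have inner: "(\<integral>\<^sup>+y. ennreal (indicator {0<..} y * k y) * indicator {y<..} x \<partial>lborel) = ennreal (comp_exp s x)" if x: "0 < x" for x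
  proof -
    have "(\<integral>\<^sup>+y. ennreal (indicator {0<..} y * k y) * indicator {y<..} x \<partial>lborel)
        = (\<integral>\<^sup>+y. ennreal (k y) * indicator {0..x} y \<partial>lborel)"
      by (intro nn_integral_cong_AE, use AE_lborel_singleton[of x] AE_lborel_singleton[of 0] in eventually_elim)
        (auto simp: indicator_def)
    also have "\<dots> = ennreal ((exp (- s * x) + s * x) - (exp (- s * 0) + s * 0))"
    proof (rule nn_integral_FTC_Icc)
      show "((\<lambda>y. exp (- s * y) + s * y) has_real_derivative k y) (at y)" for y
        by (auto intro!: derivative_eq_intros simp: k_def algebra_simps)
    qed (use k0 x in auto)
    finally show ?thesis by (simp add: algebra_simps)
  qed
  have "(\<integral>\<^sup>+x. ennreal (comp_exp s x) \<partial>N)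
      = (\<integral>\<^sup>+x. \<integral>\<^sup>+y. ennreal (indicator {0<..} y * k y) * indicator {y<..} x \<partial>lborel \<partial>N)"
    by (intro nn_integral_cong_AE, use pos in eventually_elim) (simp add: inner)
  also have "\<dots> = (\<integral>\<^sup>+x. \<integral>\<^sup>+y. ennreal (indicator {0<..} y * k y) * (if y < x then 1 else 0) \<partial>lborel \<partial>N)"
    by (auto simp: indicator_def intro!: nn_integral_cong)
  also have "\<dots> = (\<integral>\<^sup>+y. \<integral>\<^sup>+x. ennreal (indicator {0<..} y * k y) * (if y < x then 1 else 0) \<partial>N \<partial>lborel)"
    by (rule NL.Fubini'[symmetric]) measurable
  also have "\<dots> = (\<integral>\<^sup>+y. \<integral>\<^sup>+x. ennreal (indicator {0<..} y * k y) * indicator {y<..} x \<partial>N \<partial>lborel)"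
    by (auto simp: indicator_def intro!: nn_integral_cong)
  also have "\<dots> = (\<integral>\<^sup>+y. ennreal (indicator {0<..} y * (k y * measure N {y<..})) \<partial>lborel)"
  proof (rule nn_integral_cong)
    fix y
    show "(\<integral>\<^sup>+x. ennreal (indicator {0<..} y * k y) * indicator {y<..} x \<partial>N) = ennreal (indicator {0<..} y * (k y * measure N {y<..}))"
      using k0[of y] by (cases "0 < y") (auto simp: nn_integral_cmult N.emeasure_eq_measure ennreal_mult)
  qed
  also have "\<dots> = \<bar>1 / s\<bar> * (\<integral>\<^sup>+u. ennreal (indicator {0<..} (0 + 1 / s * u) * (k (0 + 1 / s * u) * measure N {0 + 1 / s * u<..})) \<partial>lborel)"
    by (rule nn_integral_real_affine) (use s in simp_all)
  also have "\<dots> = (\<integral>\<^sup>+u. \<bar>1 / s\<bar> * ennreal (indicator {0<..} (0 + 1 / s * u) * (k (0 + 1 / s * u) * measure N {0 + 1 / s * u<..})) \<partial>lborel)"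
    by (rule nn_integral_cmult[symmetric]) measurable
  also have "\<dots> = (\<integral>\<^sup>+u. ennreal (indicator {0<..} u * ((1 - exp (- u)) * measure N {u / s<..})) \<partial>lborel)"
    using s by (intro nn_integral_cong) (auto simp: indicator_def k_def zero_less_divide_iff simp flip: ennreal_mult)
  finally show ?thesis .
qed

locale regularly_varying_levy_measure =
  fixes \<nu> :: "real measure" and \<alpha> :: real
  assumes nu_borel [measurable_cong]: "sets \<nu> = sets borel"
    and nu_pos: "AE x in \<nu>. 0 < x"
    and nu_finite: "(\<integral>\<^sup>+x. ennreal (min 1 (x\<^sup>2)) \<partial>\<nu>) < \<infinity>"
    and alpha: "1 < \<alpha>" "\<alpha> < 2"
    and tail_rv: "regularly_varying_at_infinity (\<lambda>x. measure \<nu> {x<..}) (- \<alpha>)"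
begin

text \<open>Jumps of size at most \<open>1\<close> contribute only \<open>O(s\<^sup>2)\<close> to the jump exponent. Cutting them off makes
the measure finite, and its tail is positive and monotone on the whole line.\<close>

definition "big_jumps = density \<nu> (indicator {1<..})"
definition "big_tail y = measure big_jumps {y<..}"

lemma integrable_min_one: "integrable \<nu> (\<lambda>x. min 1 (x\<^sup>2))"
  using nu_finite by (intro integrableI_nonneg) auto

lemma tail_finite:
  assumes "0 < y" shows "emeasure \<nu> {y<..} < \<infinity>"
proof -
  have "integrable \<nu> (indicator {y<..} :: real \<Rightarrow> real)"
  proof (rule Bochner_Integration.integrable_bound)
    show "integrable \<nu> (\<lambda>x. 1 / min 1 (y\<^sup>2) * min 1 (x\<^sup>2))" using integrable_min_one by simp
    show "AE x in \<nu>. norm (indicator {y<..} x :: real) \<le> norm (1 / min 1 (y\<^sup>2) * min 1 (x\<^sup>2))"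
    proof (rule AE_I2)
      fix x :: real
      show "norm (indicator {y<..} x :: real) \<le> norm (1 / min 1 (y\<^sup>2) * min 1 (x\<^sup>2))"
      proof (cases "y < x")
        case True
        then have "y\<^sup>2 \<le> x\<^sup>2" using assms by (intro power_mono) auto
        then have "min 1 (y\<^sup>2) \<le> min 1 (x\<^sup>2)" by auto
        moreover have "0 < min 1 (y\<^sup>2)" using assms by simp
        ultimately have "1 \<le> 1 / min 1 (y\<^sup>2) * min 1 (x\<^sup>2)" by (simp add: field_simps)
        then show ?thesis using True by simp
      qed simp
    qed
  qed measurable
  then show ?thesis by (simp add: integrable_indicator_iff nu_borel sets_eq_imp_space_eq[OF nu_borel])
qed

lemma big_jumps_borel [measurable_cong]: "sets big_jumps = sets borel"
  by (simp add: big_jumps_def nu_borel)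

lemma emeasure_big_jumps: "emeasure big_jumps {y<..} = emeasure \<nu> {max y 1<..}"
proof -
  have "emeasure big_jumps {y<..} = (\<integral>\<^sup>+x. indicator {max y 1<..} x \<partial>\<nu>)"
  proof -
    have "emeasure big_jumps {y<..} = (\<integral>\<^sup>+x. indicator {1<..} x * indicator {y<..} x \<partial>\<nu>)"
      unfolding big_jumps_def by (rule emeasure_density) (simp_all add: nu_borel)
    also have "\<dots> = (\<integral>\<^sup>+x. indicator {max y 1<..} x \<partial>\<nu>)"
      by (rule nn_integral_cong) (auto split: split_indicator)
    finally show ?thesis .
  qed
  then show ?thesis by (simp add: nu_borel)
qed

lemma big_tail_eq: "big_tail y = measure \<nu> {max y 1<..}"
  by (simp add: big_tail_def measure_def emeasure_big_jumps)

lemma big_jumps_finite: "finite_measure big_jumps"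
proof (rule finite_measureI)
  have "emeasure big_jumps (space big_jumps) = (\<integral>\<^sup>+x. indicator {1<..} x \<partial>\<nu>)"
    unfolding big_jumps_def by (subst emeasure_density)
      (auto simp: nu_borel sets_eq_imp_space_eq[OF nu_borel] intro!: nn_integral_cong)
  also have "\<dots> = emeasure \<nu> {1<..}" by (simp add: nu_borel)
  also have "\<dots> < \<infinity>" by (rule tail_finite) simp
  finally show "emeasure big_jumps (space big_jumps) \<noteq> \<infinity>" by simp
qed

lemma big_jumps_pos: "AE x in big_jumps. 0 < x"
  unfolding big_jumps_def by (subst AE_density) (auto simp: indicator_def)

lemma big_tail_antimono: "x \<le> y \<Longrightarrow> big_tail y \<le> big_tail x"
  unfolding big_tail_def by (rule finite_measure.finite_measure_mono[OF big_jumps_finite]) (auto simp: big_jumps_borel)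

lemma big_tail_pos: "0 < big_tail y"
proof -
  obtain c where c: "\<And>x. c \<le> x \<Longrightarrow> 0 < measure \<nu> {x<..}"
    using tail_rv by (auto simp: regularly_varying_at_infinity_def)
  have "0 < measure \<nu> {max (max y c) 1<..}" by (rule c) auto
  also have "\<dots> = big_tail (max y c)" by (simp add: big_tail_eq)
  also have "\<dots> \<le> big_tail y" by (rule big_tail_antimono) simp
  finally show ?thesis .
qed

lemma big_tail_rv: assumes "0 < l" shows "((\<lambda>x. big_tail (l * x) / big_tail x) \<longlongrightarrow> l powr (- \<alpha>)) at_top"
proof -
  have "((\<lambda>x. measure \<nu> {l * x<..} / measure \<nu> {x<..}) \<longlongrightarrow> l powr (- \<alpha>)) at_top"
    using tail_rv assms by (auto simp: regularly_varying_at_infinity_def)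
  moreover have "\<forall>\<^sub>F x in at_top. measure \<nu> {l * x<..} / measure \<nu> {x<..} = big_tail (l * x) / big_tail x"
    using eventually_ge_at_top[of 1] eventually_ge_at_top[of "1 / l"]
  proof eventually_elim
    case (elim x)
    then have "1 \<le> l * x" using assms by (simp add: field_simps)
    then show ?case using elim by (simp add: big_tail_eq max_def)
  qed
  ultimately show ?thesis by (simp add: tendsto_cong)
qed

definition "abel_integral x = (LINT u|lborel. abel_kernel big_tail x u)"

lemma big_jumps_integral:
  assumes x: "0 < x" and int: "integrable lborel (\<lambda>u. abel_kernel big_tail x u)"
  shows "integrable big_jumps (\<lambda>y. comp_exp (1 / x) y)"
    and "(LINT y|big_jumps. comp_exp (1 / x) y) = abel_integral x"
proof -
  have nn: "0 \<le> comp_exp (1 / x) y" for y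
    using exp_ge_add_one_self[of "- (1 / x) * y"] by simp
  have "(\<integral>\<^sup>+y. ennreal (comp_exp (1 / x) y) \<partial>big_jumps)
      = (\<integral>\<^sup>+u. ennreal (indicator {0<..} u * ((1 - exp (- u)) * measure big_jumps {u / (1 / x)<..})) \<partial>lborel)"
    by (rule nn_integral_compensated_exp_tail[OF big_jumps_borel big_jumps_finite big_jumps_pos]) (use x in simp)
  also have "\<dots> = (\<integral>\<^sup>+u. ennreal (abel_kernel big_tail x u) \<partial>lborel)"
    by (simp add: big_tail_def)
  also have "\<dots> = ennreal (abel_integral x)"
    unfolding abel_integral_def using int big_tail_pos by (intro nn_integral_eq_integral) (auto simp: indicator_def less_imp_le)
  finally have eq: "(\<integral>\<^sup>+y. ennreal (comp_exp (1 / x) y) \<partial>big_jumps) = ennreal (abel_integral x)" .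
  show *: "integrable big_jumps (\<lambda>y. comp_exp (1 / x) y)"
    by (rule integrableI_nonneg) (use eq nn in auto)
  have "0 \<le> abel_integral x" unfolding abel_integral_def
    by (intro integral_nonneg_AE AE_I2) (auto simp: indicator_def less_imp_le[OF big_tail_pos])
  then show "(LINT y|big_jumps. comp_exp (1 / x) y) = abel_integral x"
    using eq nn_integral_eq_integral[OF * AE_I2[OF nn]] integral_nonneg_AE[OF AE_I2[OF nn], of big_jumps]
    by simp
qed

lemma abelian:
  obtains C where "0 < C"
    "\<forall>\<^sub>F x in at_top. integrable lborel (\<lambda>u. abel_kernel big_tail x u)"
    "((\<lambda>x. abel_integral x / big_tail x) \<longlongrightarrow> C) at_top"
    "((\<lambda>x. 1 / (x\<^sup>2 * big_tail x)) \<longlongrightarrow> 0) at_top"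
  by (rule abelian_integral[OF big_tail_antimono big_tail_pos big_tail_rv alpha, folded abel_integral_def]) (assumption | rule that; assumption)+

text \<open>For small \<open>s\<close> the compensated exponential is integrable by the Abelian asymptotics, and it grows linearly in \<open>x\<close>.\<close>

lemma integrable_big_jumps_id: "integrable big_jumps (\<lambda>x. x)"
proof -
  interpret big_jumps: finite_measure big_jumps by (rule big_jumps_finite)
  obtain C where "0 < C"
    and ev: "\<forall>\<^sub>F x in at_top. integrable lborel (\<lambda>u. abel_kernel big_tail x u)"
    and "((\<lambda>x. abel_integral x / big_tail x) \<longlongrightarrow> C) at_top" "((\<lambda>x. 1 / (x\<^sup>2 * big_tail x)) \<longlongrightarrow> 0) at_top"
    using abelian by metis
  have "\<forall>\<^sub>F x in at_top. integrable lborel (\<lambda>u. abel_kernel big_tail x u) \<and> 0 < x"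
    using ev eventually_gt_at_top[of 0] by eventually_elim simp
  from eventually_happens'[OF _ this]
  obtain x where x: "integrable lborel (\<lambda>u. abel_kernel big_tail x u)" "0 < x"
    by (auto simp: trivial_limit_at_top_linorder)
  show ?thesis
  proof (rule Bochner_Integration.integrable_bound)
    show "integrable big_jumps (\<lambda>y. x * comp_exp (1 / x) y + x)"
      using big_jumps_integral(1)[OF x(2,1)] by simp
    show "AE y in big_jumps. norm y \<le> norm (x * comp_exp (1 / x) y + x)"
      using big_jumps_pos
    proof eventually_elim
      case (elim y)
      have "x * comp_exp (1 / x) y + x = x * exp (- (1 / x) * y) + y"
        using x(2) by (simp add: field_simps)
      then show ?case using elim x(2) by simp
    qed
  qed simp
qed

sublocale one_sided_levy_measure \<nu>
proof
  show "sets \<nu> = sets borel" "AE x in \<nu>. 0 < x" by (fact nu_borel nu_pos)+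
  have "integrable \<nu> (\<lambda>x. indicator {1<..} x *\<^sub>R x)"
  proof -
    have "big_jumps = density \<nu> (\<lambda>x. ennreal (indicator {1<..} x))"
      unfolding big_jumps_def by (simp add: ennreal_indicator)
    with integrable_big_jumps_id have "integrable (density \<nu> (\<lambda>x. ennreal (indicator {1<..} x))) (\<lambda>x. x)" by simp
    then show ?thesis by (subst (asm) integrable_density) auto
  qed
  then have "integrable \<nu> (\<lambda>x. min 1 (x\<^sup>2) + indicator {1<..} x * x)"
    using integrable_min_one by simp
  then show "integrable \<nu> (\<lambda>x. min x (x\<^sup>2))"
  proof (rule Bochner_Integration.integrable_bound)
    show "AE x in \<nu>. norm (min x (x\<^sup>2)) \<le> norm (min 1 (x\<^sup>2) + indicator {1<..} x * x)"
      using nu_pos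
    proof eventually_elim
      case (elim x)
      show ?case
      proof (cases "x \<le> 1")
        case True
        then have "x\<^sup>2 \<le> x" "x\<^sup>2 \<le> 1" using elim by (auto simp: power2_eq_square mult_left_le mult_le_one)
        then show ?thesis using True elim by simp
      next
        case False
        then have "x \<le> x\<^sup>2" "1 \<le> x\<^sup>2" by (auto simp: power2_eq_square one_le_mult_iff intro: less_1_mult[THEN less_imp_le])
        then show ?thesis using False by simp
      qed
    qed
  qed measurable
qed

definition "r s = (LINT x|\<nu>. comp_exp s x)"

lemma r_split:
  assumes s: "0 \<le> s"
  obtains A where "0 \<le> A" "A \<le> s\<^sup>2 * (LINT x|\<nu>. min x (x\<^sup>2))" "r s = (LINT x|big_jumps. comp_exp s x) + A"
proof -
  let ?e = "\<lambda>x. comp_exp s x"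
  define A where "A = (LINT x|\<nu>. indicator {..1} x *\<^sub>R ?e x)"
  have i1: "integrable \<nu> (\<lambda>x. indicator {1<..} x *\<^sub>R ?e x)" and i2: "integrable \<nu> (\<lambda>x. indicator {..1} x *\<^sub>R ?e x)"
    by (rule integrable_mult_indicator[OF _ integrable_exp_compensated[OF s]], simp add: nu_borel)+
  have "r s = (LINT x|\<nu>. indicator {1<..} x *\<^sub>R ?e x + indicator {..1} x *\<^sub>R ?e x)"
    unfolding r_def by (intro Bochner_Integration.integral_cong) (auto simp: indicator_def)
  also have "\<dots> = (LINT x|\<nu>. indicator {1<..} x *\<^sub>R ?e x) + A"
    unfolding A_def by (rule Bochner_Integration.integral_add[OF i1 i2])
  also have "(LINT x|\<nu>. indicator {1<..} x *\<^sub>R ?e x) = (LINT x|big_jumps. ?e x)"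
  proof -
    have "big_jumps = density \<nu> (\<lambda>x. ennreal (indicator {1<..} x))"
      unfolding big_jumps_def by (simp add: ennreal_indicator)
    then show ?thesis by (subst integral_density[symmetric]) auto
  qed
  finally have eq: "r s = (LINT x|big_jumps. ?e x) + A" .
  have "0 \<le> A"
    unfolding A_def
  proof (rule integral_nonneg_AE, use nu_pos in eventually_elim)
    case (elim x)
    then show ?case using exp_compensated_bounds(1)[of s x] s by (simp add: indicator_def)
  qed
  moreover have "A \<le> (LINT x|\<nu>. s\<^sup>2 * min x (x\<^sup>2))"
    unfolding A_def
  proof (rule integral_mono_AE[OF i2])
    show "integrable \<nu> (\<lambda>x. s\<^sup>2 * min x (x\<^sup>2))" using integrable_min by simp
    show "AE x in \<nu>. indicator {..1} x *\<^sub>R ?e x \<le> s\<^sup>2 * min x (x\<^sup>2)"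
      using nu_pos
    proof eventually_elim
      case (elim x)
      show ?case
      proof (cases "x \<le> 1")
        case True
        then have "x\<^sup>2 \<le> x" using elim by (auto simp: power2_eq_square mult_left_le)
        then have "min x (x\<^sup>2) = x\<^sup>2" by simp
        then show ?thesis using True elim exp_compensated_le_square[of s x] s by simp
      qed (use elim in simp)
    qed
  qed
  ultimately show thesis using eq by (intro that) auto
qed

text \<open>The contribution of the small jumps is \<open>O(1 / x\<^sup>2)\<close>, which is negligible against \<open>big_tail x\<close> because \<open>\<alpha> < 2\<close>.\<close>

lemma r_asymptotics:
  obtains C where "0 < C" "((\<lambda>x. r (1 / x) / big_tail x) \<longlongrightarrow> C) at_top" "((\<lambda>x. 1 / (x\<^sup>2 * big_tail x)) \<longlongrightarrow> 0) at_top"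
proof -
  obtain C where C: "0 < C"
    "\<forall>\<^sub>F x in at_top. integrable lborel (\<lambda>u. abel_kernel big_tail x u)"
    "((\<lambda>x. abel_integral x / big_tail x) \<longlongrightarrow> C) at_top" "((\<lambda>x. 1 / (x\<^sup>2 * big_tail x)) \<longlongrightarrow> 0) at_top"
    using abelian by metis
  let ?K = "LINT x|\<nu>. min x (x\<^sup>2)"
  have "((\<lambda>x. r (1 / x) / big_tail x - abel_integral x / big_tail x) \<longlongrightarrow> 0) at_top"
  proof (rule Lim_null_comparison)
    show "((\<lambda>x. ?K * (1 / (x\<^sup>2 * big_tail x))) \<longlongrightarrow> 0) at_top"
      by (rule tendsto_mult_right_zero[OF C(4)])
    show "\<forall>\<^sub>F x in at_top. norm (r (1 / x) / big_tail x - abel_integral x / big_tail x) \<le> ?K * (1 / (x\<^sup>2 * big_tail x))"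
      using C(2) eventually_gt_at_top[of 0]
    proof eventually_elim
      case (elim x)
      have "0 \<le> 1 / x" using elim by simp
      then obtain A where A: "0 \<le> A" "A \<le> (1 / x)\<^sup>2 * ?K"
        "r (1 / x) = (LINT y|big_jumps. comp_exp (1 / x) y) + A"
        by (rule r_split)
      have "r (1 / x) = abel_integral x + A" using A(3) big_jumps_integral(2)[OF elim(2,1)] by simp
      then have "norm (r (1 / x) / big_tail x - abel_integral x / big_tail x) = A / big_tail x"
        using A(1) big_tail_pos[of x] by (simp add: add_divide_distrib)
      also have "\<dots> \<le> ((1 / x)\<^sup>2 * ?K) / big_tail x"
        using A big_tail_pos[of x] by (intro divide_right_mono) auto
      also have "\<dots> = ?K * (1 / (x\<^sup>2 * big_tail x))" by (simp add: power_divide)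
      finally show ?case .
    qed
  qed
  from tendsto_add[OF this C(3)] have "((\<lambda>x. r (1 / x) / big_tail x) \<longlongrightarrow> C) at_top" by simp
  with C show thesis by (intro that)
qed

lemma r_nonneg: "0 \<le> s \<Longrightarrow> 0 \<le> r s"
  unfolding r_def
proof (rule integral_nonneg_AE, use nu_pos in eventually_elim)
  fix x :: real assume "0 \<le> s" "0 < x"
  then show "0 \<le> comp_exp s x" using exp_compensated_bounds(1)[of s x] by simp
qed

text \<open>By convexity of the integrand; it follows that \<open>r s / s\<close> is nondecreasing.\<close>

lemma r_scale_le:
  assumes "0 \<le> t" "t \<le> 1" "0 \<le> s" shows "r (t * s) \<le> t * r s"
proof -
  have "r (t * s) \<le> (LINT x|\<nu>. t * comp_exp s x)"
    unfolding r_def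
  proof (rule integral_mono)
    show "integrable \<nu> (\<lambda>x. exp (- (t * s) * x) - 1 + t * s * x)"
      using assms by (intro integrable_exp_compensated) simp
    show "integrable \<nu> (\<lambda>x. t * comp_exp s x)"
      using integrable_exp_compensated[OF assms(3)] by (rule integrable_mult_right)
    show "exp (- (t * s) * x) - 1 + t * s * x \<le> t * comp_exp s x" for x
      using compensated_exp_le[OF assms(1,2), of "s * x"] by (simp add: mult.assoc)
  qed
  then show ?thesis by (simp add: r_def)
qed

lemma r_pos: assumes s: "0 < s" shows "0 < r s"
proof -
  obtain C where C: "0 < C" "((\<lambda>x. r (1 / x) / big_tail x) \<longlongrightarrow> C) at_top"
    "((\<lambda>x. 1 / (x\<^sup>2 * big_tail x)) \<longlongrightarrow> 0) at_top"
    by (rule r_asymptotics)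
  have "\<forall>\<^sub>F x in at_top. 0 < r (1 / x) / big_tail x \<and> 1 / s \<le> x"
    using order_tendstoD(1)[OF C(2,1)] eventually_ge_at_top[of "1 / s"] by eventually_elim simp
  from eventually_happens'[OF _ this] obtain x where x: "0 < r (1 / x) / big_tail x" "1 / s \<le> x"
    by auto
  have xp: "0 < x" using x(2) s by (meson less_le_trans zero_less_divide_1_iff)
  have "0 < r (1 / x)" using x(1) big_tail_pos[of x] by (simp add: zero_less_divide_iff)
  also have "r (1 / x) = r (1 / (x * s) * s)" using s by simp
  also have "\<dots> \<le> 1 / (x * s) * r s"
    using s xp x(2) by (intro r_scale_le) (auto simp: field_simps)
  finally have "0 < 1 / (x * s) * r s" .
  then show ?thesis using r_nonneg[of s] s by (cases "r s = 0") auto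
qed

theorem r_regularly_varying:
  assumes l: "0 < l" shows "((\<lambda>s. r (l * s) / r s) \<longlongrightarrow> l powr \<alpha>) (at_right 0)"
  unfolding filterlim_at_right_to_top
proof -
  obtain C where C: "0 < C" "((\<lambda>x. r (1 / x) / big_tail x) \<longlongrightarrow> C) at_top"
    "((\<lambda>x. 1 / (x\<^sup>2 * big_tail x)) \<longlongrightarrow> 0) at_top"
    by (rule r_asymptotics)
  have "filterlim (\<lambda>x::real. 1 / l * x) at_top at_top"
    using l by (intro filterlim_tendsto_pos_mult_at_top[OF tendsto_const] filterlim_ident) auto
  from filterlim_compose[OF C(2) this]
  have 1: "((\<lambda>x. r (1 / (1 / l * x)) / big_tail (1 / l * x)) \<longlongrightarrow> C) at_top" .
  have 2: "((\<lambda>x. big_tail (1 / l * x) / big_tail x) \<longlongrightarrow> (1 / l) powr (- \<alpha>)) at_top"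
    by (rule big_tail_rv) (use l in simp)
  have "((\<lambda>x. (r (1 / (1 / l * x)) / big_tail (1 / l * x)) * (big_tail (1 / l * x) / big_tail x) / (r (1 / x) / big_tail x)) \<longlongrightarrow> C * (1 / l) powr (- \<alpha>) / C) at_top"
    using C(1) by (intro tendsto_divide tendsto_mult 1 2 C(2)) auto
  moreover have "(r (1 / (1 / l * x)) / big_tail (1 / l * x)) * (big_tail (1 / l * x) / big_tail x) / (r (1 / x) / big_tail x) = r (l * inverse x) / r (inverse x)" for x
    using big_tail_pos[of x] big_tail_pos[of "1 / l * x"] by (simp add: divide_inverse)
  moreover have "C * (1 / l) powr (- \<alpha>) / C = l powr \<alpha>"
    using C(1) l by (simp add: powr_divide powr_minus_divide)
  ultimately show "((\<lambda>x. r (l * inverse x) / r (inverse x)) \<longlongrightarrow> l powr \<alpha>) at_top" by simp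
qed

theorem square_div_r_tendsto_0: "((\<lambda>s. s\<^sup>2 / r s) \<longlongrightarrow> 0) (at_right 0)"
  unfolding filterlim_at_right_to_top
proof -
  obtain C where C: "0 < C" "((\<lambda>x. r (1 / x) / big_tail x) \<longlongrightarrow> C) at_top" "((\<lambda>x. 1 / (x\<^sup>2 * big_tail x)) \<longlongrightarrow> 0) at_top"
    by (rule r_asymptotics)
  have "((\<lambda>x. 1 / (x\<^sup>2 * big_tail x) / (r (1 / x) / big_tail x)) \<longlongrightarrow> 0 / C) at_top"
    using C(1) by (intro tendsto_divide C(2,3)) auto
  moreover have "1 / (x\<^sup>2 * big_tail x) / (r (1 / x) / big_tail x) = (inverse x)\<^sup>2 / r (inverse x)" for x
    using less_imp_neq[OF big_tail_pos, of x] by (simp add: inverse_eq_divide power_divide)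
  ultimately show "((\<lambda>x. (inverse x)\<^sup>2 / r (inverse x)) \<longlongrightarrow> 0) at_top" by simp
qed

end

section \<open>Independent increments\<close>

text \<open>The all-time supremum ranges over uncountably many times and is only almost surely a limit of measurable functions;
in a complete space that makes it measurable.\<close>

lemma (in complete_measure) measurable_AE_eq:
  assumes g: "g \<in> measurable M N" and f: "f \<in> space M \<rightarrow> space N" and ae: "AE x in M. f x = g x"
  shows "f \<in> measurable M N"
proof (rule measurableI)
  show "f x \<in> space N" if "x \<in> space M" for x using f that by auto
  show "f -` A \<inter> space M \<in> sets M" if A: "A \<in> sets N" for A
  proof (rule in_sets_AE)
    show "g -` A \<inter> space M \<in> sets M" using g A by (rule measurable_sets)
    show "AE x in M. x \<in> g -` A \<inter> space M \<longleftrightarrow> x \<in> f -` A \<inter> space M"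
      using ae by eventually_elim auto
  qed auto
qed

lemma levy_processD:
  assumes "levy_process M F X"
  shows "prob_space M" and "standard_filtration M F"
    and "0 \<le> t \<Longrightarrow> X t \<in> borel_measurable (F t)"
    and "\<omega> \<in> space M \<Longrightarrow> X 0 \<omega> = 0"
    and "0 \<le> s \<Longrightarrow> s \<le> t \<Longrightarrow> prob_space.indep_set M (sets (F s))
          (sets (vimage_algebra (space M) (\<lambda>\<omega>. X t \<omega> - X s \<omega>) borel))"
    and "0 \<le> s \<Longrightarrow> s \<le> t \<Longrightarrow> distr M borel (\<lambda>\<omega>. X t \<omega> - X s \<omega>) = distr M borel (X (t - s))"
    and "\<omega> \<in> space M \<Longrightarrow> cadlag (\<lambda>t. X t \<omega>)"
  using assms unfolding levy_process_def by (elim conjE; (assumption | blast))+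

lemma standard_filtrationD:
  assumes "standard_filtration M F"
  shows "filtration (space M) F" and "0 \<le> t \<Longrightarrow> sets (F t) \<subseteq> sets M" and "complete_measure M"
  using assms unfolding standard_filtration_def by (elim conjE; simp)+

lemma levy_process_measurable:
  assumes "levy_process M F X" "0 \<le> t"
  shows "X t \<in> borel_measurable M"
proof -
  have F: "filtration (space M) F" "sets (F t) \<subseteq> sets M" "X t \<in> borel_measurable (F t)"
    using levy_processD[OF assms(1)] standard_filtrationD[OF levy_processD(2)[OF assms(1)]] assms(2) by auto
  have "borel_measurable (F t) \<subseteq> borel_measurable M"
    by (rule measurable_mono) (use F filtration.space_F[OF F(1)] in auto)
  with F(3) show ?thesis by blast
qed

text \<open>Induction on the number of increments: the event that fixes the first \<open>n\<close> increments belongs to the past of time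
\<open>n * h\<close>, which is independent of the next increment.\<close>

lemma levy_process_indep_increments:
  assumes L: "levy_process M F X" and h: "0 \<le> h"
  shows "prob_space.indep_vars M (\<lambda>_. borel) (\<lambda>i \<omega>. X (real (Suc i) * h) \<omega> - X (real i * h) \<omega>) UNIV"
proof -
  interpret prob_space M by (rule levy_processD[OF L])
  have fil: "filtration (space M) F" and FM: "\<And>t. 0 \<le> t \<Longrightarrow> sets (F t) \<subseteq> sets M"
    and XF: "\<And>t. 0 \<le> t \<Longrightarrow> X t \<in> borel_measurable (F t)"
    using levy_processD(3)[OF L] standard_filtrationD[OF levy_processD(2)[OF L]] by auto
  interpret filtration "space M" F by (rule fil)
  have ind: "indep_set (sets (F s)) (sets (vimage_algebra (space M) (\<lambda>\<omega>. X t \<omega> - X s \<omega>) borel))"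
    if "0 \<le> s" "s \<le> t" for s t
    using levy_processD(5)[OF L] that by blast
  define Z where "Z i \<omega> = X (real (Suc i) * h) \<omega> - X (real i * h) \<omega>" for i \<omega>
  have le: "real i * h \<le> real j * h" if "i \<le> j" for i j using that h by (intro mult_right_mono) auto
  have XF': "X (real i * h) \<in> borel_measurable (F (real j * h))" if "i \<le> j" for i j
  proof -
    have "borel_measurable (F (real i * h)) \<subseteq> borel_measurable (F (real j * h))"
      by (rule measurable_mono) (use sets_F_mono[OF le[OF that]] space_F in auto)
    then show ?thesis using XF[of "real i * h"] h by auto
  qed
  have ZF: "Z i \<in> borel_measurable (F (real j * h))" if "Suc i \<le> j" for i j
    unfolding Z_def [abs_def] using XF'[of "Suc i" j] XF'[of i j] that by (intro borel_measurable_diff) auto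
  have Zm [measurable]: "Z i \<in> borel_measurable M" for i
    unfolding Z_def [abs_def] using h by (intro borel_measurable_diff levy_process_measurable[OF L]) auto
  let ?E = "\<lambda>i. {Z i -` A \<inter> space M |A. A \<in> sets borel}"
  have prod: "space M \<inter> (\<Inter>i<n. A i) \<in> sets (F (real n * h)) \<and> prob (space M \<inter> (\<Inter>i<n. A i)) = (\<Prod>i<n. prob (A i))"
    if A: "\<And>i. A i \<in> ?E i" for A n
  proof (induction n)
    case 0
    then show ?case using sets.top[of "F 0"] by (simp add: space_F prob_space)
  next
    case (Suc n)
    obtain B where B: "B \<in> sets borel" "A n = Z n -` B \<inter> space M" using A[of n] by auto
    have eq: "space M \<inter> (\<Inter>i<Suc n. A i) = (space M \<inter> (\<Inter>i<n. A i)) \<inter> A n"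
      by (auto simp: lessThan_Suc)
    have An: "A n \<in> sets (vimage_algebra (space M) (Z n) borel)"
      unfolding B(2) by (rule in_vimage_algebra[OF B(1)])
    have An': "A n \<in> sets (F (real (Suc n) * h))"
      using measurable_sets[OF ZF[of n "Suc n"] B(1)] by (simp add: B(2) space_F del: of_nat_Suc)
    have "space M \<inter> (\<Inter>i<n. A i) \<in> sets (F (real (Suc n) * h))"
      using Suc sets_F_mono[OF le[of n "Suc n"]] by auto
    then have "space M \<inter> (\<Inter>i<Suc n. A i) \<in> sets (F (real (Suc n) * h))"
      unfolding eq using An' by (rule sets.Int)
    moreover have "prob (space M \<inter> (\<Inter>i<Suc n. A i)) = prob (space M \<inter> (\<Inter>i<n. A i)) * prob (A n)"
      unfolding eq
    proof (rule indep_setD)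
      show "indep_set (sets (F (real n * h))) (sets (vimage_algebra (space M) (Z n) borel))"
        unfolding Z_def [abs_def] using h le[of n "Suc n"] by (intro ind) auto
    qed (use Suc An in auto)
    ultimately show ?case using Suc by simp
  qed
  have "indep_sets ?E UNIV"
    unfolding indep_sets_def
  proof (intro conjI ballI allI impI)
    show "?E i \<subseteq> events" for i by auto
    fix J :: "nat set" and A assume J: "J \<noteq> {}" "finite J" and A: "A \<in> Pi J ?E"
    define n where "n = Suc (Max J)"
    have Jn: "J \<subseteq> {..<n}" using J by (auto simp: n_def less_Suc_eq_le)
    \<comment> \<open>Times outside \<open>J\<close> are filled in with the sure event, so that consecutive increments can be used.\<close>
    define A' where "A' i = (if i \<in> J then A i else space M)" for i
    have top: "space M \<in> ?E i" for i by (auto intro!: exI[of _ UNIV])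
    have A': "A' i \<in> ?E i" for i using A top[of i] by (auto simp: A'_def Pi_iff)
    have "\<And>j. j \<in> J \<Longrightarrow> A j \<subseteq> space M" using A by (auto simp: Pi_iff)
    then have "(\<Inter>j\<in>J. A j) = space M \<inter> (\<Inter>i<n. A' i)"
      using J(1) Jn by (auto simp: A'_def split: if_splits)
    also have "prob \<dots> = (\<Prod>i<n. prob (A' i))" using prod[OF A'] by simp
    also have "\<dots> = (\<Prod>j\<in>J. prob (A' j))"
      by (rule prod.mono_neutral_right) (use Jn in \<open>auto simp: A'_def prob_space\<close>)
    also have "\<dots> = (\<Prod>j\<in>J. prob (A j))" by (simp add: A'_def)
    finally show "prob (\<Inter>j\<in>J. A j) = (\<Prod>j\<in>J. prob (A j))" .
  qed
  then have "indep_vars (\<lambda>_. borel) Z UNIV"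
    unfolding indep_vars_def2 by simp
  then show ?thesis by (simp add: Z_def [abs_def])
qed

section \<open>The supremum of a Levy process with negative drift\<close>

locale levy_negative_drift = prob_space M for M :: "'a measure" +
  fixes F :: "real \<Rightarrow> 'a measure" and X :: "real \<Rightarrow> 'a \<Rightarrow> real" and \<psi> :: "real \<Rightarrow> real" and \<mu> a :: real
  assumes levy: "levy_process M F X"
    and integrable_exp_X: "0 \<le> t \<Longrightarrow> 0 \<le> s \<Longrightarrow> integrable M (\<lambda>\<omega>. exp (- s * X t \<omega>))"
    and laplace_X: "0 \<le> t \<Longrightarrow> 0 \<le> s \<Longrightarrow> expectation (\<lambda>\<omega>. exp (- s * X t \<omega>)) = exp (t * \<psi> s)"
    and integrable_X: "0 \<le> t \<Longrightarrow> integrable M (X t)"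
    and mean_X: "0 \<le> t \<Longrightarrow> expectation (X t) = t * \<mu>"
    and psi_slope: "((\<lambda>s. \<psi> s / s) \<longlongrightarrow> - \<mu>) (at_right 0)"
    and drift: "\<mu> < a"
begin

definition "\<phi> s = a * s + \<psi> s"
definition "step h i \<omega> = X (real (Suc i) * h) \<omega> - X (real i * h) \<omega> - a * h"

lemma phi_slope: "((\<lambda>s. \<phi> s / s) \<longlongrightarrow> a - \<mu>) (at_right 0)"
proof -
  have "((\<lambda>s. a + \<psi> s / s) \<longlongrightarrow> a + - \<mu>) (at_right 0)" by (intro tendsto_intros psi_slope)
  moreover have "\<forall>\<^sub>F s in at_right 0. a + \<psi> s / s = \<phi> s / s"
    using eventually_at_right_less[of 0] by eventually_elim (simp add: \<phi>_def field_simps)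
  ultimately show ?thesis by (simp add: tendsto_cong)
qed

lemma measurable_X: "0 \<le> t \<Longrightarrow> X t \<in> borel_measurable M"
  by (rule levy_process_measurable[OF levy])

lemma X_0: "\<omega> \<in> space M \<Longrightarrow> X 0 \<omega> = 0"
  by (rule levy_processD(4)[OF levy])

lemma step_0: "\<omega> \<in> space M \<Longrightarrow> step h 0 \<omega> = X h \<omega> - a * h"
  by (simp add: step_def X_0)

lemma negative_drift_walk_step:
  assumes h: "0 < h"
  shows "negative_drift_walk M (step h) (h * (a - \<mu>)) (\<lambda>s. h * \<phi> s)"
proof unfold_locales
  have "indep_vars (\<lambda>_. borel) (\<lambda>i \<omega>. (\<lambda>x. x - a * h) (X (real (Suc i) * h) \<omega> - X (real i * h) \<omega>)) UNIV"
    using levy_process_indep_increments[OF levy, of h] h by (intro indep_vars_compose2[where Y="\<lambda>_ x. x - a * h"]) auto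
  then show "indep_vars (\<lambda>_. borel) (step h) UNIV" by (simp add: step_def [abs_def])
  show "distr M borel (step h i) = distr M borel (step h 0)" for i
  proof -
    have *: "distr M borel (step h i) = distr (distr M borel (X h)) borel (\<lambda>x. x - a * h)" for i
    proof -
      have m: "(\<lambda>\<omega>. X (real (Suc i) * h) \<omega> - X (real i * h) \<omega>) \<in> borel_measurable M"
        using h by (intro borel_measurable_diff measurable_X) auto
      have "distr M borel (\<lambda>\<omega>. X (real (Suc i) * h) \<omega> - X (real i * h) \<omega>) = distr M borel (X (real (Suc i) * h - real i * h))"
        using h by (intro levy_processD(6)[OF levy] mult_right_mono) auto
      also have "real (Suc i) * h - real i * h = h" by (simp add: algebra_simps)
      finally have "distr (distr M borel (X h)) borel (\<lambda>x. x - a * h)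
          = distr (distr M borel (\<lambda>\<omega>. X (real (Suc i) * h) \<omega> - X (real i * h) \<omega>)) borel (\<lambda>x. x - a * h)" by simp
      also have "\<dots> = distr M borel (step h i)"
        by (subst distr_distr[OF _ m]) (auto simp: comp_def step_def [abs_def])
      finally show ?thesis by simp
    qed
    show ?thesis using *[of i] *[of 0] by simp
  qed
  have int: "integrable M (\<lambda>\<omega>. X h \<omega> - a * h)" using integrable_X[of h] h by simp
  show "integrable M (step h 0)"
    using int by (subst Bochner_Integration.integrable_cong[OF refl step_0])
  have "expectation (step h 0) = expectation (\<lambda>\<omega>. X h \<omega> - a * h)"
    by (rule Bochner_Integration.integral_cong[OF refl step_0])
  also have "\<dots> = - (h * (a - \<mu>))"
    using integrable_X[of h] mean_X[of h] h prob_space by (simp add: algebra_simps)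
  finally show "expectation (step h 0) = - (h * (a - \<mu>))" .
  show "0 < h * (a - \<mu>)" using h drift by simp
  fix s :: real assume s: "0 \<le> s"
  have eq: "exp (- s * step h 0 \<omega>) = exp (s * (a * h)) * exp (- s * X h \<omega>)" if "\<omega> \<in> space M" for \<omega>
    unfolding step_0[OF that] by (simp add: algebra_simps flip: exp_add)
  show "integrable M (\<lambda>\<omega>. exp (- s * step h 0 \<omega>))"
    using integrable_exp_X[of h s] h s by (subst Bochner_Integration.integrable_cong[OF refl eq]) auto
  have "expectation (\<lambda>\<omega>. exp (- s * step h 0 \<omega>)) = expectation (\<lambda>\<omega>. exp (s * (a * h)) * exp (- s * X h \<omega>))"
    by (rule Bochner_Integration.integral_cong[OF refl eq])
  also have "\<dots> = exp (s * (a * h)) * exp (h * \<psi> s)"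
    using laplace_X[of h s] h s by simp
  also have "\<dots> = exp (h * \<phi> s)"
    by (simp add: \<phi>_def algebra_simps flip: exp_add)
  finally show "expectation (\<lambda>\<omega>. exp (- s * step h 0 \<omega>)) = exp (h * \<phi> s)" .
next
  have "((\<lambda>s. h * (\<phi> s / s)) \<longlongrightarrow> h * (a - \<mu>)) (at_right 0)"
    by (intro tendsto_intros phi_slope)
  then show "((\<lambda>s. (exp (h * \<phi> s) - 1) / s) \<longlongrightarrow> h * (a - \<mu>)) (at_right 0)"
    by (intro exp_slope_at_right_0) simp
qed

lemma step_sum: "\<omega> \<in> space M \<Longrightarrow> (\<Sum>i<k. step h i \<omega>) = X (real k * h) \<omega> - a * (real k * h)"
  by (induction k) (simp_all add: X_0 step_def algebra_simps)

text \<open>The maximum over the dyadic times of level \<open>N\<close> up to time \<open>N\<close>. Refining the mesh and extending the horizon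
together gives one increasing sequence of random variables.\<close>

definition "grid_max N \<omega> = walk_max (N * 2 ^ N) (\<lambda>i. step (1 / 2 ^ N) i \<omega>)"

lemma grid_max_nonneg: "0 \<le> grid_max N \<omega>"
  by (simp add: grid_max_def walk_max_nonneg)

lemma grid_max_attained:
  assumes "\<omega> \<in> space M" shows "\<exists>t\<ge>0. grid_max N \<omega> = X t \<omega> - a * t"
proof -
  obtain k where "grid_max N \<omega> = (\<Sum>i<k. step (1 / 2 ^ N) i \<omega>)"
    using walk_max_attained[of "N * 2 ^ N" "\<lambda>i. step (1 / 2 ^ N) i \<omega>"] by (auto simp: grid_max_def)
  then show ?thesis using step_sum[OF assms]
    by (intro exI[of _ "real k * (1 / 2 ^ N)"]) simp
qed

lemma le_grid_max:
  assumes \<omega>: "\<omega> \<in> space M" and k: "k \<le> N * 2 ^ N"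
  shows "X (real k / 2 ^ N) \<omega> - a * (real k / 2 ^ N) \<le> grid_max N \<omega>"
  using partial_sum_le_walk_max[OF k, of "\<lambda>i. step (1 / 2 ^ N) i \<omega>"] step_sum[OF \<omega>, of "1 / 2 ^ N" k]
  by (simp add: grid_max_def)

lemma coarse_walk_le:
  assumes \<omega>: "\<omega> \<in> space M" and N: "N0 \<le> N" and n: "n \<le> N * 2 ^ N0"
  shows "walk_max n (\<lambda>i. step (1 / 2 ^ N0) i \<omega>) \<le> grid_max N \<omega>"
proof -
  obtain k where k: "k \<le> n" "walk_max n (\<lambda>i. step (1 / 2 ^ N0) i \<omega>) = (\<Sum>i<k. step (1 / 2 ^ N0) i \<omega>)"
    using walk_max_attained[of n "\<lambda>i. step (1 / 2 ^ N0) i \<omega>"] by blast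
  \<comment> \<open>The index of the same time on the finer grid.\<close>
  define k' where "k' = k * 2 ^ (N - N0)"
  have pow: "(2::'b::semiring_1) ^ N = 2 ^ N0 * 2 ^ (N - N0)" using N by (simp flip: power_add)
  have "k' \<le> (N * 2 ^ N0) * 2 ^ (N - N0)" unfolding k'_def using k(1) n by (intro mult_right_mono) auto
  also have "\<dots> = N * 2 ^ N" by (simp add: pow)
  finally have k': "k' \<le> N * 2 ^ N" .
  have "real k' / 2 ^ N = real k / 2 ^ N0" by (simp add: k'_def pow)
  then show ?thesis using le_grid_max[OF \<omega> k'] k(2) step_sum[OF \<omega>, of "1 / 2 ^ N0" k] by simp
qed

lemma grid_max_Suc: "\<omega> \<in> space M \<Longrightarrow> grid_max N \<omega> \<le> grid_max (Suc N) \<omega>"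
  unfolding grid_max_def[of N] by (rule coarse_walk_le) auto

lemma grid_max_mono: "\<omega> \<in> space M \<Longrightarrow> incseq (\<lambda>N. grid_max N \<omega>)"
  by (rule incseq_SucI) (rule grid_max_Suc)

lemma walk_grid: "negative_drift_walk M (step (1 / 2 ^ N)) (1 / 2 ^ N * (a - \<mu>)) (\<lambda>s. 1 / 2 ^ N * \<phi> s)"
  by (rule negative_drift_walk_step) simp

lemma grid_max_eq_run_max: "grid_max N = negative_drift_walk.run_max (step (1 / 2 ^ N)) (N * 2 ^ N)"
  by (rule ext) (simp add: grid_max_def negative_drift_walk.run_max_def[OF walk_grid])

lemma measurable_grid_max [measurable]: "grid_max N \<in> borel_measurable M"
  unfolding grid_max_eq_run_max by (rule negative_drift_walk.measurable_run_max[OF walk_grid])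

lemma integrable_exp_grid_max: "0 \<le> s \<Longrightarrow> integrable M (\<lambda>\<omega>. exp (- s * grid_max N \<omega>))"
  unfolding grid_max_eq_run_max by (rule negative_drift_walk.integrable_exp_run_max(1)[OF walk_grid])

text \<open>The supremum over all grid times of level \<open>N\<close> dominates \<open>grid_max N\<close>, and is itself dominated by the limit of \<open>grid_max\<close>.
So its transform separates the two, and both bounds for random walks carry over.\<close>

definition "grid_laplace s N = expectation (\<lambda>\<omega>. exp (- s * grid_max N \<omega>))"
definition "mesh_sup_laplace s N = negative_drift_walk.sup_laplace M (step (1 / 2 ^ N)) s"

lemma mesh_sup_le_grid: "0 \<le> s \<Longrightarrow> mesh_sup_laplace s N \<le> grid_laplace s N"
  unfolding mesh_sup_laplace_def grid_laplace_def grid_max_eq_run_max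
  using negative_drift_walk.sup_laplace_le[OF walk_grid, of s N "N * 2 ^ N"]
  by (simp add: negative_drift_walk.max_laplace_def[OF walk_grid])

text \<open>For \<open>s > 0\<close> this is \<open>exp (- s * sup)\<close> when the supremum over the dyadic times is finite, and \<open>0\<close> when it is infinite.\<close>

definition "limit_exp s \<omega> = lim (\<lambda>N. exp (- s * grid_max N \<omega>))"

lemma tendsto_limit_exp:
  assumes "0 \<le> s" "\<omega> \<in> space M"
  shows "(\<lambda>N. exp (- s * grid_max N \<omega>)) \<longlonglongrightarrow> limit_exp s \<omega>"
proof -
  have "decseq (\<lambda>N. exp (- s * grid_max N \<omega>))"
    using assms grid_max_Suc by (auto simp: decseq_Suc_iff mult_left_mono)
  then have "convergent (\<lambda>N. exp (- s * grid_max N \<omega>))"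
    by (metis decseq_convergent convergentI exp_ge_zero)
  then show ?thesis by (simp add: limit_exp_def convergent_LIMSEQ_iff)
qed

lemma measurable_limit_exp [measurable]: "limit_exp s \<in> borel_measurable M"
  unfolding limit_exp_def [abs_def] by measurable

lemma grid_laplace_lim: assumes s: "0 \<le> s" shows "grid_laplace s \<longlonglongrightarrow> expectation (limit_exp s)"
  unfolding grid_laplace_def
proof (rule integral_dominated_convergence)
  show "integrable M (\<lambda>_. 1)" by simp
  show "AE \<omega> in M. (\<lambda>N. exp (- s * grid_max N \<omega>)) \<longlonglongrightarrow> limit_exp s \<omega>" using tendsto_limit_exp[OF s] by simp
  show "AE \<omega> in M. norm (exp (- s * grid_max N \<omega>)) \<le> 1" for N
    using s grid_max_nonneg[of N] by simp
qed simp_all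

lemma limit_exp_le_mesh_sup: assumes s: "0 \<le> s" shows "expectation (limit_exp s) \<le> mesh_sup_laplace s N"
proof -
  interpret W: negative_drift_walk M "step (1 / 2 ^ N)" "1 / 2 ^ N * (a - \<mu>)" "\<lambda>s. 1 / 2 ^ N * \<phi> s"
    by (rule walk_grid)
  show ?thesis unfolding mesh_sup_laplace_def
  proof (rule LIMSEQ_le_const[OF W.tendsto_max_laplace[OF s]], intro exI allI impI)
    fix n
    show "expectation (limit_exp s) \<le> W.max_laplace s n"
    proof (rule LIMSEQ_le_const2[OF grid_laplace_lim[OF s]], intro exI[of _ "max N n"] allI impI)
      fix N' assume N': "max N n \<le> N'"
      have "n * 1 \<le> N' * 2 ^ N" using N' by (intro mult_mono) auto
      then have "W.run_max n \<omega> \<le> grid_max N' \<omega>" if "\<omega> \<in> space M" for \<omega>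
        unfolding W.run_max_def using N' that by (intro coarse_walk_le) auto
      then show "grid_laplace s N' \<le> W.max_laplace s n"
        unfolding grid_laplace_def W.max_laplace_def using s
        by (intro integral_mono integrable_exp_grid_max W.integrable_exp_run_max) (auto intro: mult_left_mono)
    qed
  qed
qed

lemma phi_grid_lim: "(\<lambda>N. (exp (1 / 2 ^ N * \<phi> s) - 1) / (1 / 2 ^ N)) \<longlonglongrightarrow> \<phi> s"
proof -
  have slope: "((\<lambda>h. h * \<phi> s / h) \<longlongrightarrow> \<phi> s) (at_right 0)"
  proof (rule tendsto_eventually)
    show "\<forall>\<^sub>F h in at_right 0. h * \<phi> s / h = \<phi> s"
      using eventually_at_right_less[of 0] by eventually_elim simp
  qed
  have "filterlim (\<lambda>N. 1 / 2 ^ N :: real) (at_right 0) sequentially"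
  proof -
    have "(\<lambda>N. (1 / 2) ^ N :: real) \<longlonglongrightarrow> 0" by (rule LIMSEQ_power_zero) simp
    then show ?thesis by (simp add: filterlim_at power_one_over)
  qed
  from filterlim_compose[OF exp_slope_at_right_0[OF slope] this] show ?thesis .
qed

lemma limit_exp_lower:
  assumes s: "0 \<le> s" shows "(a - \<mu>) * s \<le> \<phi> s * expectation (limit_exp s)"
proof (rule LIMSEQ_le_const[OF tendsto_mult[OF phi_grid_lim grid_laplace_lim[OF s]]], intro exI allI impI)
  fix N
  interpret W: negative_drift_walk M "step (1 / 2 ^ N)" "1 / 2 ^ N * (a - \<mu>)" "\<lambda>s. 1 / 2 ^ N * \<phi> s"
    by (rule walk_grid)
  have low: "1 / 2 ^ N * (a - \<mu>) * s \<le> (exp (1 / 2 ^ N * \<phi> s) - 1) * mesh_sup_laplace s N"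
    using W.laplace_max_lower[OF s] by (simp add: mesh_sup_laplace_def)
  have "0 \<le> 1 / 2 ^ N * (a - \<mu>) * s" using s drift by simp
  then have "0 \<le> (exp (1 / 2 ^ N * \<phi> s) - 1) * mesh_sup_laplace s N" using low by linarith
  moreover have "0 \<le> mesh_sup_laplace s N" unfolding mesh_sup_laplace_def by (rule W.sup_laplace_bounds(1)[OF s])
  moreover have "s = 0" if "mesh_sup_laplace s N = 0"
  proof (rule ccontr)
    assume "s \<noteq> 0"
    then have "0 < 1 / 2 ^ N * (a - \<mu>) * s" using s drift by simp
    then show False using low that by simp
  qed
  moreover have "\<phi> 0 = 0"
    using laplace_X[of 1 0] prob_space by (simp add: \<phi>_def)
  ultimately have "0 \<le> exp (1 / 2 ^ N * \<phi> s) - 1"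
    by (cases "mesh_sup_laplace s N = 0") (auto simp: zero_le_mult_iff)
  then have "(exp (1 / 2 ^ N * \<phi> s) - 1) * mesh_sup_laplace s N \<le> (exp (1 / 2 ^ N * \<phi> s) - 1) * grid_laplace s N"
    using mesh_sup_le_grid[OF s, of N] by (rule mult_left_mono[rotated])
  with low have "1 / 2 ^ N * ((a - \<mu>) * s) \<le> (exp (1 / 2 ^ N * \<phi> s) - 1) * grid_laplace s N"
    by (simp add: mult.assoc)
  then show "(a - \<mu>) * s \<le> (exp (1 / 2 ^ N * \<phi> s) - 1) / (1 / 2 ^ N) * grid_laplace s N"
    by (simp add: field_simps)
qed

lemma phi_nonneg: assumes s: "0 \<le> s" shows "0 \<le> \<phi> s"
proof -
  have Q0: "0 \<le> limit_exp s \<omega>" if "\<omega> \<in> space M" for \<omega>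
    by (rule LIMSEQ_le_const[OF tendsto_limit_exp[OF s that]]) auto
  have "0 \<le> expectation (limit_exp s)" by (rule integral_nonneg_AE) (auto simp: Q0)
  moreover have "0 \<le> \<phi> s * expectation (limit_exp s)"
    using limit_exp_lower[OF s] drift s by (meson diff_ge_0_iff_ge less_imp_le mult_nonneg_nonneg order_trans)
  moreover have "expectation (limit_exp s) = 0 \<Longrightarrow> s = 0"
    using limit_exp_lower[OF s] drift s by (auto simp: mult_le_0_iff)
  moreover have "\<phi> 0 = 0"
    using laplace_X[of 1 0] prob_space by (simp add: \<phi>_def)
  ultimately show ?thesis by (cases "expectation (limit_exp s) = 0") (auto simp: zero_le_mult_iff)
qed

lemma limit_exp_upper:
  assumes s: "0 < s" "s \<le> 1"
  shows "\<phi> s * expectation (limit_exp s) \<le> (a - \<mu>) * s + s\<^sup>2 * (\<phi> 1 - (a - \<mu>))"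
proof (rule LIMSEQ_le)
  show "(\<lambda>N. (exp (1 / 2 ^ N * \<phi> s) - 1) / (1 / 2 ^ N) * expectation (limit_exp s)) \<longlonglongrightarrow> \<phi> s * expectation (limit_exp s)"
    by (intro tendsto_intros phi_grid_lim)
  show "(\<lambda>N. (a - \<mu>) * s + s\<^sup>2 * ((exp (1 / 2 ^ N * \<phi> 1) - 1) / (1 / 2 ^ N) - (a - \<mu>)))
      \<longlonglongrightarrow> (a - \<mu>) * s + s\<^sup>2 * (\<phi> 1 - (a - \<mu>))"
    by (intro tendsto_add tendsto_mult tendsto_diff tendsto_const phi_grid_lim)
  show "\<exists>N0. \<forall>N\<ge>N0. (exp (1 / 2 ^ N * \<phi> s) - 1) / (1 / 2 ^ N) * expectation (limit_exp s)
      \<le> (a - \<mu>) * s + s\<^sup>2 * ((exp (1 / 2 ^ N * \<phi> 1) - 1) / (1 / 2 ^ N) - (a - \<mu>))"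
  proof (intro exI allI impI)
    fix N
    interpret W: negative_drift_walk M "step (1 / 2 ^ N)" "1 / 2 ^ N * (a - \<mu>)" "\<lambda>s. 1 / 2 ^ N * \<phi> s"
      by (rule walk_grid)
    have "0 \<le> exp (1 / 2 ^ N * \<phi> s) - 1" using phi_nonneg[of s] s by simp
    then have "(exp (1 / 2 ^ N * \<phi> s) - 1) * expectation (limit_exp s) \<le> (exp (1 / 2 ^ N * \<phi> s) - 1) * mesh_sup_laplace s N"
      using limit_exp_le_mesh_sup[of s N] s by (intro mult_left_mono) auto
    also have "\<dots> \<le> 1 / 2 ^ N * (a - \<mu>) * s + s\<^sup>2 * (exp (1 / 2 ^ N * \<phi> 1) - 1 - 1 / 2 ^ N * (a - \<mu>))"
      using W.laplace_max_upper[OF s] by (simp add: mesh_sup_laplace_def)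
    finally have *: "(exp (1 / 2 ^ N * \<phi> s) - 1) * expectation (limit_exp s)
        \<le> 1 / 2 ^ N * (a - \<mu>) * s + s\<^sup>2 * (exp (1 / 2 ^ N * \<phi> 1) - 1 - 1 / 2 ^ N * (a - \<mu>))" .
    have rescale: "A / p * q \<le> c * s + s\<^sup>2 * (B / p - c)" if "0 < p" "A * q \<le> p * c * s + s\<^sup>2 * (B - p * c)" for A B c p q :: real
    proof -
      have "A / p * q \<le> (p * c * s + s\<^sup>2 * (B - p * c)) / p"
        using divide_right_mono[OF that(2), of p] that(1) by simp
      also have "\<dots> = c * s + s\<^sup>2 * (B / p - c)" using that(1) by (simp add: field_simps)
      finally show ?thesis .
    qed
    show "(exp (1 / 2 ^ N * \<phi> s) - 1) / (1 / 2 ^ N) * expectation (limit_exp s)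
        \<le> (a - \<mu>) * s + s\<^sup>2 * ((exp (1 / 2 ^ N * \<phi> 1) - 1) / (1 / 2 ^ N) - (a - \<mu>))"
      by (rule rescale[OF _ *]) simp
  qed
qed

text \<open>On unbounded paths \<open>limit_exp s\<close> vanishes, so its expectation is at most the probability of the bounded
ones; by the lower bound this expectation tends to \<open>1\<close> as \<open>s\<close> tends to \<open>0\<close>.\<close>

lemma AE_bounded: "AE \<omega> in M. bdd_above (range (\<lambda>N. grid_max N \<omega>))"
proof -
  define B where "B = {\<omega>\<in>space M. bdd_above (range (\<lambda>N. grid_max N \<omega>))}"
  have B_eq: "B = {\<omega>\<in>space M. \<exists>m::nat. \<forall>N. grid_max N \<omega> \<le> real m}"
  proof -
    have "bdd_above (range (\<lambda>N. grid_max N \<omega>)) \<longleftrightarrow> (\<exists>m::nat. \<forall>N. grid_max N \<omega> \<le> real m)" for \<omega>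
      by (auto simp: bdd_above_def) (meson order_trans real_arch_simple)
    then show ?thesis by (simp add: B_def)
  qed
  have [measurable]: "B \<in> sets M" unfolding B_eq by measurable
  have le: "expectation (limit_exp s) \<le> prob B" if s: "0 < s" for s
  proof -
    have "limit_exp s \<omega> \<le> indicator B \<omega>" if \<omega>: "\<omega> \<in> space M" for \<omega>
    proof (cases "\<omega> \<in> B")
      case True
      have "limit_exp s \<omega> \<le> 1"
        by (rule LIMSEQ_le_const2[OF tendsto_limit_exp]) (use s \<omega> grid_max_nonneg in auto)
      then show ?thesis using True by simp
    next
      case False
      have "filterlim (\<lambda>N. grid_max N \<omega>) at_top sequentially"
        unfolding filterlim_at_top
      proof
        fix Z :: real
        have "\<exists>N0. Z \<le> grid_max N0 \<omega>"
          using False \<omega> by (auto simp: B_def bdd_above_def) (meson linear)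
        then obtain N0 where "Z \<le> grid_max N0 \<omega>" by blast
        then show "\<forall>\<^sub>F N in sequentially. Z \<le> grid_max N \<omega>"
          using incseqD[OF grid_max_mono[OF \<omega>]] by (auto simp: eventually_sequentially intro: order_trans)
      qed
      then have "filterlim (\<lambda>N. - s * grid_max N \<omega>) at_bot sequentially"
        using s by (intro filterlim_tendsto_neg_mult_at_bot[OF tendsto_const]) auto
      from filterlim_compose[OF exp_at_bot this] have "limit_exp s \<omega> = 0"
        using tendsto_limit_exp[of s \<omega>] s \<omega> LIMSEQ_unique by (auto simp: less_imp_le)
      then show ?thesis by simp
    qed
    moreover have "0 \<le> limit_exp s \<omega>" if "\<omega> \<in> space M" for \<omega>
      by (rule LIMSEQ_le_const[OF tendsto_limit_exp]) (use s that in auto)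
    moreover have "norm (limit_exp s \<omega>) \<le> 1" if "\<omega> \<in> space M" for \<omega>
    proof -
      have "indicator B \<omega> \<le> (1::real)" by (simp add: indicator_def)
      with calculation[OF that] show ?thesis unfolding real_norm_def by linarith
    qed
    ultimately have "expectation (limit_exp s) \<le> expectation (indicator B)"
      by (intro integral_mono integrable_const_bound[where B=1]) auto
    then show ?thesis by simp
  qed
  have "a - \<mu> \<le> (a - \<mu>) * prob B"
  proof (rule tendsto_le[OF _ tendsto_mult[OF phi_slope tendsto_const] tendsto_const])
    show "\<forall>\<^sub>F s in at_right 0. a - \<mu> \<le> \<phi> s / s * prob B"
      using eventually_at_right_less[of 0]
    proof eventually_elim
      case (elim s)
      have "(a - \<mu>) * s \<le> \<phi> s * expectation (limit_exp s)" using limit_exp_lower[of s] elim by simp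
      also have "\<dots> \<le> \<phi> s * prob B" using phi_nonneg[of s] le[OF elim] elim by (intro mult_left_mono) auto
      finally show ?case using elim by (simp add: field_simps)
    qed
  qed simp
  then have "1 \<le> prob B" using drift by simp
  then have "prob B = 1" using prob_le_1[of B] by simp
  then have "AE \<omega> in M. \<omega> \<in> B" by (simp add: prob_eq_1)
  then show ?thesis by eventually_elim (simp add: B_def)
qed

text \<open>Dyadic times approach \<open>t\<close> strictly from the right, where the path is continuous.\<close>

lemma path_le_bound:
  assumes \<omega>: "\<omega> \<in> space M" and Z: "\<And>N. grid_max N \<omega> \<le> Z" and t: "0 \<le> t"
  shows "X t \<omega> - a * t \<le> Z"
proof -
  \<comment> \<open>The first dyadic time of level \<open>N\<close> strictly after \<open>t\<close>.\<close>
  define tt where "tt N = (real (nat \<lfloor>t * 2 ^ N\<rfloor>) + 1) / 2 ^ N" for N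
  have tt: "t < tt N" "tt N \<le> t + (1 / 2) ^ N" for N
  proof -
    have fl: "real (nat \<lfloor>t * 2 ^ N\<rfloor>) = of_int \<lfloor>t * 2 ^ N\<rfloor>" using t by simp
    have "t * 2 ^ N < real (nat \<lfloor>t * 2 ^ N\<rfloor>) + 1" unfolding fl by linarith
    then show "t < tt N" by (simp add: tt_def field_simps)
    have "real (nat \<lfloor>t * 2 ^ N\<rfloor>) + 1 \<le> t * 2 ^ N + 1" unfolding fl by linarith
    then show "tt N \<le> t + (1 / 2) ^ N" by (simp add: tt_def field_simps power_one_over)
  qed
  have tt_lim: "tt \<longlonglongrightarrow> t"
  proof (rule tendsto_sandwich[OF _ _ tendsto_const])
    have "(\<lambda>N. t + (1 / 2) ^ N) \<longlonglongrightarrow> t + 0" by (intro tendsto_intros LIMSEQ_power_zero) simp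
    then show "(\<lambda>N. t + (1 / 2) ^ N) \<longlonglongrightarrow> t" by simp
  qed (use tt in \<open>auto intro!: always_eventually less_imp_le\<close>)
  have right: "filterlim tt (at_right t) sequentially"
    using tt_lim tt(1) by (auto simp: filterlim_at intro!: always_eventually simp: less_imp_neq[symmetric])
  have "((\<lambda>t. X t \<omega>) \<longlongrightarrow> X t \<omega>) (at_right t)"
    using levy_processD(7)[OF levy \<omega>] t by (auto simp: cadlag_def continuous_within)
  from filterlim_compose[OF this right] tt_lim
  have "(\<lambda>N. X (tt N) \<omega> - a * tt N) \<longlonglongrightarrow> X t \<omega> - a * t"
    by (intro tendsto_intros)
  then show ?thesis
  proof (rule LIMSEQ_le_const2, intro exI allI impI)
    fix N
    define k where "k = nat \<lfloor>t * 2 ^ N\<rfloor> + 1"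
    have kt: "tt N = real k / 2 ^ N" by (simp add: tt_def k_def add.commute)
    have "k * 1 \<le> max N k * 2 ^ N" by (intro mult_mono) auto
    then have "walk_max k (\<lambda>i. step (1 / 2 ^ N) i \<omega>) \<le> grid_max (max N k) \<omega>"
      by (intro coarse_walk_le[OF \<omega>]) auto
    moreover have "X (tt N) \<omega> - a * tt N \<le> walk_max k (\<lambda>i. step (1 / 2 ^ N) i \<omega>)"
      using partial_sum_le_walk_max[of k k "\<lambda>i. step (1 / 2 ^ N) i \<omega>"] step_sum[OF \<omega>, of "1 / 2 ^ N" k]
      by (simp add: kt)
    ultimately show "X (tt N) \<omega> - a * tt N \<le> Z" using Z[of "max N k"] by linarith
  qed
qed

lemma grid_max_tendsto_sup:
  assumes \<omega>: "\<omega> \<in> space M" and bdd: "bdd_above (range (\<lambda>N. grid_max N \<omega>))"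
  shows "(\<lambda>N. grid_max N \<omega>) \<longlonglongrightarrow> all_time_sup X a \<omega>"
proof -
  define Z where "Z = (SUP N. grid_max N \<omega>)"
  have lim: "(\<lambda>N. grid_max N \<omega>) \<longlonglongrightarrow> Z"
    unfolding Z_def using bdd grid_max_mono[OF \<omega>] by (rule LIMSEQ_incseq_SUP)
  have VZ: "grid_max N \<omega> \<le> Z" for N unfolding Z_def using bdd by (intro cSUP_upper) auto
  have le: "X t \<omega> - a * t \<le> Z" if "0 \<le> t" for t by (rule path_le_bound[OF \<omega> VZ that])
  have "all_time_sup X a \<omega> = Z"
    unfolding all_time_sup_def
  proof (rule antisym)
    show "(SUP t\<in>{0..}. X t \<omega> - a * t) \<le> Z" by (rule cSUP_least) (auto intro: le)
    have "bdd_above ((\<lambda>t. X t \<omega> - a * t) ` {0..})" using le by (auto intro!: bdd_aboveI2)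
    then have "grid_max N \<omega> \<le> (SUP t\<in>{0..}. X t \<omega> - a * t)" for N
      using grid_max_attained[OF \<omega>, of N] by (auto intro: cSUP_upper)
    then show "Z \<le> (SUP t\<in>{0..}. X t \<omega> - a * t)"
      unfolding Z_def by (intro cSUP_least) auto
  qed
  with lim show ?thesis by simp
qed

lemma AE_grid_max_tendsto_sup: "AE \<omega> in M. (\<lambda>N. grid_max N \<omega>) \<longlonglongrightarrow> all_time_sup X a \<omega>"
  using AE_bounded by (rule AE_mp) (simp add: grid_max_tendsto_sup)

lemma measurable_all_time_sup: "all_time_sup X a \<in> borel_measurable M"
proof (rule complete_measure.measurable_AE_eq)
  show "complete_measure M"
    by (rule standard_filtrationD(3)[OF levy_processD(2)[OF levy]])
  show "(\<lambda>\<omega>. lim (\<lambda>N. grid_max N \<omega>)) \<in> borel_measurable M" by measurable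
  show "AE \<omega> in M. all_time_sup X a \<omega> = lim (\<lambda>N. grid_max N \<omega>)"
    using AE_grid_max_tendsto_sup by eventually_elim (simp add: limI)
qed simp

lemma all_time_sup_nonneg: "AE \<omega> in M. 0 \<le> all_time_sup X a \<omega>"
  using AE_grid_max_tendsto_sup by eventually_elim (auto intro: LIMSEQ_le_const grid_max_nonneg)

lemma expectation_limit_exp: assumes "0 \<le> s" shows "expectation (\<lambda>\<omega>. exp (- s * all_time_sup X a \<omega>)) = expectation (limit_exp s)"
proof (rule integral_cong_AE)
  show "(\<lambda>\<omega>. exp (- s * all_time_sup X a \<omega>)) \<in> borel_measurable M"
    using measurable_all_time_sup by measurable
  show "AE \<omega> in M. exp (- s * all_time_sup X a \<omega>) = limit_exp s \<omega>"
    using AE_grid_max_tendsto_sup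
  proof (eventually_elim)
    case (elim \<omega>)
    then have "(\<lambda>N. exp (- s * grid_max N \<omega>)) \<longlonglongrightarrow> exp (- s * all_time_sup X a \<omega>)"
      by (intro tendsto_intros)
    then show ?case by (simp add: limit_exp_def limI)
  qed
qed simp

text \<open>The generalised Pollaczek--Khinchine formula would make the first inequality an equality; the second bounds the
defect by a term of second order in \<open>s\<close>.\<close>

theorem pollaczek_khinchine_bounds:
  assumes s: "0 < s" "s \<le> 1"
  shows "(a - \<mu>) * s \<le> \<phi> s * expectation (\<lambda>\<omega>. exp (- s * all_time_sup X a \<omega>))"
    and "\<phi> s * expectation (\<lambda>\<omega>. exp (- s * all_time_sup X a \<omega>)) \<le> (a - \<mu>) * s + s\<^sup>2 * (\<phi> 1 - (a - \<mu>))"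
  using limit_exp_lower[of s] limit_exp_upper[OF s] expectation_limit_exp[of s] s by simp_all

end

section \<open>The heavy-traffic limit\<close>

text \<open>The coefficient \<open>b\<close> of the exponent is the mean of \<open>X 1\<close>, since that is the negative slope of the Laplace exponent at \<open>0\<close>.\<close>

lemma (in one_sided_levy_measure) levy_negative_driftI:
  assumes levy: "levy_process M F X" and triplet: "has_levy_triplet M X \<gamma> \<sigma> \<nu>"
    and \<mu>_eq: "\<mu> = prob_space.expectation M (X 1)" and a: "\<mu> < a"
  shows "levy_negative_drift M F X (laplace_exponent \<mu> \<sigma>) \<mu> a"
proof -
  interpret prob_space M by (rule levy_processD[OF levy])
  define b where "b = \<gamma> + (LINT x|\<nu>. x * indicator {1..} x)"
  let ?P = "\<lambda>t. distr M borel (X t)"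
  have X_meas: "X t \<in> borel_measurable M" if "0 \<le> t" for t by (rule levy_process_measurable[OF levy that])
  have tr: "has_transforms (?P t) (\<lambda>\<theta>. of_real t * levy_symbol b \<sigma> \<theta>) (\<lambda>s. t * laplace_exponent b \<sigma> s)" if t: "0 \<le> t" for t
  proof (rule has_transforms_levy[OF t])
    show "real_distribution (?P t)" by (rule real_distribution_distr[OF X_meas[OF t]])
    show "char (?P t) \<theta> = exp (of_real t * levy_symbol b \<sigma> \<theta>)" for \<theta>
      using triplet t by (simp add: has_levy_triplet_def levy_exponent_eq_symbol b_def)
  qed
  have tr_slope: "((\<lambda>s. t * laplace_exponent b \<sigma> s / s) \<longlongrightarrow> - (t * b)) (at_right 0)" for t
  proof -
    have "((\<lambda>s. t * (laplace_exponent b \<sigma> s / s)) \<longlongrightarrow> t * - b) (at_right 0)"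
      by (intro tendsto_intros laplace_exponent_slope)
    then show ?thesis by simp
  qed
  have mean: "integrable M (X t)" "expectation (X t) = t * b" if t: "0 \<le> t" for t
    using mean_eq_laplace_slope[OF tr[OF t] tr_slope] X_meas[OF t]
    by (simp_all add: integrable_distr_eq integral_distr)
  have b: "b = \<mu>" using mean(2)[of 1] \<mu>_eq by simp
  have lap: "integrable M (\<lambda>\<omega>. exp (- s * X t \<omega>))" "expectation (\<lambda>\<omega>. exp (- s * X t \<omega>)) = exp (t * laplace_exponent \<mu> \<sigma> s)"
    if t: "0 \<le> t" and s: "0 \<le> s" for t s
  proof -
    show "integrable M (\<lambda>\<omega>. exp (- s * X t \<omega>))"
      using has_transformsD(3)[OF tr[OF t] s] X_meas[OF t] by (subst (asm) integrable_distr_eq) auto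
    show "expectation (\<lambda>\<omega>. exp (- s * X t \<omega>)) = exp (t * laplace_exponent \<mu> \<sigma> s)"
      using has_transformsD(4)[OF tr[OF t] s] X_meas[OF t] by (subst (asm) integral_distr) (auto simp: b)
  qed
  show ?thesis
    by unfold_locales (use levy lap mean b a laplace_exponent_slope[of \<mu> \<sigma>] in auto)
qed

theorem proposition1:
  fixes M :: "'a measure" and F :: "real \<Rightarrow> 'a measure" and X :: "real \<Rightarrow> 'a \<Rightarrow> real"
    and \<nu> L :: "real measure" and \<gamma> \<sigma> \<alpha> \<mu> :: real
    and \<rho> d \<Delta> :: "real \<Rightarrow> real"
  assumes "levy_process M F X"
    and "has_levy_triplet M X \<gamma> \<sigma> \<nu>"
    and "nondeterministic \<sigma> \<nu>"
    and "spectrally_positive \<nu>"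
    and "1 < \<alpha>" and "\<alpha> < 2"
    and "regularly_varying_at_infinity (\<lambda>x. measure \<nu> {x<..}) (- \<alpha>)"
    and "\<mu> = prob_space.expectation M (X 1)"
    and "\<mu> > 0"
    and "\<And>a. a > \<mu> \<Longrightarrow> \<rho> a = \<mu> / a"
    and "\<And>x. 0 < x \<Longrightarrow> x < 1 \<Longrightarrow> d x > 0"
    and "(\<lambda>x. jump_exponent \<nu> (d x)) \<sim>[at_left 1] (\<lambda>x. d x * ((1 - x) / x) * \<mu> powr \<alpha>)"
    and "\<And>x. 0 < x \<Longrightarrow> x < 1 \<Longrightarrow> \<Delta> x = d x / \<mu>"
    and "mittag_leffler_distribution (\<alpha> - 1) L"
  shows "weak_conv_along
           (\<lambda>a. distr M borel (\<lambda>\<omega>. \<Delta> (\<rho> a) * all_time_sup X a \<omega>))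
           L
           (inf (filtercomap \<rho> (at_left 1)) (principal {\<mu><..}))"
proof -
  note levy = assms(1) and triplet = assms(2) and spos = assms(4) and \<mu>_eq = assms(8) and \<mu> = assms(9)
    and \<rho> = assms(10) and d_pos = assms(11) and d_asymp = assms(12) and \<Delta> = assms(13) and mitt = assms(14)
  interpret prob_space M by (rule levy_processD[OF levy])
  have lm: "sets \<nu> = sets borel" "emeasure \<nu> {0} = 0" "(\<integral>\<^sup>+x. ennreal (min 1 (x\<^sup>2)) \<partial>\<nu>) < \<infinity>"
    using triplet by (auto simp: has_levy_triplet_def levy_measure_def)
  have AE_pos: "AE x in \<nu>. 0 < x"
  proof -
    have "{..<0} \<in> null_sets \<nu>" "{0} \<in> null_sets \<nu>"
      using spos lm by (auto simp: spectrally_positive_def null_sets_def)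
    from this[THEN AE_not_in] show ?thesis by eventually_elim auto
  qed
  interpret rv: regularly_varying_levy_measure \<nu> \<alpha>
    by unfold_locales (use lm AE_pos assms in auto)
  have drift: "levy_negative_drift M F X (rv.laplace_exponent \<mu> \<sigma>) \<mu> a" if "\<mu> < a" for a
    by (rule rv.levy_negative_driftI[OF levy triplet \<mu>_eq that])
  define K where "K = \<sigma>\<^sup>2 / 2 + rv.r 1"
  define Lap where "Lap a s = expectation (\<lambda>\<omega>. exp (- s * all_time_sup X a \<omega>))" for a s
  define \<phi> where "\<phi> a s = (a - \<mu>) * s + \<sigma>\<^sup>2 * s\<^sup>2 / 2 + rv.r s" for a s
  \<comment> \<open>The constant \<open>K\<close> is the same for all \<open>a\<close>.\<close>
  have PK: "(a - \<mu>) * s \<le> \<phi> a s * Lap a s" "\<phi> a s * Lap a s \<le> (a - \<mu>) * s + s\<^sup>2 * K"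
    if a: "\<mu> < a" and s: "0 < s" "s \<le> 1" for a s
  proof -
    interpret D: levy_negative_drift M F X "rv.laplace_exponent \<mu> \<sigma>" \<mu> a by (rule drift[OF a])
    have phi: "D.\<phi> s = \<phi> a s" for s
      by (simp add: D.\<phi>_def rv.laplace_exponent_def rv.r_def \<phi>_def algebra_simps)
    show "(a - \<mu>) * s \<le> \<phi> a s * Lap a s"
      using D.pollaczek_khinchine_bounds(1)[OF s] by (simp add: phi Lap_def)
    show "\<phi> a s * Lap a s \<le> (a - \<mu>) * s + s\<^sup>2 * K"
      using D.pollaczek_khinchine_bounds(2)[OF s] unfolding phi by (simp add: \<phi>_def Lap_def K_def)
  qed
  have jump: "jump_exponent \<nu> s = rv.r s" for s
    unfolding jump_exponent_def rv.r_def set_lebesgue_integral_def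
    by (intro integral_cong_AE, measurable) (use AE_pos in eventually_elim, simp)
  define G where "G = inf (filtercomap \<rho> (at_left 1)) (principal {\<mu><..})"
  have ev_a: "eventually (\<lambda>a. \<mu> < a) G"
    by (simp add: G_def eventually_inf_principal)
  have \<rho>_lim: "filterlim \<rho> (at_left 1) G"
    unfolding G_def by (meson filterlim_filtercomap filterlim_mono inf.cobounded1 order_refl)
  have a_lim: "((\<lambda>a. a) \<longlongrightarrow> \<mu>) G"
  proof -
    have "(\<rho> \<longlongrightarrow> 1) G" using \<rho>_lim by (simp add: filterlim_at)
    then have "((\<lambda>a. \<mu> / \<rho> a) \<longlongrightarrow> \<mu> / 1) G" by (intro tendsto_intros) auto
    moreover have "eventually (\<lambda>a. \<mu> / \<rho> a = a) G"
      using ev_a by eventually_elim (use \<mu> in \<open>simp add: \<rho>\<close>)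
    ultimately show ?thesis by (simp add: tendsto_cong)
  qed
  define D where "D a = d (\<rho> a)" for a
  have \<rho>_range: "0 < \<rho> a" "\<rho> a < 1" if "\<mu> < a" for a
    unfolding \<rho>[OF that] using that \<mu> by simp_all
  have D_pos: "0 < D a" if "\<mu> < a" for a unfolding D_def by (rule d_pos[OF \<rho>_range[OF that]])
  \<comment> \<open>The condition on \<open>d\<close>, rewritten with \<open>(1 - \<rho> a) / \<rho> a = (a - \<mu>) / \<mu>\<close>.\<close>
  have ratio: "((\<lambda>a. rv.r (D a) / (D a * (a - \<mu>))) \<longlongrightarrow> \<mu> powr (\<alpha> - 1)) G"
  proof -
    have "eventually (\<lambda>x. d x * ((1 - x) / x) * \<mu> powr \<alpha> \<noteq> 0) (at_left 1)"
      by (rule eventually_at_leftI[of 0]) (use d_pos \<mu> in \<open>force+\<close>)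
    then have "((\<lambda>x. jump_exponent \<nu> (d x) / (d x * ((1 - x) / x) * \<mu> powr \<alpha>)) \<longlongrightarrow> 1) (at_left 1)"
      by (intro asymp_equivD_strong[OF d_asymp]) (auto elim: eventually_mono)
    from tendsto_mult_left[OF filterlim_compose[OF this \<rho>_lim], of "\<mu> powr (\<alpha> - 1)"]
    have "((\<lambda>a. \<mu> powr (\<alpha> - 1) * (rv.r (D a) / (D a * ((1 - \<rho> a) / \<rho> a) * \<mu> powr \<alpha>))) \<longlongrightarrow> \<mu> powr (\<alpha> - 1)) G"
      by (simp add: jump D_def)
    moreover have "eventually (\<lambda>a. \<mu> powr (\<alpha> - 1) * (rv.r (D a) / (D a * ((1 - \<rho> a) / \<rho> a) * \<mu> powr \<alpha>))
        = rv.r (D a) / (D a * (a - \<mu>))) G"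
      using ev_a
    proof eventually_elim
      case (elim a)
      have "(1 - \<rho> a) / \<rho> a = (a - \<mu>) / \<mu>" using elim \<mu> by (simp add: \<rho> field_simps)
      moreover have "\<mu> powr \<alpha> = \<mu> * \<mu> powr (\<alpha> - 1)" using \<mu> by (simp add: powr_diff)
      ultimately show ?case using elim \<mu> by simp
    qed
    ultimately show ?thesis by (simp add: tendsto_cong)
  qed
  \<comment> \<open>By the previous limit \<open>r (D a) / D a\<close> tends to \<open>0\<close>; as \<open>r s / s\<close> is positive and nondecreasing, this
    forces \<open>D a\<close> to tend to \<open>0\<close>.\<close>
  have D_lim: "filterlim D (at_right 0) G"
  proof -
    have "((\<lambda>a. rv.r (D a) / (D a * (a - \<mu>)) * (a - \<mu>)) \<longlongrightarrow> \<mu> powr (\<alpha> - 1) * (\<mu> - \<mu>)) G"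
      by (intro tendsto_intros ratio a_lim)
    then have lim0: "((\<lambda>a. rv.r (D a) / (D a * (a - \<mu>)) * (a - \<mu>)) \<longlongrightarrow> 0) G" by simp
    have "(D \<longlongrightarrow> 0) G"
    proof (rule order_tendstoI)
      show "eventually (\<lambda>a. y < D a) G" if "y < 0" for y
        using ev_a by eventually_elim (use D_pos that in \<open>auto intro: less_trans\<close>)
      fix \<eta> :: real assume \<eta>: "0 < \<eta>"
      have "0 < rv.r \<eta> / \<eta>" using rv.r_pos[OF \<eta>] \<eta> by simp
      from order_tendstoD(2)[OF lim0 this] ev_a show "eventually (\<lambda>a. D a < \<eta>) G"
      proof eventually_elim
        case (elim a)
        show ?case
        proof (rule ccontr)
          assume "\<not> D a < \<eta>"
          then have "rv.r (\<eta> / D a * D a) \<le> \<eta> / D a * rv.r (D a)"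
            using \<eta> D_pos[OF elim(2)] by (intro rv.r_scale_le) auto
          then have "D a * rv.r \<eta> \<le> \<eta> * rv.r (D a)"
            using D_pos[OF elim(2)] by (simp add: field_simps)
          moreover have "rv.r (D a) / (D a * (a - \<mu>)) * (a - \<mu>) = rv.r (D a) / D a"
            using elim(2) by simp
          with elim(1) have "rv.r (D a) / D a < rv.r \<eta> / \<eta>" by (simp only:)
          then have "\<eta> * rv.r (D a) < D a * rv.r \<eta>"
            using \<eta> D_pos[OF elim(2)] by (simp add: field_simps)
          ultimately show False by simp
        qed
      qed
    qed
    moreover have "eventually (\<lambda>a. D a \<in> {0<..} \<and> D a \<noteq> 0) G"
      using ev_a by eventually_elim (use D_pos in force)
    ultimately show ?thesis by (simp add: filterlim_at)
  qed
  have Lap_lim: "((\<lambda>a. Lap a (real k / \<mu> * D a)) \<longlongrightarrow> 1 / (1 + real k powr (\<alpha> - 1))) G" if k: "0 < k" for k :: nat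
  proof -
    define c where "c = real k / \<mu>"
    have c: "0 < c" using k \<mu> by (simp add: c_def)
    \<comment> \<open>With \<open>s = c * D a\<close>, both the Gaussian term and the error term of the bounds are multiples of
      \<open>s / (a - \<mu>)\<close>.\<close>
    have sm: "((\<lambda>a. c * D a / (a - \<mu>)) \<longlongrightarrow> 0) G"
    proof -
      have "((\<lambda>a. c * ((D a)\<^sup>2 / rv.r (D a)) * (rv.r (D a) / (D a * (a - \<mu>)))) \<longlongrightarrow> c * 0 * \<mu> powr (\<alpha> - 1)) G"
        by (intro tendsto_intros ratio filterlim_compose[OF rv.square_div_r_tendsto_0 D_lim])
      moreover have "eventually (\<lambda>a. c * ((D a)\<^sup>2 / rv.r (D a)) * (rv.r (D a) / (D a * (a - \<mu>))) = c * D a / (a - \<mu>)) G"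
        using ev_a
      proof eventually_elim
        case (elim a)
        show ?case using D_pos[OF elim] rv.r_pos[OF D_pos[OF elim]] by (simp add: power2_eq_square)
      qed
      ultimately show ?thesis by (simp add: tendsto_cong)
    qed
    \<comment> \<open>This is \<open>\<phi> s / ((a - \<mu>) * s)\<close> at \<open>s = c * D a\<close>.\<close>
    define p where "p a = 1 + \<sigma>\<^sup>2 / 2 * (c * D a / (a - \<mu>)) + rv.r (c * D a) / rv.r (D a) * (rv.r (D a) / (D a * (a - \<mu>))) / c" for a
    have "(p \<longlongrightarrow> 1 + \<sigma>\<^sup>2 / 2 * 0 + c powr \<alpha> * \<mu> powr (\<alpha> - 1) / c) G"
      unfolding p_def using c
      by (intro tendsto_add tendsto_mult tendsto_divide tendsto_const ratio sm
          filterlim_compose[OF rv.r_regularly_varying[OF c] D_lim]) auto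
    also have "1 + \<sigma>\<^sup>2 / 2 * 0 + c powr \<alpha> * \<mu> powr (\<alpha> - 1) / c = 1 + real k powr (\<alpha> - 1)"
    proof -
      have "c powr \<alpha> / c = c powr (\<alpha> - 1)" using c by (simp add: powr_diff)
      then have "c powr \<alpha> * \<mu> powr (\<alpha> - 1) / c = c powr (\<alpha> - 1) * \<mu> powr (\<alpha> - 1)"
        by (metis times_divide_eq_left)
      also have "\<dots> = (c * \<mu>) powr (\<alpha> - 1)" using c \<mu> by (simp add: powr_mult)
      finally show ?thesis using \<mu> by (simp add: c_def)
    qed
    finally have p_lim: "(p \<longlongrightarrow> 1 + real k powr (\<alpha> - 1)) G" .
    have lim_pos: "0 < 1 + real k powr (\<alpha> - 1)" by (simp add: add_pos_nonneg)
    have s_lim: "((\<lambda>a. c * D a) \<longlongrightarrow> c * 0) G"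
      using D_lim by (intro tendsto_intros) (simp add: filterlim_at)
    have ev_s: "eventually (\<lambda>a. c * D a \<le> 1) G"
      using order_tendstoD(2)[OF s_lim, of 1] by (auto elim: eventually_mono)
    have bounds: "eventually (\<lambda>a. 1 / p a \<le> Lap a (c * D a) \<and> Lap a (c * D a) \<le> (1 + K * (c * D a / (a - \<mu>))) / p a) G"
      using ev_a ev_s order_tendstoD(1)[OF p_lim lim_pos]
    proof eventually_elim
      case (elim a)
      define s where "s = c * D a"
      define m where "m = a - \<mu>"
      have s: "0 < s" "s \<le> 1" using elim c D_pos[OF elim(1)] by (auto simp: s_def)
      have m: "0 < m" using elim by (simp add: m_def)
      have r0: "rv.r (D a) \<noteq> 0" "D a \<noteq> 0" using rv.r_pos D_pos[OF elim(1)] by force+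
      have "p a = 1 + \<sigma>\<^sup>2 / 2 * (s / m) + rv.r s / (m * s)"
        using r0 c by (simp add: p_def s_def m_def)
      then have p_eq: "p a * (m * s) = \<phi> a s"
        using m s by (simp add: \<phi>_def m_def[symmetric] field_simps power2_eq_square)
      have "m * s \<le> p a * (m * s) * Lap a s" "p a * (m * s) * Lap a s \<le> m * s + s\<^sup>2 * K"
        using PK[OF elim(1) s, folded m_def] unfolding p_eq by simp_all
      moreover have ms: "0 < m * s" using m s by simp
      moreover have "m * s + s\<^sup>2 * K = m * s * (1 + K * (s / m))"
        using m by (simp add: field_simps power2_eq_square)
      ultimately have "m * s * 1 \<le> m * s * (p a * Lap a s)" "m * s * (p a * Lap a s) \<le> m * s * (1 + K * (s / m))"
        by (simp_all only: mult_1_right mult_ac)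
      then have "1 \<le> p a * Lap a s" "p a * Lap a s \<le> 1 + K * (s / m)"
        using mult_le_cancel_left_pos[OF ms] by blast+
      then have "1 / p a \<le> Lap a s \<and> Lap a s \<le> (1 + K * (s / m)) / p a"
        using elim(3) by (simp add: pos_divide_le_eq pos_le_divide_eq mult.commute[of "p a"])
      then show ?case by (simp only: s_def m_def)
    qed
    show ?thesis
    proof (rule tendsto_sandwich)
      show "eventually (\<lambda>a. 1 / p a \<le> Lap a (real k / \<mu> * D a)) G"
        using bounds by eventually_elim (simp add: c_def)
      show "eventually (\<lambda>a. Lap a (real k / \<mu> * D a) \<le> (1 + K * (c * D a / (a - \<mu>))) / p a) G"
        using bounds by eventually_elim (simp add: c_def)
      show "((\<lambda>a. 1 / p a) \<longlongrightarrow> 1 / (1 + real k powr (\<alpha> - 1))) G"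
        using lim_pos by (intro tendsto_intros p_lim) auto
      have "((\<lambda>a. (1 + K * (c * D a / (a - \<mu>))) / p a) \<longlongrightarrow> (1 + K * 0) / (1 + real k powr (\<alpha> - 1))) G"
        using lim_pos by (intro tendsto_intros p_lim sm) auto
      then show "((\<lambda>a. (1 + K * (c * D a / (a - \<mu>))) / p a) \<longlongrightarrow> 1 / (1 + real k powr (\<alpha> - 1))) G" by simp
    qed
  qed
  have L: "real_distribution L" "AE x in L. 0 < x"
    "\<And>s. 0 \<le> s \<Longrightarrow> (LINT x|L. exp (- s * x)) = 1 / (1 + s powr (\<alpha> - 1))"
    using mitt by (auto simp: mittag_leffler_distribution_def)
  have sup_meas: "all_time_sup X a \<in> borel_measurable M" and sup_nonneg: "AE \<omega> in M. 0 \<le> all_time_sup X a \<omega>" if "\<mu> < a" for a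
    using levy_negative_drift.measurable_all_time_sup[OF drift[OF that]]
      levy_negative_drift.all_time_sup_nonneg[OF drift[OF that]] by auto
  have \<Delta>_eq: "\<Delta> (\<rho> a) = D a / \<mu>" if "\<mu> < a" for a
    using \<Delta>[OF \<rho>_range[OF that]] by (simp add: D_def)
  let ?Y = "\<lambda>a \<omega>. \<Delta> (\<rho> a) * all_time_sup X a \<omega>"
  have "weak_conv_along (\<lambda>a. distr M borel (?Y a)) L G"
  proof (rule laplace_continuity_along[OF L(1)])
    show "AE x in L. 0 \<le> x" using L(2) by eventually_elim simp
    show "eventually (\<lambda>a. real_distribution (distr M borel (?Y a)) \<and> (AE x in distr M borel (?Y a). 0 \<le> x)) G"
      using ev_a
    proof eventually_elim
      case (elim a)
      have [measurable]: "all_time_sup X a \<in> borel_measurable M" by (rule sup_meas[OF elim])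
      have "real_distribution (distr M borel (?Y a))" by (rule real_distribution_distr) measurable
      moreover have "AE x in distr M borel (?Y a). 0 \<le> x"
        using sup_nonneg[OF elim] D_pos[OF elim] \<mu> by (subst AE_distr_iff) (auto simp: \<Delta>_eq[OF elim] elim!: eventually_mono)
      ultimately show ?case ..
    qed
    fix k :: nat assume k: "0 < k"
    have "eventually (\<lambda>a. Lap a (real k / \<mu> * D a) = (LINT x|distr M borel (?Y a). exp (- real k * x))) G"
      using ev_a
    proof eventually_elim
      case (elim a)
      have [measurable]: "all_time_sup X a \<in> borel_measurable M" by (rule sup_meas[OF elim])
      show ?case by (subst integral_distr) (auto simp: Lap_def \<Delta>_eq[OF elim] mult.assoc)
    qed
    from tendsto_cong[OF this] Lap_lim[OF k]
    show "((\<lambda>a. LINT x|distr M borel (?Y a). exp (- real k * x)) \<longlongrightarrow> (LINT x|L. exp (- real k * x))) G"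
      using L(3)[of "real k"] by simp
  qed
  then show ?thesis by (simp add: G_def)
qed

end
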